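(* Let $T>0$. Suppose that $u$, $v$ are strong solutions of the Navier--Stokes equations on $(0,T)$ and let $w:=u-v$. Then $$\|w(t_2)\|^2\le\|w(t_1)\|^2\exp\left(\frac12\int_{t_1}^{t_2}\|u(s)\|_\infty^2\,ds\right)$$ for $t_1,t_2\in(0,T)$ with $t_1<t_2$.
   Context: All function spaces are over $\mathbb{R}^3$; $\int=\int_{\mathbb{R}^3}$; $\|\cdot\|_\infty$ is the $L^\infty$ norm and $\|\cdot\|$ is the $L^2$ norm. A vector field $v$ is weakly divergence free if $\int v\cdot\nabla g=0$ for all $g\in C_0^\infty(\mathbb{R}^3)$. The Navier--Stokes equations (viscosity $1$) are $\partial_tu-\Delta u+\nabla p=-(u\cdot\nabla)u$, $\operatorname{div}u=0$. A function $u$ is a strong solution of the Navier--Stokes equations on $(0,T)$ if $u\in C((0,T);L^2)\cap C((0,T);L^\infty)$, $u(t)$ is weakly divergence free for each $t\in(0,T)$, and for some $p\in L^1_{loc}(\mathbb{R}^3\times(0,T))$ $$\int_0^T\!\!\int\big(u\cdot(f_t+\Delta f)+p\,\operatorname{div}f\big)=-\int_0^T\!\!\int u\cdot(u\cdot\nabla)f\qquad\text{for all }f\in C_0^\infty(\mathbb{R}^3\times(0,T);\mathbb{R}^3).$$ *)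

theory Defs
  imports "HOL-Analysis.Analysis" "HOL-Probability.Essential_Supremum"
begin

section \<open>Smooth functions and test functions\<close>

text \<open>The symbol \<open>deriv_along h f x\<close> is the derivative of \<open>f\<close> at \<open>x\<close> in direction \<open>h\<close>. It is only
  meaningful where \<open>f\<close> is differentiable.\<close>

definition deriv_along ::
    "'a::real_normed_vector \<Rightarrow> ('a \<Rightarrow> 'b::real_normed_vector) \<Rightarrow> 'a \<Rightarrow> 'b" where
  "deriv_along h f = (\<lambda>x. frechet_derivative f (at x) h)"

fun C_times :: "nat \<Rightarrow> ('a::real_normed_vector \<Rightarrow> 'b::real_normed_vector) \<Rightarrow> bool" where
  "C_times 0 f \<longleftrightarrow> continuous_on UNIV f"
| "C_times (Suc n) f \<longleftrightarrow>
     (\<forall>x. f differentiable (at x)) \<and> (\<forall>h. C_times n (deriv_along h f))"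

text \<open>The elements of \<open>C\<^sub>0\<^sup>\<infinity>(\<Omega>)\<close> are represented by their extensions by zero to the whole space.\<close>

definition test_functions ::
    "'a::real_normed_vector set \<Rightarrow> ('a \<Rightarrow> 'b::real_normed_vector) set" where
  "test_functions \<Omega> =
     {f. (\<forall>n. C_times n f) \<and> compact (closure {x. f x \<noteq> 0}) \<and> closure {x. f x \<noteq> 0} \<subseteq> \<Omega>}"


section \<open>Lebesgue spaces of vector fields\<close>

text \<open>Elements of \<open>L\<^sup>2\<close> and \<open>L\<^sup>\<infinity>\<close> are given by representatives; two representatives agreeing
  almost everywhere are not identified, but no notion below distinguishes between them.\<close>

type_synonym vfield = "real^3 \<Rightarrow> real^3"

definition L2 :: "vfield set" where
  "L2 = {f \<in> borel_measurable lebesgue. integrable lebesgue (\<lambda>x. (norm (f x))\<^sup>2)}"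

definition L2_norm :: "vfield \<Rightarrow> real" where
  "L2_norm f = sqrt (LINT x|lebesgue. (norm (f x))\<^sup>2)"

definition Linf :: "vfield set" where
  "Linf = {f \<in> borel_measurable lebesgue. esssup lebesgue (\<lambda>x. ereal (norm (f x))) < \<infinity>}"

definition Linf_norm :: "vfield \<Rightarrow> real" where
  "Linf_norm f = real_of_ereal (esssup lebesgue (\<lambda>x. ereal (norm (f x))))"

definition continuous_curve ::
    "real set \<Rightarrow> vfield set \<Rightarrow> (vfield \<Rightarrow> real) \<Rightarrow> (real \<Rightarrow> vfield) \<Rightarrow> bool" where
  "continuous_curve I X nrm u \<longleftrightarrow>
     (\<forall>t\<in>I. u t \<in> X) \<and>
     (\<forall>t\<in>I. ((\<lambda>s. nrm (\<lambda>x. u s x - u t x)) \<longlongrightarrow> 0) (at t within I))"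


section \<open>Strong solutions of the Navier--Stokes equations\<close>

definition gradient :: "(real^3 \<Rightarrow> real) \<Rightarrow> vfield" where
  "gradient g x = (\<chi> j. deriv_along (axis j 1) g x)"

definition weakly_divergence_free :: "vfield \<Rightarrow> bool" where
  "weakly_divergence_free v \<longleftrightarrow>
     (\<forall>g\<in>test_functions UNIV. (LINT x|lebesgue. v x \<bullet> gradient g x) = 0)"

text \<open>Differential operators for functions of a space-time variable \<open>(x, t)\<close>. Apart from
  \<open>time_deriv\<close>, they act on \<open>x\<close> only.\<close>

definition time_deriv ::
    "((real^3) \<times> real \<Rightarrow> 'b::real_normed_vector) \<Rightarrow> (real^3) \<times> real \<Rightarrow> 'b" where
  "time_deriv = deriv_along (0, 1)"

definition space_deriv ::
    "3 \<Rightarrow> ((real^3) \<times> real \<Rightarrow> 'b::real_normed_vector) \<Rightarrow> (real^3) \<times> real \<Rightarrow> 'b" where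
  "space_deriv j = deriv_along (axis j 1, 0)"

definition laplacian ::
    "((real^3) \<times> real \<Rightarrow> 'b::real_normed_vector) \<Rightarrow> (real^3) \<times> real \<Rightarrow> 'b" where
  "laplacian f z = (\<Sum>j\<in>UNIV. space_deriv j (space_deriv j f) z)"

definition divergence :: "((real^3) \<times> real \<Rightarrow> real^3) \<Rightarrow> (real^3) \<times> real \<Rightarrow> real" where
  "divergence f z = (\<Sum>j\<in>UNIV. space_deriv j f z $ j)"

text \<open>\<open>advection a f z\<close> is \<open>(a \<cdot> \<nabla>)f\<close> at the point \<open>z\<close>.\<close>

definition advection ::
    "real^3 \<Rightarrow> ((real^3) \<times> real \<Rightarrow> real^3) \<Rightarrow> (real^3) \<times> real \<Rightarrow> real^3" where
  "advection a f z = (\<Sum>j\<in>UNIV. (a $ j) *\<^sub>R space_deriv j f z)"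

definition locally_integrable_on ::
    "('a::euclidean_space \<Rightarrow> real) \<Rightarrow> 'a set \<Rightarrow> bool" where
  "locally_integrable_on p \<Omega> \<longleftrightarrow> (\<forall>K. compact K \<and> K \<subseteq> \<Omega> \<longrightarrow> p absolutely_integrable_on K)"

text \<open>The space-time integrals are iterated ones, so that the equation depends only on the classes
  of the \<open>u t\<close>: representatives of the individual \<open>u t\<close> need not be jointly measurable in \<open>(x, t)\<close>.
  For the pressure term, the slices over which \<open>p\<close> fails to be integrable against \<open>div f\<close> form
  a null set of times and do not matter.\<close>

definition strong_solution :: "real \<Rightarrow> (real \<Rightarrow> vfield) \<Rightarrow> bool" where
  "strong_solution T u \<longleftrightarrow>
     continuous_curve {0<..<T} L2 L2_norm u \<and>
     continuous_curve {0<..<T} Linf Linf_norm u \<and>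
     (\<forall>t\<in>{0<..<T}. weakly_divergence_free (u t)) \<and>
     (\<exists>p. locally_integrable_on p (UNIV \<times> {0<..<T}) \<and>
        (\<forall>f\<in>test_functions (UNIV \<times> {0<..<T}).
           (LINT t:{0<..<T}|lebesgue. LINT x|lebesgue.
              u t x \<bullet> (time_deriv f (x, t) + laplacian f (x, t)) + p (x, t) * divergence f (x, t))
           = - (LINT t:{0<..<T}|lebesgue. LINT x|lebesgue.
              u t x \<bullet> advection (u t x) f (x, t))))"

end

theory Submission
  imports Defs "HOL-Computational_Algebra.Polynomial"
begin

text \<open>Mollify the difference \<open>w = u - v\<close> in space with an even kernel \<open>\<eta>\<close> and test the difference of the
  two equations with \<open>\<eta> * \<eta> * w\<close>. With \<open>D = \<nabla>(\<eta> * w)\<close> this gives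
  \<open>1/2 d/dt \<parallel>\<eta> * w\<parallel>\<^sup>2 = - \<parallel>D\<parallel>\<^sup>2 + \<langle>\<eta> * (u \<otimes> w + w \<otimes> v), D\<rangle>\<close>.
  Replacing \<open>\<eta> * (w \<otimes> v)\<close> by \<open>(\<eta> * w) \<otimes> v\<close> makes that term vanish, as \<open>v\<close> is divergence free; the error tends
  to 0 in \<open>L\<^sup>2\<close> and, like the term with \<open>u \<otimes> w\<close>, is absorbed by \<open>- \<parallel>D\<parallel>\<^sup>2\<close>. So no bound on \<open>\<nabla>w\<close> is
  needed, and in the limit \<open>\<parallel>w\<parallel>\<^sup>2\<close> grows at most at the rate \<open>1/2 \<parallel>u\<parallel>\<^sub>\<infinity>\<^sup>2 \<parallel>w\<parallel>\<^sup>2\<close>, whence the claim by Gronwall.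

  The test field does not have compact support, and a cutoff would bring back the uncontrolled pressure. A
  divergence free field is therefore first written as the divergence of an antisymmetric matrix, and the cutoff
  is applied to that matrix.\<close>

section \<open>Smooth functions\<close>

text \<open>Neither \<open>u\<close> nor \<open>v\<close> is differentiable in time, and the weak
  equation is used only with products of a scalar function of time and a fixed spatial field. So W =
  \<open>\<eta>\<close> * w is never tested with itself at varying times: the identity |W(c)|^2 -
  |W(a)|^2 = <W(c) - W(a), W(a) + W(c)> needs one frozen field per pair of times, and the derivative
  of the energy follows as a and c close in on a point.

  The second \<open>\<eta>\<close> in the test field also repairs the truncation: cutting off the
  antisymmetric matrix yields fields that are known to be divergence free only weakly, and one more
  convolution makes them smooth. As \<open>\<eta>\<close> is even, it can be moved over to the
  solution.

  The constant 1/2 is twice 1/4: completing the square gives c d - d^2 <= c^2 / 4, and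
  differentiating the squared norm doubles it. Only the norm of \<open>u\<close> survives because
  u_i u_j - v_i v_j = u_i w_j + w_i v_j leaves to \<open>v\<close> just the transport term. Both
  halves of the commutator error have the same L^2 limit w_i v_j since \<open>v\<close> is bounded;
  no rate is required, because D is absorbed completely for each kernel.\<close>

definition smooth :: "('a::real_normed_vector \<Rightarrow> 'b::real_normed_vector) \<Rightarrow> bool" where
  "smooth f \<longleftrightarrow> (\<forall>n. C_times n f)"

lemma deriv_along_eq: "(f has_derivative f') (at x) \<Longrightarrow> deriv_along h f x = f' h"
  unfolding deriv_along_def by (metis frechet_derivative_at)

lemma differentiable_has_deriv_along:
  "f differentiable (at x) \<Longrightarrow> (f has_derivative (\<lambda>h. deriv_along h f x)) (at x)"
  unfolding deriv_along_def by (metis frechet_derivative_works)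

lemma deriv_along_locally_constant:
  assumes "open A" "x \<in> A" "\<And>y. y \<in> A \<Longrightarrow> f y = c"
  shows "deriv_along h f x = 0"
proof -
  have "((\<lambda>y. c) has_derivative (\<lambda>h. 0)) (at x)" by simp
  then have "(f has_derivative (\<lambda>h. 0)) (at x)"
    by (rule has_derivative_transform_within_open[OF _ assms(1,2)]) (simp add: assms(3))
  then show ?thesis by (rule deriv_along_eq)
qed

lemma C_times_SucI:
  assumes "\<And>x. (f has_derivative f' x) (at x)" "\<And>h. C_times n (\<lambda>x. f' x h)"
  shows "C_times (Suc n) f"
proof -
  have "deriv_along h f = (\<lambda>x. f' x h)" for h
    using assms(1) deriv_along_eq by blast
  then show ?thesis
    using assms by (auto simp: differentiable_def)
qed

lemma C_times_continuous: "C_times n f \<Longrightarrow> continuous_on UNIV f"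
  by (cases n) (auto simp: continuous_on_eq_continuous_at differentiable_imp_continuous_within)

lemma C_times_SucD: "C_times (Suc n) f \<Longrightarrow> C_times n f"
proof (induction n arbitrary: f)
  case 0
  then show ?case by (metis C_times.simps(1) C_times_continuous)
next
  case (Suc n)
  then show ?case by (metis C_times.simps(2))
qed

lemma C_times_const: "C_times n (\<lambda>x. c)"
proof (induction n arbitrary: c)
  case (Suc n)
  then show ?case
    by (intro C_times_SucI[where f' = "\<lambda>_ _. 0"]) (auto intro: derivative_eq_intros)
qed auto

lemma C_times_linear: "bounded_linear L \<Longrightarrow> C_times n L"
proof (cases n)
  case (Suc m)
  assume "bounded_linear L"
  then show ?thesis unfolding Suc
    by (intro C_times_SucI[where f' = "\<lambda>_. L"] C_times_const) (auto intro: bounded_linear_imp_has_derivative)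
qed (auto intro: linear_continuous_on)

lemma C_times_add: "C_times n f \<Longrightarrow> C_times n g \<Longrightarrow> C_times n (\<lambda>x. f x + g x)"
proof (induction n arbitrary: f g)
  case (Suc n)
  show ?case
    using Suc
    by (intro C_times_SucI[where f' = "\<lambda>x h. deriv_along h f x + deriv_along h g x"])
      (auto intro!: has_derivative_add differentiable_has_deriv_along)
qed (auto intro: continuous_on_add)

lemma C_times_scaleR:
  fixes f :: "'a::real_normed_vector \<Rightarrow> real"
  shows "C_times n f \<Longrightarrow> C_times n g \<Longrightarrow> C_times n (\<lambda>x. f x *\<^sub>R g x)"
proof (induction n arbitrary: f g)
  case (Suc n)
  \<comment> \<open>The product rule reproduces \<open>f\<close> and \<open>g\<close>
    undifferentiated, so their own regularity first has to be lowered by one order.\<close>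
  show ?case
    using Suc C_times_SucD[of n f] C_times_SucD[of n g]
    by (intro C_times_SucI[where f' = "\<lambda>x h. f x *\<^sub>R deriv_along h g x + deriv_along h f x *\<^sub>R g x"]
          C_times_add Suc.IH)
      (auto intro!: has_derivative_scaleR differentiable_has_deriv_along)
qed (auto intro: continuous_on_scaleR)

lemma C_times_affine:
  assumes "bounded_linear L"
  shows "C_times n f \<Longrightarrow> C_times n (\<lambda>x. f (L x + c))"
proof (induction n arbitrary: f)
  case 0
  have "continuous_on UNIV (\<lambda>x. L x + c)"
    using assms by (intro continuous_intros linear_continuous_on)
  then show ?case using 0 by (auto intro: continuous_on_compose2)
next
  case (Suc n)
  have "((\<lambda>x. f (L x + c)) has_derivative (\<lambda>h. deriv_along (L h) f (L x + c))) (at x)" for x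
  proof (rule has_derivative_compose[where f = "\<lambda>x. L x + c" and f' = L])
    show "((\<lambda>x. L x + c) has_derivative L) (at x)"
      using bounded_linear_imp_has_derivative[OF assms] by (auto intro!: derivative_eq_intros)
    show "(f has_derivative (\<lambda>h. deriv_along h f (L x + c))) (at (L x + c))"
      using Suc by (auto intro: differentiable_has_deriv_along)
  qed
  then show ?case
    using Suc by (intro C_times_SucI[where f' = "\<lambda>x h. deriv_along (L h) f (L x + c)"]) auto
qed

text \<open>With an outer function of one real variable, the chain rule gives a scalar derivative of
  \<open>q\<close> times a composition of the same kind. The induction on the order then closes with
  products alone.\<close>

lemma has_derivative_compose_real:
  fixes f :: "real \<Rightarrow> 'b::real_normed_vector"
  assumes "f differentiable (at (q x))" "q differentiable (at x)"
  shows "((\<lambda>x. f (q x)) has_derivative (\<lambda>h. deriv_along h q x *\<^sub>R deriv_along 1 f (q x))) (at x)"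
proof -
  have 1: "(f has_derivative (\<lambda>h. deriv_along h f (q x))) (at (q x))"
    by (rule differentiable_has_deriv_along[OF assms(1)])
  have "deriv_along h f (q x) = h *\<^sub>R deriv_along 1 f (q x)" for h
    using linear_scale[OF has_derivative_linear[OF 1], of h 1] by simp
  then have "(\<lambda>h. deriv_along (deriv_along h q x) f (q x)) =
      (\<lambda>h. deriv_along h q x *\<^sub>R deriv_along 1 f (q x))"
    by blast
  then show ?thesis
    using has_derivative_compose[OF differentiable_has_deriv_along[OF assms(2)] 1] by metis
qed

lemma C_times_compose_real:
  fixes f :: "real \<Rightarrow> 'b::real_normed_vector"
  shows "C_times n f \<Longrightarrow> C_times n q \<Longrightarrow> C_times n (\<lambda>x. f (q x))"
proof (induction n arbitrary: f q)
  case 0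
  then show ?case by (auto intro: continuous_on_compose2)
next
  case (Suc n)
  then show ?case
    using C_times_SucD[of n q]
    by (intro C_times_SucI[where f' = "\<lambda>x h. deriv_along h q x *\<^sub>R deriv_along 1 f (q x)"] C_times_scaleR
          has_derivative_compose_real) auto
qed

lemma smooth_differentiable: "smooth f \<Longrightarrow> f differentiable (at x)"
  unfolding smooth_def by (metis C_times.simps(2))

lemma smooth_has_derivative: "smooth f \<Longrightarrow> (f has_derivative (\<lambda>h. deriv_along h f x)) (at x)"
  by (intro differentiable_has_deriv_along smooth_differentiable)

lemma smooth_deriv_along: "smooth f \<Longrightarrow> smooth (deriv_along h f)"
  unfolding smooth_def by (metis C_times.simps(2))

lemma smooth_continuous: "smooth f \<Longrightarrow> continuous_on A f"
  unfolding smooth_def by (meson C_times.simps(1) continuous_on_subset subset_UNIV)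

lemma smoothI_derivative:
  assumes "\<And>x. (f has_derivative f' x) (at x)" "\<And>h. smooth (\<lambda>x. f' x h)"
  shows "smooth f"
  unfolding smooth_def
proof
  fix n show "C_times n f"
    using C_times_SucI[of f f' n] assms C_times_SucD unfolding smooth_def by blast
qed

lemma smooth_const [simp]: "smooth (\<lambda>x. c)"
  by (simp add: smooth_def C_times_const)

lemma smooth_linear: "bounded_linear L \<Longrightarrow> smooth L"
  by (simp add: smooth_def C_times_linear)

lemma smooth_add: "smooth f \<Longrightarrow> smooth g \<Longrightarrow> smooth (\<lambda>x. f x + g x)"
  by (simp add: smooth_def C_times_add)

lemma smooth_scaleR:
  fixes f :: "'a::real_normed_vector \<Rightarrow> real"
  shows "smooth f \<Longrightarrow> smooth g \<Longrightarrow> smooth (\<lambda>x. f x *\<^sub>R g x)"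
  by (simp add: smooth_def C_times_scaleR)

lemma smooth_mult:
  fixes f g :: "'a::real_normed_vector \<Rightarrow> real"
  shows "smooth f \<Longrightarrow> smooth g \<Longrightarrow> smooth (\<lambda>x. f x * g x)"
  using smooth_scaleR[of f g] by simp

lemma smooth_diff: "smooth f \<Longrightarrow> smooth g \<Longrightarrow> smooth (\<lambda>x. f x - g x)"
  using smooth_add[of f "\<lambda>x. (-1) *\<^sub>R g x"] smooth_scaleR[of "\<lambda>x. -1" g] by simp

lemma smooth_sum: "(\<And>i. i \<in> A \<Longrightarrow> smooth (f i)) \<Longrightarrow> smooth (\<lambda>x. \<Sum>i\<in>A. f i x)"
  by (induction A rule: infinite_finite_induct) (auto intro: smooth_add)

lemma smooth_affine: "bounded_linear L \<Longrightarrow> smooth f \<Longrightarrow> smooth (\<lambda>x. f (L x + c))"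
  by (simp add: smooth_def C_times_affine)

lemma smooth_compose_real:
  fixes f :: "real \<Rightarrow> 'b::real_normed_vector"
  shows "smooth f \<Longrightarrow> smooth q \<Longrightarrow> smooth (\<lambda>x. f (q x))"
  by (simp add: smooth_def C_times_compose_real)

lemma smooth_inner_self: "smooth (\<lambda>x::real^3. x \<bullet> x)"
proof -
  have "smooth (\<lambda>x::real^3. \<Sum>i\<in>UNIV. (x $ i) * (x $ i))"
    by (intro smooth_sum smooth_mult) (intro smooth_linear bounded_linear_vec_nth)+
  then show ?thesis
    by (simp add: inner_vec_def)
qed

section \<open>A smooth step function\<close>

text \<open>This family of functions is closed under differentiation.\<close>

definition exp_cusp :: "real poly \<Rightarrow> real \<Rightarrow> real" where
  "exp_cusp p t = (if t > 0 then poly p (1/t) * exp (- (1/t)) else 0)"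

lemma poly_exp_decay: "((\<lambda>x::real. poly p x * exp (- x)) \<longlongrightarrow> 0) at_top"
proof -
  have "((\<lambda>x::real. \<Sum>i\<le>degree p. coeff p i * (x ^ i / exp x)) \<longlongrightarrow> (\<Sum>i\<le>degree p. coeff p i * 0)) at_top"
    by (intro tendsto_sum tendsto_mult tendsto_const tendsto_power_div_exp_0)
  moreover have "poly p x * exp (- x) = (\<Sum>i\<le>degree p. coeff p i * (x ^ i / exp x))" for x :: real
    by (simp add: poly_altdef exp_minus sum_distrib_right divide_inverse mult.assoc)
  ultimately show ?thesis by simp
qed

text \<open>With s = 1/t, differentiation in s turns p(s) exp(-s) into (p' - p)(s) exp(-s), and
  ds/dt = - s^2. The factor s^2 is the polynomial \<open>[:0,0,1:]\<close>. At t = 0 only the decay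
  of exp(-s) against polynomials is used.\<close>

lemma exp_cusp_has_derivative:
  "(exp_cusp p has_real_derivative exp_cusp ([:0,0,1:] * (p - pderiv p)) t) (at t)"
proof (cases t "0::real" rule: linorder_cases)
  case less
  have "((\<lambda>t. 0) has_real_derivative exp_cusp ([:0,0,1:] * (p - pderiv p)) t) (at t)"
    using less by (simp add: exp_cusp_def)
  then show ?thesis
    by (rule has_field_derivative_transform_within_open[where S = "{..<0}"])
      (use less in \<open>auto simp: exp_cusp_def\<close>)
next
  case greater
  have "((\<lambda>t. poly p (1/t)) has_real_derivative poly (pderiv p) (1/t) * (- (1 / t\<^sup>2))) (at t)"
    using greater
    by (intro DERIV_chain2[OF poly_DERIV]) (auto intro!: derivative_eq_intros simp: power2_eq_square)
  moreover have "((\<lambda>t. exp (- (1/t))) has_real_derivative exp (- (1/t)) * (1 / t\<^sup>2)) (at t)"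
    using greater by (auto intro!: derivative_eq_intros simp: power2_eq_square)
  ultimately have "((\<lambda>t. poly p (1/t) * exp (- (1/t))) has_real_derivative
      poly p (1/t) * (exp (- (1/t)) * (1 / t\<^sup>2)) + poly (pderiv p) (1/t) * (- (1 / t\<^sup>2)) * exp (- (1/t))) (at t)"
    by (rule DERIV_mult')
  moreover have "exp_cusp ([:0,0,1:] * (p - pderiv p)) t =
      poly p (1/t) * (exp (- (1/t)) * (1 / t\<^sup>2)) + poly (pderiv p) (1/t) * (- (1 / t\<^sup>2)) * exp (- (1/t))"
    using greater by (simp add: exp_cusp_def power2_eq_square algebra_simps)
  ultimately have "((\<lambda>t. poly p (1/t) * exp (- (1/t))) has_real_derivative
      exp_cusp ([:0,0,1:] * (p - pderiv p)) t) (at t)"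
    by simp
  then show ?thesis
    by (rule has_field_derivative_transform_within_open[where S = "{0<..}"])
      (use greater in \<open>auto simp: exp_cusp_def\<close>)
next
  case equal
  have "((\<lambda>t. exp_cusp p t / t) \<longlongrightarrow> 0) (at_right 0)"
  proof -
    \<comment> \<open>Under t = 1/x the difference quotient at 0 becomes x p(x) exp(-x), hence the
      polynomial \<open>pCons 0 p\<close>.\<close>
    have "((\<lambda>x. exp_cusp p (inverse x) / inverse x) \<longlongrightarrow> 0) at_top"
    proof (rule Lim_transform_eventually[OF poly_exp_decay[of "pCons 0 p"]])
      show "\<forall>\<^sub>F x in at_top. poly (pCons 0 p) x * exp (- x) = exp_cusp p (inverse x) / inverse x"
        using eventually_gt_at_top[of "0::real"]
        by eventually_elim (auto simp: exp_cusp_def field_simps)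
    qed
    then show ?thesis by (simp add: filterlim_at_right_to_top)
  qed
  moreover have "((\<lambda>t. exp_cusp p t / t) \<longlongrightarrow> 0) (at_left 0)"
    by (rule Lim_transform_eventually[OF tendsto_const])
      (auto simp: exp_cusp_def eventually_at_filter)
  ultimately have "((\<lambda>t. exp_cusp p t / t) \<longlongrightarrow> 0) (at 0)"
    by (simp add: filterlim_split_at)
  then show ?thesis
    unfolding equal by (simp add: DERIV_def exp_cusp_def)
qed

lemma smooth_exp_cusp: "smooth (exp_cusp p)"
  unfolding smooth_def
proof
  fix n show "C_times n (exp_cusp p)"
  proof (induction n arbitrary: p)
    case 0
    show ?case
      using exp_cusp_has_derivative DERIV_isCont continuous_at_imp_continuous_on by (metis C_times.simps(1))
  next
    case (Suc n)
    show ?case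
      using exp_cusp_has_derivative[of p] Suc
      by (intro C_times_SucI[where f' = "\<lambda>x h. exp_cusp ([:0,0,1:] * (p - pderiv p)) x *\<^sub>R h"] C_times_scaleR C_times_const)
        (auto simp: has_field_derivative_def)
  qed
qed

text \<open>The step is a normalised antiderivative of a smooth \<open>b\<close> that is positive
  exactly on the open unit interval. Its derivative is recorded as nonnegative because rescaled
  copies of it later act as averaging weights in time.\<close>

lemma smooth_step_exists:
  obtains S :: "real \<Rightarrow> real"
  where "smooth S" "\<And>t. t \<le> 0 \<Longrightarrow> S t = 0" "\<And>t. 1 \<le> t \<Longrightarrow> S t = 1"
    "\<And>t. 0 \<le> S t" "\<And>t. S t \<le> 1" "\<And>t. 0 \<le> deriv_along 1 S t"
proof -
  define b where "b t = exp_cusp 1 t * exp_cusp 1 (1 - t)" for t :: real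
  have sb: "smooth b"
    unfolding b_def
    using smooth_affine[OF bounded_linear_minus[OF bounded_linear_ident] smooth_exp_cusp[of 1], of 1]
    by (intro smooth_mult smooth_exp_cusp) (simp add: add.commute)
  have b0: "b t \<ge> 0" for t
    by (simp add: b_def exp_cusp_def)
  have bpos: "b t > 0" if "0 < t" "t < 1" for t
    using that by (simp add: b_def exp_cusp_def)
  have bz: "b t = 0" if "t \<le> 0 \<or> 1 \<le> t" for t
    using that by (auto simp: b_def exp_cusp_def)
  obtain F where F: "\<And>t. (F has_real_derivative b t) (at t)"
    using einterval_antiderivative[of "-\<infinity>" \<infinity> b] smooth_continuous[OF sb, of UNIV]
    by (auto simp: has_real_derivative_iff_has_vector_derivative continuous_on_eq_continuous_at)
  have mono: "F s \<le> F t" if "s \<le> t" for s t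
    using DERIV_nonneg_imp_nondecreasing[OF that, of F] F b0 by blast
  have Fc: "continuous_on A F" for A
    using F DERIV_isCont continuous_at_imp_continuous_on by blast
  have less: "F 0 < F 1"
    using F bpos Fc by (intro DERIV_pos_imp_increasing_open[of 0 1 F]) auto
  have Fd0: "(F has_real_derivative 0) (at t)" if "t \<le> 0 \<or> 1 \<le> t" for t
    using F[of t] bz[OF that] by simp
  have left: "F t = F 0" if "t \<le> 0" for t
  proof (cases "t < 0")
    case True
    then show ?thesis
      using DERIV_isconst_end[OF True Fc] Fd0 by (metis less_imp_le)
  qed (use that in simp)
  have right: "F t = F 1" if "1 \<le> t" for t
  proof (cases "1 < t")
    case True
    then show ?thesis
      using DERIV_isconst_end[OF True Fc] Fd0 by (metis less_imp_le)
  qed (use that in simp)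
  define S where "S t = (F t - F 0) / (F 1 - F 0)" for t
  have dS: "(S has_derivative (\<lambda>h. (b t / (F 1 - F 0)) *\<^sub>R h)) (at t)" for t
  proof -
    have "((\<lambda>t. F t - F 0) has_real_derivative b t) (at t)"
      using F[of t] by (auto intro!: derivative_eq_intros)
    from DERIV_cdivide[OF this, of "F 1 - F 0"] show ?thesis
      unfolding S_def[abs_def] has_field_derivative_def real_scaleR_def .
  qed
  have "smooth (\<lambda>x. (b x / (F 1 - F 0)) *\<^sub>R h)" for h :: real
    using smooth_mult[OF sb, of "\<lambda>_. h / (F 1 - F 0)"] by simp
  then have "smooth S"
    by (rule smoothI_derivative[OF dS])
  moreover have "deriv_along 1 S t \<ge> 0" for t
    using deriv_along_eq[OF dS] b0 less by simp
  moreover have "0 \<le> S t" "S t \<le> 1" for t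
    using mono[of 0 t] mono[of t 1] left[of t] right[of t] less unfolding S_def
    by (cases "t \<le> 0"; cases "1 \<le> t"; simp)+
  moreover have "S t = 0" if "t \<le> 0" for t
    using left[OF that] by (simp add: S_def)
  moreover have "S t = 1" if "1 \<le> t" for t
    using right[OF that] less by (simp add: S_def)
  ultimately show thesis
    using that by blast
qed

section \<open>Square integrable functions\<close>

text \<open>Functions are Borel and integrals are over \<open>lborel\<close>, so that integrands
  such as \<open>k (x - y) * f y\<close> are jointly measurable without null set corrections. The
  passage from \<open>lebesgue\<close> is made separately, through Borel representatives.\<close>

definition sq :: "('a::euclidean_space \<Rightarrow> real) \<Rightarrow> bool" where
  "sq f \<longleftrightarrow> f \<in> borel_measurable borel \<and> integrable lborel (\<lambda>x. (f x)\<^sup>2)"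

definition ip :: "('a::euclidean_space \<Rightarrow> real) \<Rightarrow> ('a \<Rightarrow> real) \<Rightarrow> real" where
  "ip f g = (LINT x|lborel. f x * g x)"

definition nrm :: "('a::euclidean_space \<Rightarrow> real) \<Rightarrow> real" where
  "nrm f = sqrt (ip f f)"

lemma sq_measurable [measurable_dest]: "sq f \<Longrightarrow> f \<in> borel_measurable borel"
  by (simp add: sq_def)

lemma sq_integrable: "sq f \<Longrightarrow> integrable lborel (\<lambda>x. (f x)\<^sup>2)"
  by (simp add: sq_def)

lemma sq_dominated:
  assumes "sq g" "f \<in> borel_measurable borel" "\<And>x. \<bar>f x\<bar> \<le> \<bar>g x\<bar>"
  shows "sq f"
proof -
  have "(f x)\<^sup>2 \<le> (g x)\<^sup>2" for x
    using assms(3) abs_le_square_iff by blast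
  then have "integrable lborel (\<lambda>x. (f x)\<^sup>2)"
    using assms(2) by (intro Bochner_Integration.integrable_bound[OF sq_integrable[OF assms(1)]]) auto
  then show ?thesis using assms(2) by (simp add: sq_def)
qed

lemma abs_mult_le_squares: "\<bar>a * b\<bar> \<le> a\<^sup>2 + b\<^sup>2" for a b :: real
proof -
  have "2 * (\<bar>a\<bar> * \<bar>b\<bar>) \<le> a\<^sup>2 + b\<^sup>2"
    using sum_squares_bound[of "\<bar>a\<bar>" "\<bar>b\<bar>"] by (simp add: mult.assoc)
  moreover have "0 \<le> \<bar>a\<bar> * \<bar>b\<bar>" by simp
  ultimately show ?thesis unfolding abs_mult by linarith
qed

lemma sq_mult_integrable:
  assumes "sq f" "sq g"
  shows "integrable lborel (\<lambda>x. f x * g x)"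
proof (rule Bochner_Integration.integrable_bound)
  show "integrable lborel (\<lambda>x. (f x)\<^sup>2 + (g x)\<^sup>2)"
    using assms by (intro Bochner_Integration.integrable_add sq_integrable)
  show "(\<lambda>x. f x * g x) \<in> borel_measurable lborel"
    using assms by (auto dest: sq_measurable)
  show "AE x in lborel. norm (f x * g x) \<le> norm ((f x)\<^sup>2 + (g x)\<^sup>2)"
    using abs_mult_le_squares by (intro AE_I2) simp
qed

lemma sq_zero [simp]: "sq (\<lambda>x. 0)"
  by (simp add: sq_def)

lemma sq_cmult: "sq f \<Longrightarrow> sq (\<lambda>x. c * f x)"
  by (auto simp: sq_def power_mult_distrib)

lemma sq_minus: "sq f \<Longrightarrow> sq (\<lambda>x. - f x)"
  using sq_cmult[of f "-1"] by simp

lemma sq_abs: "sq f \<Longrightarrow> sq (\<lambda>x. \<bar>f x\<bar>)"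
  by (auto simp: sq_def)

lemma sq_add:
  assumes "sq f" "sq g"
  shows "sq (\<lambda>x. f x + g x)"
proof -
  have "integrable lborel (\<lambda>x. (f x)\<^sup>2 + (g x)\<^sup>2 + 2 * (f x * g x))"
    by (intro Bochner_Integration.integrable_add sq_integrable assms integrable_mult_right sq_mult_integrable)
  then show ?thesis
    using assms by (auto simp: sq_def power2_sum mult.assoc)
qed

lemma sq_diff: "sq f \<Longrightarrow> sq g \<Longrightarrow> sq (\<lambda>x. f x - g x)"
  using sq_add[OF _ sq_minus, of f g] by simp

lemma sq_sum: "(\<And>i. i \<in> A \<Longrightarrow> sq (f i)) \<Longrightarrow> sq (\<lambda>x. \<Sum>i\<in>A. f i x)"
  by (induction A rule: infinite_finite_induct) (auto intro: sq_add)

lemma sq_bounded_mult: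
  assumes "sq f" "b \<in> borel_measurable borel" "\<And>x. \<bar>b x\<bar> \<le> M"
  shows "sq (\<lambda>x. b x * f x)"
proof (rule sq_dominated[OF sq_cmult[OF assms(1), of M]])
  show "(\<lambda>x. b x * f x) \<in> borel_measurable borel"
    using assms by (auto dest: sq_measurable)
  show "\<bar>b x * f x\<bar> \<le> \<bar>M * f x\<bar>" for x
    using assms(3)[of x] unfolding abs_mult by (intro mult_right_mono) auto
qed

lemma ip_commute: "ip f g = ip g f"
  by (simp add: ip_def mult.commute)

lemma ip_add_left: "sq f \<Longrightarrow> sq g \<Longrightarrow> sq h \<Longrightarrow> ip (\<lambda>x. f x + g x) h = ip f h + ip g h"
  by (simp add: ip_def distrib_right sq_mult_integrable)

lemma ip_diff_left: "sq f \<Longrightarrow> sq g \<Longrightarrow> sq h \<Longrightarrow> ip (\<lambda>x. f x - g x) h = ip f h - ip g h"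
  by (simp add: ip_def left_diff_distrib sq_mult_integrable)

lemma ip_add_right: "sq f \<Longrightarrow> sq g \<Longrightarrow> sq h \<Longrightarrow> ip h (\<lambda>x. f x + g x) = ip h f + ip h g"
  by (simp add: ip_commute[of h] ip_add_left)

lemma ip_diff_right: "sq f \<Longrightarrow> sq g \<Longrightarrow> sq h \<Longrightarrow> ip h (\<lambda>x. f x - g x) = ip h f - ip h g"
  by (simp add: ip_commute[of h] ip_diff_left)

lemma ip_cmult_left: "ip (\<lambda>x. c * f x) h = c * ip f h"
  by (simp add: ip_def mult.assoc)

lemma ip_minus_left: "ip (\<lambda>x. - f x) h = - ip f h"
  by (simp add: ip_def)

lemma ip_sum_left:
  "(\<And>i. i \<in> A \<Longrightarrow> sq (f i)) \<Longrightarrow> sq h \<Longrightarrow> ip (\<lambda>x. \<Sum>i\<in>A. f i x) h = (\<Sum>i\<in>A. ip (f i) h)"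
  by (simp add: ip_def sum_distrib_right sq_mult_integrable)

lemma ip_self_eq: "ip f f = (LINT x|lborel. (f x)\<^sup>2)"
  by (simp add: ip_def power2_eq_square)

lemma ip_self_nonneg [simp]: "0 \<le> ip f f"
  by (simp add: ip_self_eq)

lemma nrm_nonneg [simp]: "0 \<le> nrm f"
  by (simp add: nrm_def)

lemma nrm_power2: "(nrm f)\<^sup>2 = ip f f"
  by (simp add: nrm_def)

lemma nrm_zero [simp]: "nrm (\<lambda>x. 0) = 0"
  by (simp add: nrm_def ip_def)

lemma ip_Cauchy_Schwarz:
  assumes "sq f" "sq g"
  shows "\<bar>ip f g\<bar> \<le> nrm f * nrm g"
proof -
  define A B C where "A = ip g g" and "B = ip f g" and "C = ip f f"
  have q: "C + 2 * t * B + t\<^sup>2 * A \<ge> 0" for t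
  proof -
    have s: "sq (\<lambda>x. t * g x)" using assms(2) by (rule sq_cmult)
    have "0 \<le> ip (\<lambda>x. f x + t * g x) (\<lambda>x. f x + t * g x)" by simp
    also have "\<dots> = C + 2 * t * B + t\<^sup>2 * A"
      using assms s sq_add[OF assms(1) s]
      by (simp add: ip_add_left ip_add_right ip_cmult_left ip_commute[of _ "\<lambda>x. t * g x"] ip_commute[of g f]
          A_def B_def C_def power2_eq_square algebra_simps)
    finally show ?thesis .
  qed
  have "B\<^sup>2 \<le> C * A"
  proof (cases "A = 0")
    case True
    have "B = 0"
    proof (rule ccontr)
      assume "B \<noteq> 0"
      \<comment> \<open>For A = 0 the quadratic in t is affine, and this t would give it the value
        -1.\<close>
      then have "2 * (- (C + 1) / (2 * B)) * B = - (C + 1)" by simp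
      then show False using q[of "- (C + 1) / (2 * B)"] True by simp
    qed
    then show ?thesis using True by simp
  next
    case False
    then have "A > 0" using ip_self_nonneg[of g] by (auto simp: A_def less_le)
    then show ?thesis
      using q[of "- B / A"] by (simp add: field_simps power2_eq_square)
  qed
  then have "\<bar>B\<bar> \<le> sqrt (C * A)"
    by (metis real_sqrt_le_mono real_sqrt_abs)
  then show ?thesis by (simp add: nrm_def A_def B_def C_def real_sqrt_mult)
qed

lemma nrm_triangle:
  assumes "sq f" "sq g"
  shows "nrm (\<lambda>x. f x + g x) \<le> nrm f + nrm g"
proof (rule power2_le_imp_le)
  have "(nrm (\<lambda>x. f x + g x))\<^sup>2 = ip f f + 2 * ip f g + ip g g"
    using assms by (simp add: nrm_power2 ip_add_left ip_add_right sq_add ip_commute[of g f])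
  also have "\<dots> \<le> (nrm f + nrm g)\<^sup>2"
    using ip_Cauchy_Schwarz[OF assms] by (simp add: power2_sum nrm_power2)
  finally show "(nrm (\<lambda>x. f x + g x))\<^sup>2 \<le> (nrm f + nrm g)\<^sup>2" .
qed simp

lemma nrm_minus: "nrm (\<lambda>x. - f x) = nrm f"
  by (simp add: nrm_def ip_def)

lemma nrm_cmult: "nrm (\<lambda>x. c * f x) = \<bar>c\<bar> * nrm f"
  by (simp add: nrm_def ip_self_eq power_mult_distrib real_sqrt_mult)

lemma nrm_diff_commute: "nrm (\<lambda>x. f x - g x) = nrm (\<lambda>x. g x - f x)"
  using nrm_minus[of "\<lambda>x. f x - g x"] by simp

lemma nrm_triangle_diff:
  assumes "sq f" "sq g"
  shows "nrm (\<lambda>x. f x - g x) \<le> nrm f + nrm g"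
  using nrm_triangle[OF assms(1) sq_minus[OF assms(2)]] by (simp add: nrm_minus)

lemma nrm_reverse_triangle:
  assumes "sq f" "sq g"
  shows "\<bar>nrm f - nrm g\<bar> \<le> nrm (\<lambda>x. f x - g x)"
  using nrm_triangle[OF sq_diff[OF assms] assms(2)] nrm_triangle[OF sq_diff[OF assms(2,1)] assms(1)]
  by (simp add: nrm_diff_commute[of g f])

lemma nrm_mono:
  assumes "sq g" "f \<in> borel_measurable borel" "\<And>x. \<bar>f x\<bar> \<le> \<bar>g x\<bar>"
  shows "nrm f \<le> nrm g"
proof -
  have "(f x)\<^sup>2 \<le> (g x)\<^sup>2" for x
    using assms(3) abs_le_square_iff by blast
  then show ?thesis
    unfolding nrm_def ip_self_eq
    by (intro real_sqrt_le_mono integral_mono sq_integrable assms sq_dominated[OF assms])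
qed

lemma nrm_bounded_mult:
  assumes "sq f" "b \<in> borel_measurable borel" "\<And>x. \<bar>b x\<bar> \<le> M" "0 \<le> M"
  shows "nrm (\<lambda>x. b x * f x) \<le> M * nrm f"
proof -
  have "nrm (\<lambda>x. b x * f x) \<le> nrm (\<lambda>x. M * f x)"
    using assms(3,4) assms(2) sq_measurable[OF assms(1)]
    by (intro nrm_mono sq_cmult assms(1)) (auto simp: abs_mult intro!: mult_right_mono)
  then show ?thesis using assms(4) by (simp add: nrm_cmult)
qed

section \<open>Affine changes of variables\<close>

lemma nn_integral_lborel_affine:
  fixes f :: "'a::euclidean_space \<Rightarrow> ennreal"
  assumes [measurable]: "f \<in> borel_measurable borel" and c: "c \<noteq> 0"
  shows "(\<integral>\<^sup>+x. f x \<partial>lborel) = ennreal (\<bar>c\<bar> ^ DIM('a)) * (\<integral>\<^sup>+x. f (t + c *\<^sub>R x) \<partial>lborel)"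
  by (subst lborel_affine[OF c, of t])
    (simp add: nn_integral_density nn_integral_distr nn_integral_cmult)

lemma lborel_shift: "distr lborel borel (\<lambda>x. t + x) = (lborel :: 'a::euclidean_space measure)"
  using lborel_affine[of 1 t] by (simp add: density_1)

lemma lborel_reflect: "distr lborel borel (\<lambda>x. t - x) = (lborel :: 'a::euclidean_space measure)"
  using lborel_affine[of "-1" t] by (simp add: density_1)

lemma integrable_shift:
  fixes f :: "'a::euclidean_space \<Rightarrow> real"
  assumes "integrable lborel f"
  shows "integrable lborel (\<lambda>x. f (t + x))"
proof -
  have "integrable (distr lborel borel (\<lambda>x. t + x)) f"
    using assms by (simp add: lborel_shift)
  then show ?thesis by (subst (asm) integrable_distr_eq) (use assms in auto)
qed

lemma integrable_reflect:
  fixes f :: "'a::euclidean_space \<Rightarrow> real"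
  assumes "integrable lborel f"
  shows "integrable lborel (\<lambda>x. f (t - x))"
proof -
  have "integrable (distr lborel borel (\<lambda>x. t - x)) f"
    using assms by (simp add: lborel_reflect)
  then show ?thesis by (subst (asm) integrable_distr_eq) (use assms in auto)
qed

lemma integral_shift:
  fixes f :: "'a::euclidean_space \<Rightarrow> real"
  assumes [measurable]: "f \<in> borel_measurable borel"
  shows "(LINT x|lborel. f (t + x)) = (LINT x|lborel. f x)"
  by (subst (2) lborel_shift[of t, symmetric]) (simp add: integral_distr)

lemma integral_reflect:
  fixes f :: "'a::euclidean_space \<Rightarrow> real"
  assumes [measurable]: "f \<in> borel_measurable borel"
  shows "(LINT x|lborel. f (t - x)) = (LINT x|lborel. f x)"
  by (subst (2) lborel_reflect[of t, symmetric]) (simp add: integral_distr)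

section \<open>Smooth functions of compact support\<close>

definition bump :: "('a::euclidean_space \<Rightarrow> real) \<Rightarrow> bool" where
  "bump k \<longleftrightarrow> smooth k \<and> (\<exists>r. \<forall>x. r < norm x \<longrightarrow> k x = 0)"

lemma bump_smooth: "bump k \<Longrightarrow> smooth k"
  by (simp add: bump_def)

lemma bump_measurable [measurable_dest]: "bump k \<Longrightarrow> k \<in> borel_measurable borel"
  by (simp add: bump_def smooth_continuous borel_measurable_continuous_onI)

lemma bump_support:
  assumes "bump k"
  obtains r where "0 < r" "\<And>x. r < norm x \<Longrightarrow> k x = 0"
proof -
  obtain r where r: "\<And>x. r < norm x \<Longrightarrow> k x = 0" using assms by (auto simp: bump_def)
  show thesis by (rule that[of "max r 1"]) (use r in auto)
qed

lemma deriv_along_zero_outside: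
  assumes "\<And>x. r < norm x \<Longrightarrow> k x = 0" "r < norm x"
  shows "deriv_along h k x = 0"
proof (rule deriv_along_locally_constant)
  show "open {x. r < norm x}" by (intro open_Collect_less continuous_intros)
qed (use assms in auto)

lemma bump_deriv_along: "bump k \<Longrightarrow> bump (deriv_along h k)"
  unfolding bump_def by (metis deriv_along_zero_outside smooth_deriv_along)

lemma bump_mult_smooth: "bump k \<Longrightarrow> smooth f \<Longrightarrow> bump (\<lambda>x. k x * f x)"
  unfolding bump_def by (auto intro!: smooth_mult)

lemma bump_reflect: 
  assumes "bump k" shows "bump (\<lambda>y. k (x - y))"
proof -
  obtain r where r: "\<And>x. r < norm x \<Longrightarrow> k x = 0" using assms by (auto simp: bump_def)
  have "smooth (\<lambda>y. k (- y + x))"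
    by (rule smooth_affine[OF bounded_linear_minus[OF bounded_linear_ident] bump_smooth[OF assms]])
  moreover have "k (x - y) = 0" if "r + norm x < norm y" for y
    using that norm_triangle_ineq2[of y x] by (intro r) (simp add: norm_minus_commute)
  ultimately show ?thesis unfolding bump_def by auto
qed

lemma compact_support_bounded:
  fixes k :: "'a::euclidean_space \<Rightarrow> real"
  assumes "continuous_on UNIV k" "\<And>x. r < norm x \<Longrightarrow> k x = 0"
  obtains B where "0 < B" "\<And>x. \<bar>k x\<bar> \<le> B"
proof -
  have "bounded (k ` cball 0 r)"
    by (intro compact_imp_bounded compact_continuous_image continuous_on_subset[OF assms(1)]) auto
  then obtain B where B: "0 < B" "\<And>x. x \<in> cball 0 r \<Longrightarrow> norm (k x) \<le> B"
    by (auto simp: bounded_pos)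
  have "\<bar>k x\<bar> \<le> B" for x
    using B assms(2)[of x] by (cases "r < norm x") auto
  then show thesis using B that by blast
qed

lemma bump_bounded:
  assumes "bump k"
  obtains B where "0 < B" "\<And>x. \<bar>k x\<bar> \<le> B"
  using assms compact_support_bounded smooth_continuous unfolding bump_def by metis

lemma sq_indicator_cball: "sq (indicator (cball x r) :: 'a::euclidean_space \<Rightarrow> real)"
proof -
  have "integrable lborel (indicator (cball x r) :: 'a \<Rightarrow> real)"
    by (intro integrable_real_indicator) (use emeasure_lborel_cball_finite[of x r] in auto)
  moreover have "(indicator (cball x r) y)\<^sup>2 = (indicator (cball x r) y :: real)" for y
    by (auto simp: indicator_def)
  ultimately show ?thesis by (auto simp: sq_def)
qed

lemma sq_compact_support:
  fixes k :: "'a::euclidean_space \<Rightarrow> real"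
  assumes "k \<in> borel_measurable borel" "\<And>x. r < norm x \<Longrightarrow> k x = 0" "\<And>x. \<bar>k x\<bar> \<le> B"
  shows "sq k"
  by (rule sq_dominated[OF sq_cmult[OF sq_indicator_cball[of 0 r], of B] assms(1)])
     (use assms(2,3) in \<open>auto simp: indicator_def abs_mult not_le intro: order_trans[OF _ abs_ge_self]\<close>)

lemma bump_sq: "bump k \<Longrightarrow> sq k"
  by (meson bump_bounded bump_support bump_measurable sq_compact_support)

lemma bump_integrable:
  assumes "bump k" shows "integrable lborel k"
proof -
  obtain r where r: "\<And>x. r < norm x \<Longrightarrow> k x = 0" using bump_support[OF assms] by metis
  have "integrable lborel (\<lambda>x. indicator (cball 0 r) x * k x)"
    by (intro sq_mult_integrable sq_indicator_cball bump_sq assms)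
  moreover have "indicator (cball 0 r) x * k x = k x" for x
    using r[of x] by (auto simp: indicator_def)
  ultimately show ?thesis by simp
qed

section \<open>Convolution\<close>

definition conv :: "('a::euclidean_space \<Rightarrow> real) \<Rightarrow> ('a \<Rightarrow> real) \<Rightarrow> 'a \<Rightarrow> real" where
  "conv k f x = (LINT y|lborel. k (x - y) * f y)"

definition l1 :: "('a::euclidean_space \<Rightarrow> real) \<Rightarrow> real" where
  "l1 k = (LINT x|lborel. \<bar>k x\<bar>)"

lemma l1_nonneg [simp]: "0 \<le> l1 k"
  by (simp add: l1_def)

lemma conv_integrand: "bump k \<Longrightarrow> sq f \<Longrightarrow> integrable lborel (\<lambda>y. k (x - y) * f y)"
  by (rule sq_mult_integrable[OF bump_sq[OF bump_reflect]])

lemma conv_measurable [measurable]: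
  assumes [measurable]: "k \<in> borel_measurable borel" "f \<in> borel_measurable borel"
  shows "conv k f \<in> borel_measurable borel"
  unfolding conv_def[abs_def] by measurable

lemma conv_add: "bump k \<Longrightarrow> sq f \<Longrightarrow> sq g \<Longrightarrow> conv k (\<lambda>x. f x + g x) = (\<lambda>x. conv k f x + conv k g x)"
  by (simp add: conv_def fun_eq_iff distrib_left conv_integrand)

lemma conv_diff: "bump k \<Longrightarrow> sq f \<Longrightarrow> sq g \<Longrightarrow> conv k (\<lambda>x. f x - g x) = (\<lambda>x. conv k f x - conv k g x)"
  by (simp add: conv_def fun_eq_iff right_diff_distrib conv_integrand)

lemma conv_minus_kernel: "conv (\<lambda>x. - k x) f = (\<lambda>x. - conv k f x)"
  by (simp add: conv_def fun_eq_iff)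

text \<open>By translation invariance the integral of |K (x - y) F y| over x is \<open>l1 K\<close>
  times |F y|, which is integrable in y. This one Fubini condition serves convolution in L^1,
  Young's inequality and the adjoint formula.\<close>

lemma conv_integrable_pair:
  fixes K F :: "'a::euclidean_space \<Rightarrow> real"
  assumes K: "integrable lborel K" and F: "integrable lborel F"
  shows "integrable (lborel \<Otimes>\<^sub>M lborel) (\<lambda>(y, x). K (x - y) * F y)"
proof (rule lborel_pair.Fubini_integrable)
  have [measurable]: "K \<in> borel_measurable borel" "F \<in> borel_measurable borel"
    using K F by auto
  show "(\<lambda>(y, x). K (x - y) * F y) \<in> borel_measurable (lborel \<Otimes>\<^sub>M lborel)"
    by measurable
  have Ki: "integrable lborel (\<lambda>x. K (x - y))" for y
    using integrable_shift[OF K, of "- y"] by simp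
  have "(LINT x|lborel. \<bar>K (x - y)\<bar>) = l1 K" for y
    using integral_shift[of "\<lambda>x. \<bar>K x\<bar>" "- y"] by (simp add: l1_def)
  then have "(LINT x|lborel. norm (case (y, x) of (y, x) \<Rightarrow> K (x - y) * F y)) = l1 K * \<bar>F y\<bar>" for y
    using Ki[of y] by (simp add: abs_mult)
  then show "integrable lborel (\<lambda>y. LINT x|lborel. norm (case (y, x) of (y, x) \<Rightarrow> K (x - y) * F y))"
    using F by simp
  show "AE y in lborel. integrable lborel (\<lambda>x. case (y, x) of (y, x) \<Rightarrow> K (x - y) * F y)"
    using Ki by simp
qed

lemma
  fixes K F :: "'a::euclidean_space \<Rightarrow> real"
  assumes K: "integrable lborel K" and F: "integrable lborel F"
  shows conv_integrable: "integrable lborel (conv K F)"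
    and conv_integral: "(LINT x|lborel. conv K F x) = (LINT x|lborel. K x) * (LINT x|lborel. F x)"
proof -
  have [measurable]: "K \<in> borel_measurable borel" "F \<in> borel_measurable borel"
    using K F by auto
  note * = conv_integrable_pair[OF assms]
  show "integrable lborel (conv K F)"
    unfolding conv_def[abs_def] using lborel_pair.integrable_snd[OF *] by simp
  have Ki: "integrable lborel (\<lambda>x. K (x - y))" for y
    using integrable_shift[OF K, of "- y"] by simp
  have "(LINT x|lborel. K (x - y)) = (LINT x|lborel. K x)" for y
    using integral_shift[of K "- y"] by simp
  then have "(LINT y|lborel. LINT x|lborel. K (x - y) * F y) = (LINT x|lborel. K x) * (LINT x|lborel. F x)"
    using Ki by simp
  then show "(LINT x|lborel. conv K F x) = (LINT x|lborel. K x) * (LINT x|lborel. F x)"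
    unfolding conv_def using lborel_pair.Fubini_integral[OF *] by simp
qed

lemma bump_bounded_integrable:
  fixes F :: "'a::euclidean_space \<Rightarrow> real"
  assumes "bump k" "integrable lborel F"
  shows "integrable lborel (\<lambda>y. k (x - y) * F y)"
proof -
  obtain B where B: "\<And>z. \<bar>k z\<bar> \<le> B" using bump_bounded[OF assms(1)] by metis
  have [measurable]: "k \<in> borel_measurable borel" by (rule bump_measurable[OF assms(1)])
  have [measurable]: "F \<in> borel_measurable borel" using assms(2) by auto
  have "integrable lborel (\<lambda>y. B * F y)" using assms(2) by simp
  then show ?thesis
  proof (rule Bochner_Integration.integrable_bound)
    show "AE y in lborel. norm (k (x - y) * F y) \<le> norm (B * F y)"
      using B unfolding real_norm_def abs_mult
      by (intro AE_I2 mult_right_mono) (auto intro: order_trans[OF _ abs_ge_self])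
  qed simp
qed

text \<open>Cauchy-Schwarz after splitting the kernel into two factors of size sqrt |k|, the sign of
  k being attached to the factor that carries f.\<close>

lemma conv_square_le:
  assumes k: "bump k" and f: "sq f"
  shows "(conv k f x)\<^sup>2 \<le> l1 k * (LINT y|lborel. \<bar>k (x - y)\<bar> * (f y)\<^sup>2)"
proof -
  define a where "a y = sqrt \<bar>k (x - y)\<bar>" for y
  define b where "b y = sgn (k (x - y)) * sqrt \<bar>k (x - y)\<bar> * f y" for y
  have [measurable]: "k \<in> borel_measurable borel" "f \<in> borel_measurable borel"
    using assms by (auto dest: sq_measurable bump_measurable)
  have ki: "integrable lborel (\<lambda>y. k (x - y))"
    by (intro bump_integrable bump_reflect k)
  then have a: "sq a"
    by (auto simp: sq_def a_def[abs_def])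
  have kf: "integrable lborel (\<lambda>y. k (x - y) * (f y)\<^sup>2)"
    by (intro bump_bounded_integrable sq_integrable assms)
  have b2: "(b y)\<^sup>2 = \<bar>k (x - y) * (f y)\<^sup>2\<bar>" for y
    by (simp add: b_def power_mult_distrib abs_mult power2_eq_square[of "sgn _"] sgn_if)
  have b: "sq b"
    using kf unfolding sq_def b2 by (auto simp: b_def[abs_def])
  have ab: "a y * b y = k (x - y) * f y" for y
    by (simp add: a_def b_def sgn_if)
  have "(conv k f x)\<^sup>2 = (ip a b)\<^sup>2"
    by (simp add: conv_def ip_def ab)
  also have "\<dots> \<le> (nrm a * nrm b)\<^sup>2"
    using ip_Cauchy_Schwarz[OF a b] by (simp add: abs_le_square_iff[symmetric] abs_mult)
  also have "\<dots> = ip a a * ip b b"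
    by (simp add: power_mult_distrib nrm_power2)
  also have "ip b b = (LINT y|lborel. \<bar>k (x - y)\<bar> * (f y)\<^sup>2)"
    unfolding ip_self_eq b2 by (simp add: abs_mult)
  also have "ip a a = l1 k"
    unfolding ip_self_eq l1_def using integral_reflect[of "\<lambda>y. \<bar>k y\<bar>" x] by (simp add: a_def)
  finally show ?thesis .
qed

text \<open>Young's inequality for L^1 and L^2: integrating \<open>conv_square_le\<close> over x
  leaves \<open>l1 k\<close> times the integral of the convolution of |k| with f^2, two integrable
  functions.\<close>

lemma
  assumes k: "bump k" and f: "sq f"
  shows conv_sq: "sq (conv k f)" and nrm_conv_le: "nrm (conv k f) \<le> l1 k * nrm f"
proof -
  have [measurable]: "k \<in> borel_measurable borel" "f \<in> borel_measurable borel"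
    using assms by (auto dest: sq_measurable bump_measurable)
  define G where "G = conv (\<lambda>x. \<bar>k x\<bar>) (\<lambda>x. (f x)\<^sup>2)"
  have ki: "integrable lborel (\<lambda>x. \<bar>k x\<bar>)"
    using bump_integrable[OF k] by simp
  have G: "integrable lborel G" "(LINT x|lborel. G x) = l1 k * ip f f"
    unfolding G_def l1_def ip_self_eq
    by (intro conv_integrable conv_integral sq_integrable f ki)+
  have le: "(conv k f x)\<^sup>2 \<le> l1 k * G x" for x
    using conv_square_le[OF assms] by (simp add: G_def conv_def)
  have int: "integrable lborel (\<lambda>x. (conv k f x)\<^sup>2)"
  proof (rule Bochner_Integration.integrable_bound)
    show "integrable lborel (\<lambda>x. l1 k * G x)" using G by simp
    show "AE x in lborel. norm ((conv k f x)\<^sup>2) \<le> norm (l1 k * G x)"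
      using le by (auto intro: order_trans[OF _ abs_ge_self])
  qed simp
  then show "sq (conv k f)" by (simp add: sq_def)
  have "ip (conv k f) (conv k f) \<le> (LINT x|lborel. l1 k * G x)"
    unfolding ip_self_eq using int G le by (intro integral_mono) auto
  also have "\<dots> = (l1 k)\<^sup>2 * ip f f"
    using G by (simp add: power2_eq_square)
  finally have "sqrt (ip (conv k f) (conv k f)) \<le> sqrt ((l1 k)\<^sup>2 * ip f f)"
    by (rule real_sqrt_le_mono)
  then show "nrm (conv k f) \<le> l1 k * nrm f"
    by (simp add: nrm_def real_sqrt_mult)
qed

text \<open>Fubini. The double integrand k (x - y) f(y) g(x) is dominated by |k (x - y)| (f(y)^2 +
  g(x)^2), and each of the two parts is covered by \<open>conv_integrable_pair\<close>.\<close>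

lemma conv_adjoint:
  assumes k: "bump k" and f: "sq f" and g: "sq g"
  shows "ip (conv k f) g = ip f (conv (\<lambda>x. k (- x)) g)"
proof -
  have [measurable]: "k \<in> borel_measurable borel" "f \<in> borel_measurable borel" "g \<in> borel_measurable borel"
    using assms by (auto dest: sq_measurable bump_measurable)
  have ki: "integrable lborel (\<lambda>x. \<bar>k x\<bar>)"
    using bump_integrable[OF k] by simp
  have ki': "integrable lborel (\<lambda>x. \<bar>k (- x)\<bar>)"
    using integrable_reflect[OF ki, of 0] by simp
  have 1: "integrable (lborel \<Otimes>\<^sub>M lborel) (\<lambda>(y, x). \<bar>k (x - y)\<bar> * (f y)\<^sup>2)"
    by (intro conv_integrable_pair ki sq_integrable f)
  have "integrable (lborel \<Otimes>\<^sub>M lborel) (\<lambda>(x, y). \<bar>k (- (y - x))\<bar> * (g x)\<^sup>2)"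
    by (rule conv_integrable_pair[OF ki' sq_integrable[OF g]])
  then have "integrable (lborel \<Otimes>\<^sub>M lborel) (\<lambda>(x, y). \<bar>k (x - y)\<bar> * (g x)\<^sup>2)"
    by (simp add: algebra_simps)
  from lborel_pair.integrable_product_swap[OF this]
  have 2: "integrable (lborel \<Otimes>\<^sub>M lborel) (\<lambda>(y, x). \<bar>k (x - y)\<bar> * (g x)\<^sup>2)"
    by (simp add: case_prod_beta')
  have "integrable (lborel \<Otimes>\<^sub>M lborel) (\<lambda>(y, x). k (x - y) * f y * g x)"
  proof (rule Bochner_Integration.integrable_bound[OF Bochner_Integration.integrable_add[OF 1 2]])
    have "\<bar>k (x - y)\<bar> * \<bar>f y * g x\<bar> \<le> \<bar>k (x - y)\<bar> * ((f y)\<^sup>2 + (g x)\<^sup>2)" for x y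
      by (intro mult_left_mono abs_mult_le_squares) auto
    then show "AE z in lborel \<Otimes>\<^sub>M lborel. norm (case z of (y, x) \<Rightarrow> k (x - y) * f y * g x)
        \<le> norm ((case z of (y, x) \<Rightarrow> \<bar>k (x - y)\<bar> * (f y)\<^sup>2) + (case z of (y, x) \<Rightarrow> \<bar>k (x - y)\<bar> * (g x)\<^sup>2))"
      by (auto simp: abs_mult algebra_simps)
  qed measurable
  from lborel_pair.Fubini_integral[OF this]
  have "(LINT x|lborel. (LINT y|lborel. k (x - y) * f y * g x)) = (LINT y|lborel. (LINT x|lborel. k (x - y) * f y * g x))" .
  moreover have "ip (conv k f) g = (LINT x|lborel. (LINT y|lborel. k (x - y) * f y * g x))"
    by (simp add: ip_def conv_def)
  moreover have "(LINT x|lborel. k (x - y) * f y * g x) = f y * conv (\<lambda>x. k (- x)) g y" for y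
  proof -
    have "(LINT x|lborel. k (x - y) * f y * g x) = (LINT x|lborel. f y * (k (- (y - x)) * g x))"
      by (intro Bochner_Integration.integral_cong) (simp_all add: mult_ac)
    then show ?thesis by (simp add: conv_def)
  qed
  ultimately show ?thesis by (simp add: ip_def)
qed

section \<open>Differentiation of convolutions\<close>

lemma bump_deriv_along_bound:
  fixes k :: "'a::euclidean_space \<Rightarrow> real"
  assumes "bump k"
  obtains L where "0 < L" "\<And>h z. \<bar>deriv_along h k z\<bar> \<le> L * norm h"
proof -
  have "\<exists>B>0. \<forall>z. \<bar>deriv_along b k z\<bar> \<le> B" for b
    using bump_bounded[OF bump_deriv_along[OF assms]] by metis
  then obtain B where B: "\<And>b. 0 < B b" "\<And>b z. \<bar>deriv_along b k z\<bar> \<le> B b"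
    by metis
  have "\<bar>deriv_along h k z\<bar> \<le> (\<Sum>b\<in>Basis. B b) * norm h" for h z
  proof -
    interpret bounded_linear "\<lambda>h. deriv_along h k z"
      by (rule has_derivative_bounded_linear[OF smooth_has_derivative[OF bump_smooth[OF assms]]])
    have "deriv_along h k z = deriv_along (\<Sum>b\<in>Basis. (h \<bullet> b) *\<^sub>R b) k z"
      by (simp add: euclidean_representation)
    also have "\<dots> = (\<Sum>b\<in>Basis. (h \<bullet> b) * deriv_along b k z)"
      by (simp add: sum scaleR)
    also have "\<bar>\<dots>\<bar> \<le> (\<Sum>b\<in>Basis. norm h * B b)"
      using B by (intro order_trans[OF sum_abs] sum_mono) (auto simp: abs_mult Basis_le_norm intro!: mult_mono)
    finally show ?thesis by (simp add: sum_distrib_left mult.commute)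
  qed
  moreover have "0 < (\<Sum>b\<in>(Basis::'a set). B b)"
    using B by (intro sum_pos) auto
  ultimately show thesis using that by blast
qed

lemma bump_lipschitz:
  fixes k :: "'a::euclidean_space \<Rightarrow> real"
  assumes "bump k" "0 < L" "\<And>h z. \<bar>deriv_along h k z\<bar> \<le> L * norm h"
  shows "\<bar>k x - k y\<bar> \<le> L * norm (x - y)"
proof -
  have "norm (k x - k y) \<le> L * norm (x - y)"
  proof (rule differentiable_bound[of UNIV k "\<lambda>x h. deriv_along h k x"])
    show "(k has_derivative (\<lambda>h. deriv_along h k z)) (at z within UNIV)" for z
      using smooth_has_derivative[OF bump_smooth[OF assms(1)]] by simp
    show "onorm (\<lambda>h. deriv_along h k z) \<le> L" for z
      using assms by (intro onorm_le) auto
  qed auto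
  then show ?thesis by simp
qed

text \<open>Differentiation under the integral sign, by dominated convergence along sequences of
  increments. The remainder of the kernel has a bounded majorant supported in a fixed ball around x,
  and such a majorant is integrable against any f in L^2.\<close>

lemma conv_has_derivative:
  fixes k :: "'a::euclidean_space \<Rightarrow> real"
  assumes k: "bump k" and f: "sq f"
  shows "(conv k f has_derivative (\<lambda>h. conv (deriv_along h k) f x)) (at x)"
  unfolding has_derivative_at
proof
  have [measurable]: "k \<in> borel_measurable borel" "f \<in> borel_measurable borel"
    using assms by (auto dest: sq_measurable bump_measurable)
  have [measurable]: "deriv_along h k \<in> borel_measurable borel" for h
    by (intro bump_measurable bump_deriv_along k)
  have bl: "bounded_linear (\<lambda>h. deriv_along h k z)" for z
    by (rule has_derivative_bounded_linear[OF smooth_has_derivative[OF bump_smooth[OF k]]])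
  have int: "integrable lborel (\<lambda>y. deriv_along h k (x - y) * f y)" for h
    by (intro conv_integrand bump_deriv_along k f)
  have "linear (\<lambda>h. conv (deriv_along h k) f x)"
  proof
    show "conv (deriv_along (b1 + b2) k) f x = conv (deriv_along b1 k) f x + conv (deriv_along b2 k) f x" for b1 b2
      using int linear_add[OF bounded_linear.linear[OF bl]] by (simp add: conv_def distrib_right)
    show "conv (deriv_along (r *\<^sub>R b) k) f x = r *\<^sub>R conv (deriv_along b k) f x" for r b
      using linear_scale[OF bounded_linear.linear[OF bl]] by (simp add: conv_def mult.assoc)
  qed
  then show "bounded_linear (\<lambda>h. conv (deriv_along h k) f x)"
    by (rule linear_conv_bounded_linear[THEN iffD1])
  obtain L where L: "0 < L" "\<And>h z. \<bar>deriv_along h k z\<bar> \<le> L * norm h"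
    using bump_deriv_along_bound[OF k] by metis
  note lip = bump_lipschitz[OF k L]
  obtain r where r: "0 < r" "\<And>x. r < norm x \<Longrightarrow> k x = 0"
    using bump_support[OF k] by metis
  define q where "q h z = (k (z + h) - k z - deriv_along h k z) / norm h" for h z
  have [measurable]: "q h \<in> borel_measurable borel" for h
    unfolding q_def[abs_def] by measurable
  \<comment> \<open>The constant 2 L collects the Lipschitz bound and the bound of the linear term.
    The radius r + 1 leaves room for an increment of length below 1.\<close>
  have q_bound: "\<bar>q h (x - y)\<bar> \<le> 2 * L * indicator (cball x (r + 1)) y" if "h \<noteq> 0" "norm h < 1" for h y
  proof (cases "dist x y \<le> r + 1")
    case True
    have "\<bar>k (x - y + h) - k (x - y) - deriv_along h k (x - y)\<bar> \<le> L * norm h + L * norm h"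
      using lip[of "x - y + h" "x - y"] L(2)[of h "x - y"] by simp
    then show ?thesis using True that by (simp add: q_def field_simps)
  next
    case False
    then have "r + 1 < norm (x - y)" by (simp add: dist_norm)
    moreover from this have "r < norm (x - y + h)"
      using norm_triangle_ineq2[of "x - y" "- h"] that by simp
    ultimately have "q h (x - y) = 0"
      using r deriv_along_zero_outside[of r k "x - y" h] by (simp add: q_def)
    then show ?thesis using L by (simp add: indicator_def)
  qed
  have eq: "norm (conv k f (x + h) - conv k f x - conv (deriv_along h k) f x) / norm h =
      \<bar>LINT y|lborel. q h (x - y) * f y\<bar>" for h
  proof -
    have "(LINT y|lborel. q h (x - y) * f y) =
        (LINT y|lborel. (k (x + h - y) * f y - k (x - y) * f y - deriv_along h k (x - y) * f y) / norm h)"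
      by (intro Bochner_Integration.integral_cong) (auto simp: q_def algebra_simps diff_divide_distrib)
    also have "\<dots> = (conv k f (x + h) - conv k f x - conv (deriv_along h k) f x) / norm h"
      using int conv_integrand[OF k f] by (simp add: conv_def)
    finally show ?thesis by (simp add: abs_divide)
  qed
  have "(\<lambda>h. LINT y|lborel. q h (x - y) * f y) \<midarrow>0\<rightarrow> 0"
    unfolding tendsto_at_iff_sequentially comp_def
  proof (intro allI impI)
    fix X :: "nat \<Rightarrow> 'a" assume X: "\<forall>i. X i \<in> UNIV - {0}" "X \<longlonglongrightarrow> 0"
    have "eventually (\<lambda>n. norm (X n) < 1) sequentially"
      using tendsto_norm[OF X(2)] by (auto dest!: order_tendstoD)
    then obtain N where "\<forall>n\<ge>N. norm (X n) < 1"
      unfolding eventually_sequentially by blast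
    then have N: "norm (X (n + N)) < 1" for n
      using le_add2 by blast
    have XN: "(\<lambda>n. X (n + N)) \<longlonglongrightarrow> 0"
      using X(2) by (rule LIMSEQ_ignore_initial_segment)
    have q_lim: "(\<lambda>h. q h z) \<midarrow>0\<rightarrow> 0" for z
    proof -
      have "(\<lambda>h. norm (k (z + h) - k z - deriv_along h k z) / norm h) \<midarrow>0\<rightarrow> 0"
        using smooth_has_derivative[OF bump_smooth[OF k], of z] by (simp add: has_derivative_at)
      then have "(\<lambda>h. norm (q h z)) \<midarrow>0\<rightarrow> 0"
        by (simp add: q_def abs_divide)
      then show ?thesis by (rule tendsto_norm_zero_cancel)
    qed
    have "(\<lambda>n. LINT y|lborel. q (X (n + N)) (x - y) * f y) \<longlonglongrightarrow> (LINT y|lborel. 0 * f y)"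
    proof (rule integral_dominated_convergence[where w = "\<lambda>y. (2 * L * indicator (cball x (r + 1)) y) * \<bar>f y\<bar>"])
      show "integrable lborel (\<lambda>y. (2 * L * indicator (cball x (r + 1)) y) * \<bar>f y\<bar>)"
        by (intro sq_mult_integrable sq_cmult sq_indicator_cball sq_abs f)
      show "AE y in lborel. norm (q (X (n + N)) (x - y) * f y) \<le> (2 * L * indicator (cball x (r + 1)) y) * \<bar>f y\<bar>" for n
        using q_bound[OF _ N] X(1) unfolding real_norm_def abs_mult by (intro AE_I2 mult_right_mono) auto
      show "AE y in lborel. (\<lambda>n. q (X (n + N)) (x - y) * f y) \<longlonglongrightarrow> 0 * f y"
      proof (intro AE_I2 tendsto_mult tendsto_const)
        fix y
        show "(\<lambda>n. q (X (n + N)) (x - y)) \<longlonglongrightarrow> 0"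
          using q_lim[of "x - y", unfolded tendsto_at_iff_sequentially comp_def, rule_format, OF _ XN] X(1)
          by blast
      qed
    qed measurable
    then show "(\<lambda>n. LINT y|lborel. q (X n) (x - y) * f y) \<longlonglongrightarrow> 0"
      using LIMSEQ_offset[of "\<lambda>n. LINT y|lborel. q (X n) (x - y) * f y" N 0] by simp
  qed
  then show "(\<lambda>h. norm (conv k f (x + h) - conv k f x - conv (deriv_along h k) f x) / norm h) \<midarrow>0\<rightarrow> 0"
    unfolding eq by (rule tendsto_rabs_zero)
qed

lemma deriv_along_conv:
  assumes "bump k" "sq f"
  shows "deriv_along h (conv k f) = conv (deriv_along h k) f"
  using deriv_along_eq[OF conv_has_derivative[OF assms]] by blast

lemma smooth_conv:
  assumes "bump k" "sq f"
  shows "smooth (conv k f)"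
  unfolding smooth_def
proof
  fix n show "C_times n (conv k f)"
    using assms(1)
  proof (induction n arbitrary: k)
    case 0
    then show ?case
      using has_derivative_continuous[OF conv_has_derivative[OF _ assms(2)]]
      by (simp add: continuous_on_eq_continuous_at)
  next
    case (Suc n)
    then show ?case
      using conv_has_derivative[OF _ assms(2)] by (intro C_times_SucI) (auto intro: bump_deriv_along)
  qed
qed

lemma bump_conv:
  assumes k: "bump k" and f: "sq f" and R: "\<And>x. R < norm x \<Longrightarrow> f x = 0"
  shows "bump (conv k f)"
proof -
  obtain r where r: "0 < r" "\<And>x. r < norm x \<Longrightarrow> k x = 0"
    using bump_support[OF k] by metis
  have "conv k f x = 0" if "r + R < norm x" for x
  proof -
    have "k (x - y) * f y = 0" for y
      using that r(2)[of "x - y"] R[of y] norm_triangle_ineq2[of x y] by (cases "R < norm y") auto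
    then have "(\<lambda>y. k (x - y) * f y) = (\<lambda>y. 0)" by blast
    then show ?thesis unfolding conv_def by simp
  qed
  then show ?thesis
    using smooth_conv[OF k f] by (auto simp: bump_def)
qed

section \<open>Integration by parts\<close>

text \<open>Translation invariance takes the place of boundary terms: g(x + e) - g(x) has integral
  0, and it is also the integral over s in [0,1] of the derivative at x + s e. After Fubini every
  slice in s contributes the same integral of the derivative.\<close>

lemma integral_deriv_along_zero:
  fixes g :: "'a::euclidean_space \<Rightarrow> real"
  assumes d: "\<And>x. g differentiable (at x)" and c: "continuous_on UNIV (deriv_along e g)"
    and g: "integrable lborel g" and g': "integrable lborel (deriv_along e g)"
  shows "(LINT x|lborel. deriv_along e g x) = 0"
proof -
  define g' where "g' = deriv_along e g"
  have [measurable]: "g' \<in> borel_measurable borel"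
    using c by (simp add: g'_def borel_measurable_continuous_onI)
  have [measurable]: "g \<in> borel_measurable borel" using g by auto
  have shift: "integrable lborel (\<lambda>x. g' (x + s *\<^sub>R e))" "(LINT x|lborel. g' (x + s *\<^sub>R e)) = (LINT x|lborel. g' x)"
    "(LINT x|lborel. \<bar>g' (x + s *\<^sub>R e)\<bar>) = (LINT x|lborel. \<bar>g' x\<bar>)" for s
    using integrable_shift[OF g'[folded g'_def], of "s *\<^sub>R e"] integral_shift[of g' "s *\<^sub>R e"]
      integral_shift[of "\<lambda>x. \<bar>g' x\<bar>" "s *\<^sub>R e"]
    by (simp_all add: add.commute)
  have ftc: "(LINT s|lborel. indicator {0..1} s *\<^sub>R g' (x + s *\<^sub>R e)) = g (e + x) - g x" for x
  proof -
    have "(LINT s|lborel. indicator {0..1} s *\<^sub>R g' (x + s *\<^sub>R e)) = g (x + 1 *\<^sub>R e) - g (x + 0 *\<^sub>R e)"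
    proof (rule integral_FTC_Icc)
      show "continuous_on {0..1} (\<lambda>s. g' (x + s *\<^sub>R e))"
        using c unfolding g'_def by (rule continuous_on_compose2) (auto intro!: continuous_intros)
      fix s :: real
      have gd: "(g has_derivative (\<lambda>h. deriv_along h g y)) (at y)" for y
        by (rule differentiable_has_deriv_along[OF d])
      have "((\<lambda>s. g (x + s *\<^sub>R e)) has_derivative (\<lambda>s'. deriv_along (s' *\<^sub>R e) g (x + s *\<^sub>R e))) (at s within {0..1})"
        by (rule has_derivative_compose[OF _ gd]) (auto intro!: derivative_eq_intros)
      moreover have "deriv_along (s' *\<^sub>R e) g y = s' *\<^sub>R g' y" for s' y
        using linear_scale[OF has_derivative_linear[OF gd]] by (simp add: g'_def)
      ultimately show "((\<lambda>s. g (x + s *\<^sub>R e)) has_vector_derivative g' (x + s *\<^sub>R e)) (at s within {0..1})"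
        by (simp add: has_vector_derivative_def)
    qed simp
    then show ?thesis by (simp add: add.commute)
  qed
  have "integrable (lborel \<Otimes>\<^sub>M lborel) (\<lambda>(s::real, x). indicator {0..1} s *\<^sub>R g' (x + s *\<^sub>R e))"
  proof (rule lborel_pair.Fubini_integrable)
    show "(\<lambda>(s::real, x). indicator {0..1} s *\<^sub>R g' (x + s *\<^sub>R e)) \<in> borel_measurable (lborel \<Otimes>\<^sub>M lborel)"
      by measurable
    have "(LINT x|lborel. norm (case (s, x) of (s::real, x) \<Rightarrow> indicator {0..1} s *\<^sub>R g' (x + s *\<^sub>R e)))
        = indicator {0..1} s * (LINT x|lborel. \<bar>g' x\<bar>)" for s
      using shift(3)[of s] by (simp add: abs_mult)
    then show "integrable lborel (\<lambda>s. LINT x|lborel. norm (case (s, x) of (s::real, x) \<Rightarrow> indicator {0..1} s *\<^sub>R g' (x + s *\<^sub>R e)))"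
      by simp
    show "AE s in lborel. integrable lborel (\<lambda>x. case (s, x) of (s::real, x) \<Rightarrow> indicator {0..1} s *\<^sub>R g' (x + s *\<^sub>R e))"
      using shift(1) by simp
  qed
  from lborel_pair.Fubini_integral[OF this]
  have "(LINT x|lborel. LINT s|lborel. indicator {0..1} s *\<^sub>R g' (x + s *\<^sub>R e)) =
      (LINT s|lborel. LINT x|lborel. indicator {0..1} s *\<^sub>R g' (x + s *\<^sub>R e))" .
  also have "\<dots> = (LINT s|lborel. indicator {0..1::real} s *\<^sub>R (LINT x|lborel. g' x))"
    using shift(2) by simp
  also have "\<dots> = (LINT x|lborel. g' x)" by simp
  finally have "(LINT x|lborel. g (e + x) - g x) = (LINT x|lborel. g' x)"
    unfolding ftc .
  moreover have "(LINT x|lborel. g (e + x) - g x) = 0"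
    using integrable_shift[OF g, of e] g integral_shift[of g e] by simp
  ultimately show ?thesis by (simp add: g'_def)
qed

lemma deriv_along_mult:
  fixes a b :: "'a::real_normed_vector \<Rightarrow> real"
  assumes "a differentiable (at x)" "b differentiable (at x)"
  shows "deriv_along e (\<lambda>x. a x * b x) x = a x * deriv_along e b x + deriv_along e a x * b x"
  by (rule deriv_along_eq, rule has_derivative_mult) (intro differentiable_has_deriv_along assms)+

lemma smooth_deriv_along_mult:
  fixes a b :: "'a::real_normed_vector \<Rightarrow> real"
  assumes "smooth a" "smooth b"
  shows "deriv_along e (\<lambda>x. a x * b x) = (\<lambda>x. a x * deriv_along e b x + deriv_along e a x * b x)"
  using deriv_along_mult smooth_differentiable assms by blast

lemma ip_by_parts:
  assumes "smooth a" "smooth b"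
    "sq a" "sq b" "sq (deriv_along e a)" "sq (deriv_along e b)"
  shows "ip (deriv_along e a) b = - ip a (deriv_along e b)"
proof -
  have eq: "deriv_along e (\<lambda>x. a x * b x) = (\<lambda>x. a x * deriv_along e b x + deriv_along e a x * b x)"
    by (rule smooth_deriv_along_mult[OF assms(1,2)])
  have "(LINT x|lborel. deriv_along e (\<lambda>x. a x * b x) x) = 0"
  proof (rule integral_deriv_along_zero)
    show "integrable lborel (\<lambda>x. a x * b x)" "integrable lborel (deriv_along e (\<lambda>x. a x * b x))"
      unfolding eq using assms by (auto intro!: sq_mult_integrable)
    show "(\<lambda>x. a x * b x) differentiable (at x)" for x
      by (intro smooth_differentiable smooth_mult assms)
    show "continuous_on UNIV (deriv_along e (\<lambda>x. a x * b x))"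
      by (intro smooth_continuous smooth_deriv_along smooth_mult assms)
  qed
  then show ?thesis
    unfolding eq ip_def using assms by (simp add: sq_mult_integrable)
qed

section \<open>Mollifiers and cutoff functions\<close>

text \<open>Radial mollifiers satisfy the last condition by direct computation, so that the symmetry of general
  second derivatives is never needed.\<close>

definition mollifier :: "real \<Rightarrow> (real^3 \<Rightarrow> real) \<Rightarrow> bool" where
  "mollifier \<delta> \<eta> \<longleftrightarrow> bump \<eta> \<and> (\<forall>x. 0 \<le> \<eta> x) \<and> (LINT x|lborel. \<eta> x) = 1 \<and>
     (\<forall>x. \<delta> < norm x \<longrightarrow> \<eta> x = 0) \<and> (\<forall>x. \<eta> (- x) = \<eta> x) \<and>
     (\<forall>h k. deriv_along h (deriv_along k \<eta>) = deriv_along k (deriv_along h \<eta>))"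

lemma deriv_along_radial:
  fixes \<theta> :: "real \<Rightarrow> real" and x :: "real^3"
  assumes "smooth \<theta>"
  shows "deriv_along h (\<lambda>x. \<theta> (x \<bullet> x)) x = (2 * (x \<bullet> h)) * deriv_along 1 \<theta> (x \<bullet> x)"
proof -
  have "((\<lambda>x::real^3. x \<bullet> x) has_derivative (\<lambda>h. 2 * (x \<bullet> h))) (at x)"
    by (auto intro!: derivative_eq_intros simp: inner_commute)
  from deriv_along_eq[OF this] have "deriv_along h (\<lambda>x. x \<bullet> x) x = 2 * (x \<bullet> h)" .
  then show ?thesis
    using deriv_along_eq[OF has_derivative_compose_real[of \<theta> "\<lambda>x. x \<bullet> x"], of x h]
      smooth_differentiable[OF assms] smooth_differentiable[OF smooth_inner_self] by simp
qed

lemma smooth_radial: "smooth \<theta> \<Longrightarrow> smooth (\<lambda>x::real^3. \<theta> (x \<bullet> x) :: real)"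
  by (rule smooth_compose_real[OF _ smooth_inner_self])

text \<open>Both sides equal 4 (x . h) (x . k) \<open>\<theta>\<close>'' + 2 (h . k)
  \<open>\<theta>\<close>', which is visibly symmetric in h and k.\<close>

lemma deriv_along_radial_commute:
  fixes \<theta> :: "real \<Rightarrow> real"
  assumes "smooth \<theta>"
  shows "deriv_along h (deriv_along k (\<lambda>x::real^3. \<theta> (x \<bullet> x))) = deriv_along k (deriv_along h (\<lambda>x. \<theta> (x \<bullet> x)))"
proof -
  have lin: "deriv_along h (\<lambda>x::real^3. 2 * (x \<bullet> k)) x = 2 * (h \<bullet> k)" "smooth (\<lambda>x::real^3. 2 * (x \<bullet> k))" for h k x
  proof -
    have "bounded_linear (\<lambda>x::real^3. 2 * (x \<bullet> k))"
      using bounded_linear_scaleR_right[of 2, THEN bounded_linear_compose, OF bounded_linear_inner_left] by simp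
    from bounded_linear_imp_has_derivative[OF this] smooth_linear[OF this]
    show "deriv_along h (\<lambda>x::real^3. 2 * (x \<bullet> k)) x = 2 * (h \<bullet> k)" "smooth (\<lambda>x::real^3. 2 * (x \<bullet> k))"
      by (auto dest: deriv_along_eq)
  qed
  have "deriv_along h (deriv_along k (\<lambda>x::real^3. \<theta> (x \<bullet> x))) x =
      (2 * (x \<bullet> k)) * ((2 * (x \<bullet> h)) * deriv_along 1 (deriv_along 1 \<theta>) (x \<bullet> x)) + 2 * (h \<bullet> k) * deriv_along 1 \<theta> (x \<bullet> x)" for h k x
    unfolding deriv_along_radial[OF assms, abs_def]
    using assms lin by (simp add: smooth_deriv_along_mult smooth_radial smooth_deriv_along deriv_along_radial)
  then show ?thesis by (auto simp: fun_eq_iff inner_commute)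
qed

lemma deriv_along_cmult:
  fixes f :: "'a::real_normed_vector \<Rightarrow> real"
  assumes "smooth f"
  shows "deriv_along h (\<lambda>x. c * f x) = (\<lambda>x. c * deriv_along h f x)"
  using deriv_along_eq[OF has_derivative_mult_right[OF smooth_has_derivative[OF assms]]] by blast

lemma bump_radial_exists:
  obtains \<beta> :: "real^3 \<Rightarrow> real"
  where "bump \<beta>" "\<And>x. 0 \<le> \<beta> x" "\<And>x. \<beta> x \<le> 1" "\<And>x. norm x \<le> 1 \<Longrightarrow> \<beta> x = 1" "\<And>x. 2 \<le> norm x \<Longrightarrow> \<beta> x = 0"
    "\<And>x. \<beta> (- x) = \<beta> x" "\<And>h k. deriv_along h (deriv_along k \<beta>) = deriv_along k (deriv_along h \<beta>)"
proof -
  obtain S :: "real \<Rightarrow> real" where S: "smooth S" "\<And>t. t \<le> 0 \<Longrightarrow> S t = 0" "\<And>t. 1 \<le> t \<Longrightarrow> S t = 1"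
    "\<And>t. 0 \<le> S t" "\<And>t. S t \<le> 1"
    using smooth_step_exists by metis
  \<comment> \<open>This is applied to |x|^2, which is smooth also at the origin: the value is 1 up
    to |x|^2 = 1 and 0 from |x|^2 = 2 on, hence certainly from |x| = 2 on.\<close>
  define \<theta> where "\<theta> r = S (- r + 2)" for r
  have \<theta>: "smooth \<theta>"
    unfolding \<theta>_def by (rule smooth_affine[OF bounded_linear_minus[OF bounded_linear_ident] S(1)])
  define \<beta> where "\<beta> x = \<theta> (x \<bullet> x)" for x :: "real^3"
  have 1: "\<beta> x = 1" if "norm x \<le> 1" for x
    using that power_mono[OF that, of 2] by (auto simp: \<beta>_def \<theta>_def dot_square_norm intro!: S)
  have 2: "\<beta> x = 0" if "2 \<le> norm x" for x
    using that power_mono[OF that, of 2] by (auto simp: \<beta>_def \<theta>_def dot_square_norm intro!: S)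
  have "bump \<beta>"
    using 2 smooth_radial[OF \<theta>] by (auto simp: bump_def \<beta>_def[abs_def] less_imp_le intro!: exI[of _ 2])
  then show thesis
    using 1 2 S(4,5) deriv_along_radial_commute[OF \<theta>]
    by (intro that[of \<beta>]) (auto simp: \<beta>_def[abs_def] \<theta>_def)
qed

lemma smooth_scale:
  fixes f :: "'a::real_normed_vector \<Rightarrow> real"
  assumes "smooth f"
  shows "smooth (\<lambda>x. f (c *\<^sub>R x))" "deriv_along h (\<lambda>x. f (c *\<^sub>R x)) = (\<lambda>x. c * deriv_along h f (c *\<^sub>R x))"
proof -
  show "smooth (\<lambda>x. f (c *\<^sub>R x))"
    using smooth_affine[OF bounded_linear_scaleR_right assms, of c 0] by simp
  show "deriv_along h (\<lambda>x. f (c *\<^sub>R x)) = (\<lambda>x. c * deriv_along h f (c *\<^sub>R x))"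
  proof
    fix x
    note d = smooth_has_derivative[OF assms, of "c *\<^sub>R x"]
    have "((\<lambda>x. f (c *\<^sub>R x)) has_derivative (\<lambda>h. deriv_along (c *\<^sub>R h) f (c *\<^sub>R x))) (at x)"
      by (rule has_derivative_compose[where f = "\<lambda>x. c *\<^sub>R x" and f' = "\<lambda>h. c *\<^sub>R h", OF _ d]) (auto intro!: derivative_eq_intros)
    then show "deriv_along h (\<lambda>x. f (c *\<^sub>R x)) x = c * deriv_along h f (c *\<^sub>R x)"
      using linear_scale[OF has_derivative_linear[OF d]] by (simp add: deriv_along_eq)
  qed
qed

text \<open>What matters is the balance between the support radius 2 (n + 1) and the gradient bound
  L / (n + 1): the product of |x| and the gradient of the cutoff stays bounded uniformly in n. This
  compensates a potential that grows linearly.\<close>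

lemma cutoff_sequence:
  obtains \<psi> :: "nat \<Rightarrow> real^3 \<Rightarrow> real" and L :: real
  where "0 < L" "\<And>n. bump (\<psi> n)" "\<And>n x. \<bar>\<psi> n x\<bar> \<le> 1" "\<And>n x. 2 * real (Suc n) \<le> norm x \<Longrightarrow> \<psi> n x = 0"
    "\<And>n h x. \<bar>deriv_along h (\<psi> n) x\<bar> \<le> L / real (Suc n) * norm h"
    "\<And>x. (\<lambda>n. \<psi> n x) \<longlonglongrightarrow> 1" "\<And>h x. (\<lambda>n. deriv_along h (\<psi> n) x) \<longlonglongrightarrow> 0"
proof -
  obtain \<beta> :: "real^3 \<Rightarrow> real" where \<beta>: "bump \<beta>" "\<And>x. 0 \<le> \<beta> x" "\<And>x. \<beta> x \<le> 1"
    "\<And>x. norm x \<le> 1 \<Longrightarrow> \<beta> x = 1" "\<And>x. 2 \<le> norm x \<Longrightarrow> \<beta> x = 0"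
    using bump_radial_exists by metis
  note \<beta>s = bump_smooth[OF \<beta>(1)]
  obtain L where L: "0 < L" "\<And>h x. \<bar>deriv_along h \<beta> x\<bar> \<le> L * norm h"
    using bump_deriv_along_bound[OF \<beta>(1)] by metis
  define \<psi> where "\<psi> n x = \<beta> ((1 / real (Suc n)) *\<^sub>R x)" for n x
  have z: "\<psi> n x = 0" if "2 * real (Suc n) \<le> norm x" for n x
    using that by (simp add: \<psi>_def field_simps \<beta>(5))
  have \<psi>b: "bump (\<psi> n)" for n
    using z[of n] smooth_scale(1)[OF \<beta>s, of "1 / real (Suc n)"]
    unfolding bump_def \<psi>_def[abs_def] by (intro conjI exI[of _ "2 * real (Suc n)"] allI impI) auto
  have d: "\<bar>deriv_along h (\<psi> n) x\<bar> \<le> L / real (Suc n) * norm h" for n h x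
  proof -
    have "\<bar>deriv_along h (\<psi> n) x\<bar> = \<bar>deriv_along h \<beta> ((1 / real (Suc n)) *\<^sub>R x)\<bar> / real (Suc n)"
      unfolding \<psi>_def[abs_def] smooth_scale(2)[OF \<beta>s] by (simp add: abs_mult)
    also have "\<dots> \<le> L * norm h / real (Suc n)"
      using L by (intro divide_right_mono) auto
    finally show ?thesis by simp
  qed
  show thesis
  proof (rule that[OF L(1) \<psi>b _ z d])
    show "\<bar>\<psi> n x\<bar> \<le> 1" for n x using \<beta>(2,3) by (simp add: \<psi>_def)
    show "(\<lambda>n. \<psi> n x) \<longlonglongrightarrow> 1" for x
    proof (rule tendsto_eventually)
      show "\<forall>\<^sub>F n in sequentially. \<psi> n x = 1"
        using eventually_ge_at_top[of "nat \<lceil>norm x\<rceil>"]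
      proof eventually_elim
        case (elim n)
        then have "norm x \<le> real (Suc n)" by (simp add: nat_le_iff ceiling_le_iff)
        then show ?case by (simp add: \<psi>_def field_simps \<beta>(4))
      qed
    qed
    show "(\<lambda>n. deriv_along h (\<psi> n) x) \<longlonglongrightarrow> 0" for h x
    proof (rule Lim_null_comparison)
      have "(\<lambda>n. L * (inverse (real (Suc n)) * norm h)) \<longlonglongrightarrow> L * (0 * norm h)"
        by (intro tendsto_intros LIMSEQ_inverse_real_of_nat)
      then show "(\<lambda>n. L / real (Suc n) * norm h) \<longlonglongrightarrow> 0" by (simp add: divide_inverse mult.assoc)
      show "\<forall>\<^sub>F n in sequentially. norm (deriv_along h (\<psi> n) x) \<le> L / real (Suc n) * norm h"
        using d by (intro always_eventually) simp
    qed
  qed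
qed

lemma mollifier_exists:
  assumes "0 < \<delta>"
  shows "\<exists>\<eta>. mollifier \<delta> \<eta>"
proof -
  obtain \<beta> :: "real^3 \<Rightarrow> real" where \<beta>: "bump \<beta>" "\<And>x. 0 \<le> \<beta> x" "\<And>x. \<beta> x \<le> 1"
    "\<And>x. norm x \<le> 1 \<Longrightarrow> \<beta> x = 1" "\<And>x. 2 \<le> norm x \<Longrightarrow> \<beta> x = 0"
    "\<And>x. \<beta> (- x) = \<beta> x" "\<And>h k. deriv_along h (deriv_along k \<beta>) = deriv_along k (deriv_along h \<beta>)"
    using bump_radial_exists by metis
  define \<gamma> where "\<gamma> x = \<beta> ((2 / \<delta>) *\<^sub>R x)" for x
  have z: "\<gamma> x = 0" if "\<delta> \<le> norm x" for x
    using that assms by (simp add: \<gamma>_def field_simps \<beta>(5))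
  have s\<gamma>: "smooth \<gamma>"
    unfolding \<gamma>_def[abs_def] by (rule smooth_scale(1)[OF bump_smooth[OF \<beta>(1)]])
  then have b\<gamma>: "bump \<gamma>"
    using z by (auto simp: bump_def less_imp_le intro!: exI[of _ \<delta>])
  have "0 < measure lborel (cball (0::real^3) (\<delta>/2))"
    using assms content_cball_pos by auto
  also have "\<dots> = (LINT x|lborel. indicator (cball (0::real^3) (\<delta>/2)) x)"
    by simp
  also have "\<dots> \<le> (LINT x|lborel. \<gamma> x)"
  proof (rule integral_mono)
    show "integrable lborel (indicat_real (cball (0::real^3) (\<delta>/2)))"
      by (intro integrable_real_indicator) (use emeasure_lborel_cball_finite[of "0::real^3" "\<delta>/2"] in auto)
    show "indicat_real (cball (0::real^3) (\<delta>/2)) x \<le> \<gamma> x" for x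
      using \<beta>(2)[of "(2 / \<delta>) *\<^sub>R x"] \<beta>(4)[of "(2 / \<delta>) *\<^sub>R x"] assms
      by (auto simp: indicator_def \<gamma>_def field_simps)
  qed (rule bump_integrable[OF b\<gamma>])
  finally have pos: "0 < (LINT x|lborel. \<gamma> x)" .
  define c where "c = 1 / (LINT x|lborel. \<gamma> x)"
  have s\<gamma>': "deriv_along h \<gamma> = (\<lambda>x. 2 / \<delta> * deriv_along h \<beta> ((2 / \<delta>) *\<^sub>R x))" for h
    unfolding \<gamma>_def[abs_def] by (rule smooth_scale(2)[OF bump_smooth[OF \<beta>(1)]])
  have s\<gamma>'': "deriv_along k (deriv_along h \<gamma>) = (\<lambda>x. 2 / \<delta> * (2 / \<delta> * deriv_along k (deriv_along h \<beta>) ((2 / \<delta>) *\<^sub>R x)))" for h k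
    unfolding s\<gamma>'
    by (simp only: deriv_along_cmult smooth_scale smooth_deriv_along bump_smooth[OF \<beta>(1)])
  have "mollifier \<delta> (\<lambda>x. c * \<gamma> x)"
    unfolding mollifier_def
  proof (intro conjI allI impI)
    show "bump (\<lambda>x. c * \<gamma> x)"
      using bump_mult_smooth[OF b\<gamma> smooth_const[of c]] by (simp add: mult.commute)
    show "deriv_along h (deriv_along k (\<lambda>x. c * \<gamma> x)) = deriv_along k (deriv_along h (\<lambda>x. c * \<gamma> x))" for h k
      by (simp add: deriv_along_cmult s\<gamma> smooth_deriv_along s\<gamma>'' \<beta>(7)[of h k])
  qed (use pos z \<beta>(2,6) in \<open>auto simp: c_def \<gamma>_def\<close>)
  then show ?thesis by blast
qed

lemma mollifier_bump: "mollifier \<delta> \<eta> \<Longrightarrow> bump \<eta>"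
  by (simp add: mollifier_def)

lemma mollifier_mono: "mollifier \<delta> \<eta> \<Longrightarrow> \<delta> \<le> \<delta>' \<Longrightarrow> mollifier \<delta>' \<eta>"
  by (auto simp: mollifier_def)

lemma mollifier_l1: "mollifier \<delta> \<eta> \<Longrightarrow> l1 \<eta> = 1"
  by (simp add: mollifier_def l1_def)

lemma nrm_mollify_le: "mollifier \<delta> \<eta> \<Longrightarrow> sq f \<Longrightarrow> nrm (conv \<eta> f) \<le> nrm f"
  using nrm_conv_le[of \<eta> f] by (simp add: mollifier_l1 mollifier_bump)

section \<open>Convergence of mollifications\<close>

lemma nrm_tendsto_dominated:
  fixes f :: "nat \<Rightarrow> 'a::euclidean_space \<Rightarrow> real"
  assumes sq: "\<And>n. sq (f n)" "sq g" "sq w"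
    and lim: "AE x in lborel. (\<lambda>n. f n x) \<longlonglongrightarrow> g x"
    and bound: "\<And>n. AE x in lborel. \<bar>f n x - g x\<bar> \<le> w x"
  shows "(\<lambda>n. nrm (\<lambda>x. f n x - g x)) \<longlonglongrightarrow> 0"
proof -
  have [measurable]: "f n \<in> borel_measurable borel" "g \<in> borel_measurable borel" for n
    using sq by (auto dest: sq_measurable)
  have "(\<lambda>n. LINT x|lborel. (f n x - g x)\<^sup>2) \<longlonglongrightarrow> integral\<^sup>L (lborel :: 'a measure) (\<lambda>x. 0)"
  proof (rule integral_dominated_convergence[where w = "\<lambda>x. (w x)\<^sup>2"])
    show "integrable lborel (\<lambda>x. (w x)\<^sup>2)" by (rule sq_integrable[OF sq(3)])
    show "AE x in lborel. (\<lambda>n. (f n x - g x)\<^sup>2) \<longlonglongrightarrow> 0"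
      using lim
    proof eventually_elim
      case (elim x)
      then have "(\<lambda>n. (f n x - g x)\<^sup>2) \<longlonglongrightarrow> (g x - g x)\<^sup>2" by (intro tendsto_intros)
      then show ?case by simp
    qed
    show "AE x in lborel. norm ((f n x - g x)\<^sup>2) \<le> (w x)\<^sup>2" for n
      using bound[of n] by eventually_elim (auto intro: abs_le_square_iff[THEN iffD1] order_trans[OF _ abs_ge_self])
  qed auto
  then have "(\<lambda>n. sqrt (LINT x|lborel. (f n x - g x)\<^sup>2)) \<longlonglongrightarrow> sqrt 0"
    by (intro tendsto_real_sqrt) simp
  then show ?thesis by (simp add: nrm_def ip_self_eq)
qed

text \<open>Convergence is required uniformly over all kernels of radius \<open>\<delta>\<close>, so
  that it applies to whichever sequence of mollifiers is chosen later.\<close>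

definition mollifies :: "(real^3 \<Rightarrow> real) \<Rightarrow> bool" where
  "mollifies f \<longleftrightarrow> (\<forall>e>0. \<exists>\<delta>>0. \<forall>\<eta>. mollifier \<delta> \<eta> \<longrightarrow> nrm (\<lambda>x. conv \<eta> f x - f x) < e)"

text \<open>An argument with three errors of size e/3. Convolution with a mollifier does not
  increase the L^2 norm, so the approximation error of g n is the same before and after mollifying,
  for all kernels at once.\<close>

lemma mollifies_limit:
  assumes g: "\<And>n::nat. sq (g n)" "\<And>n. mollifies (g n)" and f: "sq f"
    and lim: "(\<lambda>n. nrm (\<lambda>x. g n x - f x)) \<longlonglongrightarrow> 0"
  shows "mollifies f"
  unfolding mollifies_def
proof (intro allI impI)
  fix e :: real assume e: "0 < e"
  then have "\<forall>\<^sub>F n in sequentially. nrm (\<lambda>x. g n x - f x) < e / 3"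
    using lim by (intro order_tendstoD(2)[OF lim]) auto
  then obtain n where n: "nrm (\<lambda>x. g n x - f x) < e / 3"
    by (auto simp: eventually_sequentially)
  have "0 < e / 3" using e by simp
  then obtain \<delta> where \<delta>: "0 < \<delta>" "\<And>\<eta>. mollifier \<delta> \<eta> \<Longrightarrow> nrm (\<lambda>x. conv \<eta> (g n) x - g n x) < e / 3"
    using g(2)[of n] unfolding mollifies_def by meson
  have "nrm (\<lambda>x. conv \<eta> f x - f x) < e" if \<eta>: "mollifier \<delta> \<eta>" for \<eta>
  proof -
    note b = mollifier_bump[OF \<eta>]
    have s: "sq (\<lambda>x. f x - g n x)" "sq (\<lambda>x. g n x - f x)" "sq (\<lambda>x. conv \<eta> (g n) x - g n x)"
      using f g b by (auto intro!: sq_diff conv_sq)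
    have eq: "(\<lambda>x. conv \<eta> f x - f x) = (\<lambda>x. (conv \<eta> (\<lambda>x. f x - g n x) x + (conv \<eta> (g n) x - g n x)) + (g n x - f x))"
      using conv_diff[OF b f g(1)] by simp
    have "nrm (\<lambda>x. conv \<eta> f x - f x) \<le> nrm (\<lambda>x. (conv \<eta> (\<lambda>x. f x - g n x) x + (conv \<eta> (g n) x - g n x))) + nrm (\<lambda>x. g n x - f x)"
      unfolding eq by (intro nrm_triangle sq_add s conv_sq b)
    also have "nrm (\<lambda>x. (conv \<eta> (\<lambda>x. f x - g n x) x + (conv \<eta> (g n) x - g n x))) \<le>
        nrm (conv \<eta> (\<lambda>x. f x - g n x)) + nrm (\<lambda>x. conv \<eta> (g n) x - g n x)"
      using s by (intro nrm_triangle) (auto intro: conv_sq b)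
    also have "nrm (conv \<eta> (\<lambda>x. f x - g n x)) \<le> nrm (\<lambda>x. f x - g n x)"
      by (rule nrm_mollify_le[OF \<eta> s(1)])
    finally show ?thesis
      using \<delta>(2)[OF \<eta>] n nrm_diff_commute[of f "g n"] by linarith
  qed
  then show "\<exists>\<delta>>0. \<forall>\<eta>. mollifier \<delta> \<eta> \<longrightarrow> nrm (\<lambda>x. conv \<eta> f x - f x) < e"
    using \<delta>(1) by blast
qed

text \<open>Since the kernel is nonnegative with integral 1, the error at x is an average of f(y) -
  f(x) over |x - y| <= \<open>\<delta>\<close>. Uniform continuity makes it small, and it vanishes
  away from a slightly larger ball.\<close>

lemma mollifies_continuous:
  assumes c: "continuous_on UNIV f" and r: "\<And>x. r < norm x \<Longrightarrow> f x = 0"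
  shows "mollifies f"
  unfolding mollifies_def
proof (intro allI impI)
  fix e :: real assume e: "0 < e"
  obtain B where B: "0 < B" "\<And>x. \<bar>f x\<bar> \<le> B"
    using compact_support_bounded[OF c r] by metis
  have [measurable]: "f \<in> borel_measurable borel"
    by (rule borel_measurable_continuous_onI[OF c])
  have f: "sq f"
    by (rule sq_compact_support[OF _ r B(2)]) auto
  define I where "I = (indicator (cball 0 (r + 1)) :: real^3 \<Rightarrow> real)"
  have I: "sq I" unfolding I_def by (rule sq_indicator_cball)
  \<comment> \<open>Chosen so that the pointwise error \<open>e' * I x\<close> has norm below e.
    Adding 1 keeps the denominator positive, since the ball may be empty for negative r.\<close>
  define e' where "e' = e / (nrm I + 1)"
  have e': "0 < e'" "e' * nrm I < e"
  proof -
    have "0 < nrm I + 1" using nrm_nonneg[of I] by linarith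
    then show "0 < e'" "e' * nrm I < e" using e by (auto simp: e'_def field_simps)
  qed
  \<comment> \<open>The error is estimated for x in the ball of radius r + 1, and y lies within
    distance 1 of x; both points are in the ball of radius r + 2.\<close>
  have "uniformly_continuous_on (cball 0 (r + 2)) f"
    by (intro compact_uniformly_continuous continuous_on_subset[OF c]) auto
  then obtain d where d: "0 < d" "\<And>x y. x \<in> cball 0 (r + 2) \<Longrightarrow> y \<in> cball 0 (r + 2) \<Longrightarrow> dist y x < d \<Longrightarrow> dist (f y) (f x) < e'"
    using e'(1) unfolding uniformly_continuous_on_def by metis
  define \<delta> where "\<delta> = min (d / 2) 1"
  have \<delta>: "0 < \<delta>" using d by (simp add: \<delta>_def)
  have "nrm (\<lambda>x. conv \<eta> f x - f x) < e" if \<eta>: "mollifier \<delta> \<eta>" for \<eta>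
  proof -
    note b = mollifier_bump[OF \<eta>]
    have [measurable]: "\<eta> \<in> borel_measurable borel" by (rule bump_measurable[OF b])
    have \<eta>i: "integrable lborel (\<lambda>y. \<eta> (x - y))" for x
      by (intro bump_integrable bump_reflect b)
    have \<eta>1: "(LINT y|lborel. \<eta> (x - y)) = 1" for x
      using integral_reflect[of \<eta> x] \<eta> by (simp add: mollifier_def)
    have \<eta>0: "0 \<le> \<eta> x" "\<delta> < norm x \<Longrightarrow> \<eta> x = 0" for x
      using \<eta> by (auto simp: mollifier_def)
    have "\<bar>conv \<eta> f x - f x\<bar> \<le> \<bar>e' * I x\<bar>" for x
    proof -
      have ie: "\<bar>\<eta> (x - y) * (f y - f x)\<bar> \<le> \<eta> (x - y) * (e' * I x)" for y
      proof (cases "\<delta> < norm (x - y)")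
        case False
        then have n: "norm (x - y) \<le> d / 2" "norm (x - y) \<le> 1" by (auto simp: \<delta>_def)
        have "\<bar>f y - f x\<bar> \<le> e' * I x"
        proof (cases "norm x \<le> r + 1")
          case True
          then have "dist (f y) (f x) < e'"
            using n d(1) norm_triangle_ineq2[of y x] norm_minus_commute[of y x]
            by (intro d(2)) (auto simp: dist_norm norm_minus_commute)
          then show ?thesis using True by (simp add: I_def dist_real_def)
        next
          case False
          then have "f x = 0" "f y = 0"
            using n norm_triangle_ineq2[of x y] by (auto intro!: r)
          then show ?thesis using e' by (simp add: I_def)
        qed
        then show ?thesis using \<eta>0 by (simp add: abs_mult mult_left_mono)
      qed (use \<eta>0 in auto)
      have "conv \<eta> f x - f x = (LINT y|lborel. \<eta> (x - y) * f y) - (LINT y|lborel. \<eta> (x - y) * f x)"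
        using \<eta>1[of x] \<eta>i by (simp add: conv_def)
      also have "\<dots> = (LINT y|lborel. \<eta> (x - y) * (f y - f x))"
        using conv_integrand[OF b f] \<eta>i by (simp add: right_diff_distrib)
      also have "\<bar>\<dots>\<bar> \<le> (LINT y|lborel. \<eta> (x - y) * (e' * I x))"
      proof (rule order_trans[OF integral_abs_bound integral_mono])
        show "integrable lborel (\<lambda>y. \<bar>\<eta> (x - y) * (f y - f x)\<bar>)"
          using conv_integrand[OF b f, of x] \<eta>i[of x] unfolding right_diff_distrib by (intro integrable_abs) auto
      qed (use ie \<eta>i in auto)
      also have "\<dots> = e' * I x" using \<eta>1 \<eta>i by simp
      finally show ?thesis by simp
    qed
    then have "nrm (\<lambda>x. conv \<eta> f x - f x) \<le> nrm (\<lambda>x. e' * I x)"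
      by (intro nrm_mono sq_cmult I) auto
    then show ?thesis using e' by (simp add: nrm_cmult)
  qed
  then show "\<exists>\<delta>>0. \<forall>\<eta>. mollifier \<delta> \<eta> \<longrightarrow> nrm (\<lambda>x. conv \<eta> f x - f x) < e"
    using \<delta> by blast
qed

text \<open>Density in two stages. A bounded function of bounded support is almost everywhere a
  limit of continuous functions, which are made dominated by clamping and cutting off. A general f
  is the L^2 limit of its truncations in domain and range.\<close>

lemma sq_mollifies:
  assumes f: "sq f"
  shows "mollifies f"
proof -
  obtain \<beta> :: "real^3 \<Rightarrow> real" where \<beta>: "bump \<beta>" "\<And>x. 0 \<le> \<beta> x" "\<And>x. \<beta> x \<le> 1"
    "\<And>x. norm x \<le> 1 \<Longrightarrow> \<beta> x = 1" "\<And>x. 2 \<le> norm x \<Longrightarrow> \<beta> x = 0"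
    using bump_radial_exists by metis
  have bounded: "mollifies g"
    if g [measurable]: "g \<in> borel_measurable borel" and R: "0 < R" and out: "\<And>x. R < norm x \<Longrightarrow> g x = 0" and M: "\<And>x. \<bar>g x\<bar> \<le> M" for g R M
  proof -
    have "g measurable_on UNIV"
      using g by (intro lebesgue_measurable_imp_measurable_on measurable_completion) auto
    then obtain N F where N: "negligible N" and F: "\<And>n. continuous_on UNIV (F n)"
      and lim: "\<And>x. x \<notin> N \<Longrightarrow> (\<lambda>n. F n x) \<longlonglongrightarrow> g x"
      unfolding measurable_on_def by auto
    define \<psi> where "\<psi> x = \<beta> ((1/R) *\<^sub>R x)" for x
    have \<psi>: "smooth \<psi>" "\<And>x. 0 \<le> \<psi> x" "\<And>x. \<psi> x \<le> 1"
      "\<And>x. norm x \<le> R \<Longrightarrow> \<psi> x = 1" "\<And>x. 2 * R \<le> norm x \<Longrightarrow> \<psi> x = 0"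
      unfolding \<psi>_def[abs_def] using R \<beta> smooth_scale(1)[OF bump_smooth[OF \<beta>(1)], of "1/R"]
      by (auto simp: field_simps)
    \<comment> \<open>Neither clamping to [-M, M] nor the factor \<open>\<psi>\<close> changes the
      limit, as |g| <= M and \<open>\<psi>\<close> is 1 where g may be nonzero. Both together
      provide a square integrable majorant and compact support.\<close>
    define G where "G n x = \<psi> x * max (- M) (min M (F n x))" for n x
    have Gc: "continuous_on UNIV (G n)" for n
      unfolding G_def[abs_def] by (intro continuous_intros smooth_continuous \<psi>(1) F)
    have Gz: "G n x = 0" if "2 * R < norm x" for n x
      using that \<psi>(5)[of x] by (simp add: G_def)
    have M0: "0 \<le> M" using M[of 0] by linarith
    have GM: "\<bar>G n x\<bar> \<le> M" for n x
      using \<psi>(2,3)[of x] M0 mult_mono[of "\<psi> x" 1 "\<bar>max (- M) (min M (F n x))\<bar>" M] by (auto simp: G_def abs_mult)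
    have Gs: "sq (G n)" for n
      by (rule sq_compact_support[OF borel_measurable_continuous_onI[OF Gc] Gz GM])
    have gs: "sq g"
      by (rule sq_compact_support[OF g out M])
    have "(\<lambda>n. nrm (\<lambda>x. G n x - g x)) \<longlonglongrightarrow> 0"
    proof (rule nrm_tendsto_dominated[where w = "\<lambda>x. 2 * M * indicator (cball 0 (2 * R)) x"])
      show "sq (\<lambda>x::real^3. 2 * M * indicator (cball 0 (2 * R)) x)"
        by (intro sq_cmult sq_indicator_cball)
      show "AE x in lborel. \<bar>G n x - g x\<bar> \<le> 2 * M * indicator (cball 0 (2 * R)) x" for n
      proof (rule AE_I2)
        fix x
        show "\<bar>G n x - g x\<bar> \<le> 2 * M * indicator (cball 0 (2 * R)) x"
          using GM[of n x] M[of x] Gz[of x n] out[of x] R by (cases "norm x \<le> 2 * R") (auto simp: indicator_def)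
      qed
      have "AE x in lborel. x \<notin> N"
        using N by (auto simp: negligible_iff_null_sets null_sets_completion_iff2 intro: AE_I')
      then show "AE x in lborel. (\<lambda>n. G n x) \<longlonglongrightarrow> g x"
      proof eventually_elim
        case (elim x)
        have "(\<lambda>n. G n x) \<longlonglongrightarrow> \<psi> x * max (- M) (min M (g x))"
          unfolding G_def by (intro tendsto_intros tendsto_max tendsto_min lim elim)
        moreover have "max (- M) (min M (g x)) = g x" using M[of x] by (auto simp: max_def min_def abs_le_iff)
        moreover have "\<psi> x * g x = g x" using \<psi>(4)[of x] out[of x] by (cases "norm x \<le> R") auto
        ultimately show ?case by simp
      qed
    qed (intro Gs gs)+
    then show ?thesis
      using Gs gs mollifies_continuous[OF Gc Gz] by (intro mollifies_limit[of G g]) auto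
  qed
  \<comment> \<open>The radius is n + 1 rather than n because \<open>bounded\<close> asks for a
    positive radius.\<close>
  define G where "G n x = indicator (cball 0 (real (Suc n))) x * max (- real n) (min (real n) (f x))" for n x
  have [measurable]: "f \<in> borel_measurable borel" by (rule sq_measurable[OF f])
  have Gm: "G n \<in> borel_measurable borel" for n
    unfolding G_def[abs_def]
    by (intro borel_measurable_times borel_measurable_indicator borel_measurable_max borel_measurable_min
        borel_measurable_const sq_measurable[OF f]) auto
  have Gf: "\<bar>G n x\<bar> \<le> \<bar>f x\<bar>" for n x
    by (auto simp: G_def indicator_def max_def min_def)
  have Gs: "sq (G n)" for n
    by (rule sq_dominated[OF f Gm Gf])
  have "mollifies (G n)" for n
    by (rule bounded[OF Gm, where R = "Suc n" and M = n]) (auto simp: G_def indicator_def)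
  moreover have "(\<lambda>n. nrm (\<lambda>x. G n x - f x)) \<longlonglongrightarrow> 0"
  proof (rule nrm_tendsto_dominated[where w = "\<lambda>x. 2 * \<bar>f x\<bar>"])
    show "AE x in lborel. \<bar>G n x - f x\<bar> \<le> 2 * \<bar>f x\<bar>" for n
      using Gf[of n] by (intro AE_I2) (smt (verit))
    show "AE x in lborel. (\<lambda>n. G n x) \<longlonglongrightarrow> f x"
    proof (intro AE_I2 tendsto_eventually)
      fix x
      show "\<forall>\<^sub>F n in sequentially. G n x = f x"
        using eventually_ge_at_top[of "nat \<lceil>norm x\<rceil>"] eventually_ge_at_top[of "nat \<lceil>\<bar>f x\<bar>\<rceil>"]
        by eventually_elim (auto simp: G_def indicator_def max_def min_def nat_le_iff ceiling_le_iff)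
    qed
  qed (intro Gs f sq_cmult sq_abs)+
  ultimately show ?thesis
    by (intro mollifies_limit[of G f] Gs f)
qed

lemma mollify_tendsto:
  assumes f: "sq f" and \<eta>: "\<And>n. mollifier (1 / real (Suc n)) (\<eta> n)"
  shows "(\<lambda>n. nrm (\<lambda>x. conv (\<eta> n) f x - f x)) \<longlonglongrightarrow> 0"
proof (rule LIMSEQ_I)
  fix e :: real assume "0 < e"
  then obtain \<delta> where \<delta>: "0 < \<delta>" "\<And>\<eta>. mollifier \<delta> \<eta> \<Longrightarrow> nrm (\<lambda>x. conv \<eta> f x - f x) < e"
    using sq_mollifies[OF f] unfolding mollifies_def by meson
  obtain N where N: "1 / real (Suc N) < \<delta>"
    using reals_Archimedean[OF \<delta>(1)] by (auto simp: divide_inverse)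
  have "norm (nrm (\<lambda>x. conv (\<eta> n) f x - f x) - 0) < e" if "N \<le> n" for n
  proof -
    have "1 / real (Suc n) \<le> 1 / real (Suc N)" using that by (intro divide_left_mono) auto
    then show ?thesis using N \<delta>(2)[OF mollifier_mono[OF \<eta>[of n]]] by simp
  qed
  then show "\<exists>N. \<forall>n\<ge>N. norm (nrm (\<lambda>x. conv (\<eta> n) f x - f x) - 0) < e" by blast
qed

section \<open>Coordinate derivatives, and integrals over a parameter in the unit interval\<close>

abbreviation pd :: "3 \<Rightarrow> (real^3 \<Rightarrow> real) \<Rightarrow> real^3 \<Rightarrow> real" where
  "pd j \<equiv> deriv_along (axis j 1)"

lemma deriv_along_expand:
  fixes f :: "real^3 \<Rightarrow> real"
  assumes "smooth f"
  shows "deriv_along h f x = (\<Sum>j\<in>UNIV. h $ j * pd j f x)"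
proof -
  interpret bounded_linear "\<lambda>h. deriv_along h f x"
    by (rule has_derivative_bounded_linear[OF smooth_has_derivative[OF assms]])
  have "h = (\<Sum>j\<in>UNIV. (h $ j) *\<^sub>R axis j 1)"
    using basis_expansion[of h] by (simp add: scalar_mult_eq_scaleR)
  then have "deriv_along h f x = deriv_along (\<Sum>j\<in>UNIV. (h $ j) *\<^sub>R axis j 1) f x" by simp
  then show ?thesis by (simp add: sum scaleR)
qed

lemma continuous_pair_measurable:
  fixes K :: "real \<times> (real^3) \<Rightarrow> real"
  assumes "continuous_on UNIV K"
  shows "(\<lambda>x. LINT \<sigma>|lborel. indicator {0..1} \<sigma> * K (\<sigma>, x)) \<in> borel_measurable borel"
proof -
  have [measurable]: "K \<in> borel_measurable (borel \<Otimes>\<^sub>M borel)"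
    using borel_measurable_continuous_onI[OF assms] by (simp add: borel_prod)
  show ?thesis by measurable
qed

lemma integrable_Icc_continuous:
  fixes K :: "real \<Rightarrow> real"
  assumes "continuous_on UNIV K"
  shows "integrable lborel (\<lambda>\<sigma>. indicator {0..1} \<sigma> * K \<sigma>)"
  using borel_integrable_compact[of "{0..1}" K] continuous_on_subset[OF assms] by simp

lemma integral_swap_compact:
  fixes K :: "real \<times> (real^3) \<Rightarrow> real"
  assumes K: "continuous_on UNIV K" and r: "\<And>\<sigma> x. r < norm x \<Longrightarrow> K (\<sigma>, x) = 0"
  shows "(LINT x|lborel. LINT \<sigma>|lborel. indicator {0..1} \<sigma> * K (\<sigma>, x)) =
    (LINT \<sigma>|lborel. indicator {0..1} \<sigma> * (LINT x|lborel. K (\<sigma>, x)))"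
proof -
  have "integrable lborel (\<lambda>z. indicator ({0..1} \<times> cball 0 r) z *\<^sub>R K z)"
    by (intro borel_integrable_compact compact_Times continuous_on_subset[OF K]) auto
  moreover have "indicator ({0..1} \<times> cball 0 r) z *\<^sub>R K z = (case z of (\<sigma>, x) \<Rightarrow> indicator {0..1} \<sigma> * K (\<sigma>, x))" for z
    using r[of "snd z" "fst z"] by (cases z) (auto simp: indicator_def)
  ultimately have "integrable (lborel \<Otimes>\<^sub>M lborel) (\<lambda>(\<sigma>, x). indicator {0..1} \<sigma> * K (\<sigma>, x))"
    by (simp add: lborel_prod)
  from lborel_pair.Fubini_integral[OF this] show ?thesis by simp
qed

section \<open>Averages over dilations\<close>

text \<open>The integral of s \<open>\<gamma>\<close>(s x) over s in [0,1], written with s =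
  \<open>\<sigma>\<close>^2, so that s ds = 2 \<open>\<sigma>\<close>^3
  d\<open>\<sigma>\<close>.\<close>

definition dilation_avg :: "(real^3 \<Rightarrow> real) \<Rightarrow> real^3 \<Rightarrow> real" where
  "dilation_avg \<gamma> x = (LINT \<sigma>|lborel. indicator {0..1} \<sigma> * (2 * \<sigma> ^ 3 * \<gamma> (\<sigma>\<^sup>2 *\<^sub>R x)))"

text \<open>Cauchy-Schwarz on [0,1] bounds the square by the integral of 4 \<open>\<sigma>\<close>^6
  \<open>\<gamma>\<close>(\<open>\<sigma>\<close>^2 x)^2. In dimension 3 the dilation x ->
  \<open>\<sigma>\<close>^2 x produces the Jacobian factor \<open>\<sigma>\<close>^(-6), which
  cancels the weight exactly. What remains is 4 times the squared norm of \<open>\<gamma>\<close>,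
  with no singularity at \<open>\<sigma>\<close> = 0.\<close>

lemma sq_dilation_avg:
  assumes c: "continuous_on UNIV \<gamma>" and s: "sq \<gamma>"
  shows "sq (dilation_avg \<gamma>)"
proof -
  have cK: "continuous_on UNIV (\<lambda>z::real \<times> (real^3). \<gamma> ((fst z)\<^sup>2 *\<^sub>R snd z))"
    by (intro continuous_on_compose2[OF c] continuous_intros) auto
  have [measurable]: "\<gamma> \<in> borel_measurable borel" by (rule sq_measurable[OF s])
  have m: "dilation_avg \<gamma> \<in> borel_measurable borel"
    using continuous_pair_measurable[of "\<lambda>z. 2 * fst z ^ 3 * \<gamma> ((fst z)\<^sup>2 *\<^sub>R snd z)"]
    unfolding dilation_avg_def[abs_def] by (auto intro!: continuous_intros cK)
  define q where "q x \<sigma> = indicator {0..1} \<sigma> * (4 * \<sigma> ^ 6 * (\<gamma> (\<sigma>\<^sup>2 *\<^sub>R x))\<^sup>2)" for x and \<sigma> :: real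
  have cx: "continuous_on UNIV (\<lambda>\<sigma>. \<gamma> (\<sigma>\<^sup>2 *\<^sub>R x))" for x
    by (intro continuous_on_compose2[OF c] continuous_intros) auto
  have qi: "integrable lborel (q x)" for x
    unfolding q_def[abs_def] by (intro integrable_Icc_continuous continuous_intros cx)
  have q0: "0 \<le> q x \<sigma>" for x \<sigma>
    by (auto simp: q_def indicator_def)
  have "(dilation_avg \<gamma> x)\<^sup>2 \<le> (LINT \<sigma>|lborel. q x \<sigma>)" for x
  proof -
    define a where "a = (indicator {0..1} :: real \<Rightarrow> real)"
    define b where "b \<sigma> = indicator {0..1} \<sigma> * (2 * \<sigma> ^ 3 * \<gamma> (\<sigma>\<^sup>2 *\<^sub>R x))" for \<sigma> :: real
    have b2: "(b \<sigma>)\<^sup>2 = q x \<sigma>" for \<sigma>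
      by (auto simp: b_def q_def indicator_def power_mult_distrib power_mult[symmetric])
    have "(\<lambda>\<sigma>. 2 * \<sigma> ^ 3 * \<gamma> (\<sigma>\<^sup>2 *\<^sub>R x)) \<in> borel_measurable borel"
      by (intro borel_measurable_continuous_onI continuous_intros cx)
    then have "b \<in> borel_measurable borel"
      unfolding b_def[abs_def] by measurable
    then have b: "sq b" using qi[of x] by (simp add: sq_def b2)
    have a: "sq a" unfolding a_def
      using sq_indicator_cball[of "1/2::real" "1/2"] by (simp add: cball_eq_atLeastAtMost)
    have "(dilation_avg \<gamma> x)\<^sup>2 = (ip a b)\<^sup>2"
      by (auto simp: dilation_avg_def ip_def a_def b_def indicator_def intro!: arg_cong[where f = "\<lambda>x. x\<^sup>2"] Bochner_Integration.integral_cong)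
    also have "\<dots> \<le> (nrm a * nrm b)\<^sup>2"
      using ip_Cauchy_Schwarz[OF a b] by (simp add: abs_le_square_iff[symmetric] abs_mult)
    also have "\<dots> = ip a a * ip b b"
      by (simp add: power_mult_distrib nrm_power2)
    also have "ip a a = 1"
      by (simp add: ip_def a_def indicator_inter_arith[symmetric])
    finally show ?thesis by (simp add: ip_self_eq b2)
  qed
  then have "ennreal ((dilation_avg \<gamma> x)\<^sup>2) \<le> (\<integral>\<^sup>+\<sigma>. ennreal (q x \<sigma>) \<partial>lborel)" for x
    using nn_integral_eq_integral[OF qi] q0 by (simp add: ennreal_leI)
  then have "(\<integral>\<^sup>+x. ennreal ((dilation_avg \<gamma> x)\<^sup>2) \<partial>lborel) \<le> (\<integral>\<^sup>+x. \<integral>\<^sup>+\<sigma>. ennreal (q x \<sigma>) \<partial>lborel \<partial>lborel)"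
    by (intro nn_integral_mono) auto
  also have "\<dots> = (\<integral>\<^sup>+\<sigma>. \<integral>\<^sup>+x. ennreal (q x \<sigma>) \<partial>lborel \<partial>lborel)"
  proof (rule lborel_pair.Fubini'[symmetric])
    show "(\<lambda>(x, \<sigma>). ennreal (q x \<sigma>)) \<in> borel_measurable (lborel \<Otimes>\<^sub>M lborel)"
      unfolding q_def by measurable
  qed
  also have "\<dots> \<le> (\<integral>\<^sup>+\<sigma>. ennreal (4 * ip \<gamma> \<gamma>) * indicator {0..1::real} \<sigma> \<partial>lborel)"
  proof (rule nn_integral_mono_AE)
    have "AE \<sigma> in lborel. \<sigma> \<noteq> (0::real)" by (rule AE_lborel_singleton)
    then show "AE \<sigma> in lborel. (\<integral>\<^sup>+x. ennreal (q x \<sigma>) \<partial>lborel) \<le> ennreal (4 * ip \<gamma> \<gamma>) * indicator {0..1} \<sigma>"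
    proof eventually_elim
      case (elim \<sigma>)
      have "(\<integral>\<^sup>+x. ennreal ((\<gamma> x)\<^sup>2) \<partial>lborel) = ennreal (\<bar>\<sigma>\<^sup>2\<bar> ^ 3) * (\<integral>\<^sup>+x. ennreal ((\<gamma> (\<sigma>\<^sup>2 *\<^sub>R x))\<^sup>2) \<partial>lborel)"
        using nn_integral_lborel_affine[of "\<lambda>x. ennreal ((\<gamma> x)\<^sup>2)" "\<sigma>\<^sup>2" 0] elim by simp
      moreover have "(\<integral>\<^sup>+x. ennreal ((\<gamma> x)\<^sup>2) \<partial>lborel) = ennreal (ip \<gamma> \<gamma>)"
        unfolding ip_self_eq by (intro nn_integral_eq_integral sq_integrable s) auto
      moreover have "ennreal (q x \<sigma>) = (ennreal (4 * \<bar>\<sigma>\<^sup>2\<bar> ^ 3) * indicator {0..1} \<sigma>) * ennreal ((\<gamma> (\<sigma>\<^sup>2 *\<^sub>R x))\<^sup>2)" for x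
        by (auto simp: q_def indicator_def ennreal_mult'[symmetric] power_mult[symmetric])
      ultimately show ?case
        by (simp add: nn_integral_cmult ennreal_mult' mult_ac)
    qed
  qed
  also have "\<dots> < \<infinity>"
    by (simp add: nn_integral_cmult ennreal_mult_less_top)
  finally have "integrable lborel (\<lambda>x. (dilation_avg \<gamma> x)\<^sup>2)"
    using m by (intro integrableI_bounded) auto
  then show ?thesis using m by (simp add: sq_def)
qed

section \<open>Compactly supported approximation of divergence free fields\<close>

text \<open>A divergence free \<open>g\<close> is the divergence of the antisymmetric matrix
  \<open>M i j x = \<integral>\<^sub>0\<^sup>1 s (g i (s x) x\<^sub>j - g j (s x) x\<^sub>i) ds\<close> (Poincare homotopy). Its truncation is the divergence of
  \<open>\<psi> M\<close>. The substitution \<open>s = \<sigma>\<^sup>2\<close> makes the \<open>L\<^sup>2\<close> bound of the dilation average immediate.\<close>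

definition hom :: "(3 \<Rightarrow> real^3 \<Rightarrow> real) \<Rightarrow> real \<Rightarrow> 3 \<Rightarrow> 3 \<Rightarrow> real^3 \<Rightarrow> real" where
  "hom g \<sigma> i j x = 2 * \<sigma> ^ 3 * (g i (\<sigma>\<^sup>2 *\<^sub>R x) * x $ j - g j (\<sigma>\<^sup>2 *\<^sub>R x) * x $ i)"

text \<open>This is the derivative of \<open>\<sigma>\<close>^4 g_i(\<open>\<sigma>\<close>^2 x)
  with respect to \<open>\<sigma>\<close>, so its integral over [0,1] recovers g_i(x). For
  divergence free g it is also the divergence over j of \<open>hom g \<sigma> i j\<close>; the two
  readings together give div M = g.\<close>

definition hom_div :: "(3 \<Rightarrow> real^3 \<Rightarrow> real) \<Rightarrow> real \<Rightarrow> 3 \<Rightarrow> real^3 \<Rightarrow> real" where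
  "hom_div g \<sigma> i x = 4 * \<sigma> ^ 3 * g i (\<sigma>\<^sup>2 *\<^sub>R x) + 2 * \<sigma> ^ 5 * (\<Sum>j\<in>UNIV. x $ j * pd j (g i) (\<sigma>\<^sup>2 *\<^sub>R x))"

definition hom_matrix :: "(3 \<Rightarrow> real^3 \<Rightarrow> real) \<Rightarrow> 3 \<Rightarrow> 3 \<Rightarrow> real^3 \<Rightarrow> real" where
  "hom_matrix g i j x = (LINT \<sigma>|lborel. indicator {0..1} \<sigma> * hom g \<sigma> i j x)"

text \<open>The product rule is already carried out and div M replaced by g, so that derivatives
  fall on the cutoff only and the integral defining \<open>hom_matrix\<close> is never
  differentiated.\<close>

definition truncation :: "(real^3 \<Rightarrow> real) \<Rightarrow> (3 \<Rightarrow> real^3 \<Rightarrow> real) \<Rightarrow> 3 \<Rightarrow> real^3 \<Rightarrow> real" where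
  "truncation \<psi> g i x = \<psi> x * g i x + (\<Sum>j\<in>UNIV. pd j \<psi> x * hom_matrix g i j x)"

lemma smooth_vec_nth: "smooth (\<lambda>x::real^3. x $ i)"
  by (rule smooth_linear[OF bounded_linear_vec_nth])

lemma deriv_along_vec_nth: "deriv_along h (\<lambda>x::real^3. x $ i) x = h $ i"
  by (rule deriv_along_eq, rule bounded_linear_imp_has_derivative, rule bounded_linear_vec_nth)

lemma deriv_along_diff:
  fixes f g :: "'a::real_normed_vector \<Rightarrow> real"
  assumes "smooth f" "smooth g"
  shows "deriv_along h (\<lambda>x. f x - g x) x = deriv_along h f x - deriv_along h g x"
  by (rule deriv_along_eq, rule has_derivative_diff) (intro smooth_has_derivative assms)+

lemma smooth_hom:
  assumes g: "\<And>i. smooth (g i)"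
  shows "smooth (hom g \<sigma> i j)"
  unfolding hom_def[abs_def]
  by (intro smooth_mult smooth_const smooth_diff smooth_scale(1) smooth_vec_nth g)

text \<open>Differentiating x_j gives g_i three times, differentiating x_i takes one g_i away, and
  the remaining 2 g_i together with the prefactor 2 \<open>\<sigma>\<close>^3 make the term 4
  \<open>\<sigma>\<close>^3 g_i. The part x_i div g vanishes.\<close>

lemma div_hom:
  assumes g: "\<And>i. smooth (g i)" and div: "\<And>x. (\<Sum>i\<in>UNIV. pd i (g i) x) = 0"
  shows "(\<Sum>j\<in>UNIV. pd j (hom g \<sigma> i j) x) = hom_div g \<sigma> i x"
proof -
  let ?y = "\<sigma>\<^sup>2 *\<^sub>R x"
  have sm: "smooth (\<lambda>x. g i (\<sigma>\<^sup>2 *\<^sub>R x))" "smooth (\<lambda>x. g i (\<sigma>\<^sup>2 *\<^sub>R x) * x $ j)" for i j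
    by (intro smooth_mult smooth_scale(1) smooth_vec_nth g)+
  have prod: "pd j (\<lambda>x. g i (\<sigma>\<^sup>2 *\<^sub>R x) * x $ k) x = g i ?y * (if k = j then 1 else 0) + \<sigma>\<^sup>2 * pd j (g i) ?y * x $ k" for i j k
    using smooth_deriv_along_mult[OF sm(1)[of i] smooth_vec_nth[of k], of "axis j 1"] smooth_scale(2)[OF g]
    by (auto simp: deriv_along_vec_nth axis_def)
  have "pd j (hom g \<sigma> i j) x = 2 * \<sigma> ^ 3 * (g i ?y + \<sigma>\<^sup>2 * (x $ j * pd j (g i) ?y)
      - g j ?y * (if i = j then 1 else 0) - \<sigma>\<^sup>2 * (x $ i * pd j (g j) ?y))" for j
  proof -
    have "pd j (hom g \<sigma> i j) x = 2 * \<sigma> ^ 3 * (pd j (\<lambda>x. g i (\<sigma>\<^sup>2 *\<^sub>R x) * x $ j) x - pd j (\<lambda>x. g j (\<sigma>\<^sup>2 *\<^sub>R x) * x $ i) x)"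
      unfolding hom_def[abs_def] deriv_along_cmult[OF smooth_diff[OF sm(2) sm(2)]] deriv_along_diff[OF sm(2) sm(2)] ..
    also have "\<dots> = 2 * \<sigma> ^ 3 * (g i ?y + \<sigma>\<^sup>2 * (x $ j * pd j (g i) ?y)
      - g j ?y * (if i = j then 1 else 0) - \<sigma>\<^sup>2 * (x $ i * pd j (g j) ?y))"
      unfolding prod by (auto simp: algebra_simps)
    finally show ?thesis .
  qed
  then have "(\<Sum>j\<in>UNIV. pd j (hom g \<sigma> i j) x) = 2 * \<sigma> ^ 3 * (3 * g i ?y + \<sigma>\<^sup>2 * (\<Sum>j\<in>UNIV. x $ j * pd j (g i) ?y)
      - g i ?y - \<sigma>\<^sup>2 * (x $ i * (\<Sum>j\<in>UNIV. pd j (g j) ?y)))"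
    by (simp add: sum_distrib_left[symmetric] sum_subtractf sum.distrib if_distrib[of "\<lambda>c. _ * c"] cong: if_cong)
  then show ?thesis
    by (simp add: div hom_div_def algebra_simps power_add[symmetric] eval_nat_numeral)
qed

lemma integral_hom_div:
  assumes g: "\<And>i. smooth (g i)"
  shows "(LINT \<sigma>|lborel. indicator {0..1} \<sigma> * hom_div g \<sigma> i x) = g i x"
proof -
  have cg: "continuous_on UNIV (\<lambda>\<sigma>. f (\<sigma>\<^sup>2 *\<^sub>R x))" if "smooth f" for f :: "real^3 \<Rightarrow> real"
    by (intro continuous_on_compose2[OF smooth_continuous[OF that, of UNIV]] continuous_intros) auto
  have "(LINT \<sigma>|lborel. indicator {0..1} \<sigma> *\<^sub>R hom_div g \<sigma> i x) = 1 ^ 4 * g i (1\<^sup>2 *\<^sub>R x) - 0 ^ 4 * g i (0\<^sup>2 *\<^sub>R x)"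
  proof (rule integral_FTC_Icc)
    have "continuous_on UNIV (\<lambda>\<sigma>. hom_div g \<sigma> i x)"
      unfolding hom_div_def by (intro continuous_intros cg smooth_deriv_along g)
    then show "continuous_on {0..1} (\<lambda>\<sigma>. hom_div g \<sigma> i x)"
      by (rule continuous_on_subset) simp
    fix \<sigma> :: real
    have 1: "((\<lambda>\<sigma>. \<sigma>\<^sup>2 *\<^sub>R x) has_derivative (\<lambda>s. (2 * \<sigma> * s) *\<^sub>R x)) (at \<sigma>)"
      by (auto intro!: derivative_eq_intros)
    have "((\<lambda>\<sigma>. g i (\<sigma>\<^sup>2 *\<^sub>R x)) has_derivative (\<lambda>s. deriv_along ((2 * \<sigma> * s) *\<^sub>R x) (g i) (\<sigma>\<^sup>2 *\<^sub>R x))) (at \<sigma>)"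
      using has_derivative_compose[OF 1 smooth_has_derivative[OF g]] .
    moreover have "deriv_along ((2 * \<sigma> * s) *\<^sub>R x) (g i) (\<sigma>\<^sup>2 *\<^sub>R x) = (2 * \<sigma> * (\<Sum>j\<in>UNIV. x $ j * pd j (g i) (\<sigma>\<^sup>2 *\<^sub>R x))) * s" for s
      by (subst deriv_along_expand[OF g]) (simp add: sum_distrib_left sum_distrib_right mult_ac)
    ultimately have "((\<lambda>\<sigma>. g i (\<sigma>\<^sup>2 *\<^sub>R x)) has_real_derivative 2 * \<sigma> * (\<Sum>j\<in>UNIV. x $ j * pd j (g i) (\<sigma>\<^sup>2 *\<^sub>R x))) (at \<sigma>)"
      by (simp add: has_field_derivative_def)
    then have "((\<lambda>\<sigma>. \<sigma> ^ 4 * g i (\<sigma>\<^sup>2 *\<^sub>R x)) has_real_derivative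
        \<sigma> ^ 4 * (2 * \<sigma> * (\<Sum>j\<in>UNIV. x $ j * pd j (g i) (\<sigma>\<^sup>2 *\<^sub>R x))) + 4 * \<sigma> ^ 3 * g i (\<sigma>\<^sup>2 *\<^sub>R x)) (at \<sigma>)"
      by (intro DERIV_mult') (auto intro!: derivative_eq_intros)
    moreover have "\<sigma> ^ 4 * (2 * \<sigma> * (\<Sum>j\<in>UNIV. x $ j * pd j (g i) (\<sigma>\<^sup>2 *\<^sub>R x))) + 4 * \<sigma> ^ 3 * g i (\<sigma>\<^sup>2 *\<^sub>R x) = hom_div g \<sigma> i x"
      by (simp add: hom_div_def eval_nat_numeral)
    ultimately show "((\<lambda>\<sigma>. \<sigma> ^ 4 * g i (\<sigma>\<^sup>2 *\<^sub>R x)) has_vector_derivative hom_div g \<sigma> i x) (at \<sigma> within {0..1})"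
      by (simp add: has_real_derivative_iff_has_vector_derivative has_vector_derivative_at_within)
  qed simp
  then show ?thesis by simp
qed

lemma continuous_on_dilation:
  fixes f :: "real^3 \<Rightarrow> real"
  assumes "smooth f"
  shows "continuous_on UNIV (\<lambda>z::real \<times> (real^3). f ((fst z)\<^sup>2 *\<^sub>R snd z))" "continuous_on UNIV (\<lambda>z::real \<times> (real^3). f (snd z))"
    "continuous_on UNIV (\<lambda>\<sigma>. f (\<sigma>\<^sup>2 *\<^sub>R x))"
  by (intro continuous_on_compose2[OF smooth_continuous[OF assms, of UNIV]] continuous_intros; simp)+

text \<open>Formally a double divergence of an antisymmetric matrix. To stay with smooth functions,
  the claim is proved for each \<open>\<sigma>\<close> separately: the integrand is the sum of
  \<open>\<partial>\<close>_j (\<open>\<psi>\<close> \<open>\<partial>\<close>_i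
  \<open>\<phi>\<close> hom_ij), whose integral over x is 0, and Fubini brings the integral over
  \<open>\<sigma>\<close> back.\<close>

lemma truncation_divergence_free:
  assumes g: "\<And>i. smooth (g i)" and div: "\<And>x. (\<Sum>i\<in>UNIV. pd i (g i) x) = 0"
    and \<psi>: "bump \<psi>" and \<phi>: "bump \<phi>" and sym: "\<And>i j. pd i (pd j \<phi>) = pd j (pd i \<phi>)"
  shows "(LINT x|lborel. (\<Sum>i\<in>UNIV. truncation \<psi> g i x * pd i \<phi> x)) = 0"
proof -
  define b where "b \<sigma> i j x = pd i \<phi> x * hom g \<sigma> i j x" for \<sigma> i j x
  \<comment> \<open>The integrand of the pairing before integration over \<open>\<sigma>\<close>.
    \<open>Kdiv\<close> recognises it as a sum of derivatives of compactly supported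
    functions.\<close>
  define K where "K z = (\<Sum>i\<in>UNIV. \<Sum>j\<in>UNIV. pd j \<psi> (snd z) * (pd i \<phi> (snd z) * hom g (fst z) i j (snd z)))
      + \<psi> (snd z) * (\<Sum>i\<in>UNIV. pd i \<phi> (snd z) * hom_div g (fst z) i (snd z))" for z
  have sb: "bump (\<lambda>x. \<psi> x * b \<sigma> i j x)" and sb': "smooth (b \<sigma> i j)" for \<sigma> i j
    unfolding b_def[abs_def]
    by (intro bump_mult_smooth[OF \<psi>] smooth_mult smooth_deriv_along[OF bump_smooth[OF \<phi>]] smooth_hom g)+
  have Kdiv: "K (\<sigma>, x) = (\<Sum>i\<in>UNIV. \<Sum>j\<in>UNIV. pd j (\<lambda>x. \<psi> x * b \<sigma> i j x) x)" for \<sigma> x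
  proof -
    have e1: "pd j (\<lambda>x. \<psi> x * b \<sigma> i j x) x = pd j \<psi> x * (pd i \<phi> x * hom g \<sigma> i j x)
       + \<psi> x * (pd j (pd i \<phi>) x * hom g \<sigma> i j x) + \<psi> x * (pd i \<phi> x * pd j (hom g \<sigma> i j) x)" for i j
      using smooth_deriv_along_mult[OF bump_smooth[OF \<psi>] sb', of "axis j 1"]
        smooth_deriv_along_mult[OF smooth_deriv_along[OF bump_smooth[OF \<phi>]] smooth_hom[OF g], of "axis j 1"]
      by (simp add: b_def[abs_def] algebra_simps)
    \<comment> \<open>The only surplus term of the product rule. Exchanging i and j changes the sign
      of \<open>hom\<close> but not the second derivative of \<open>\<phi>\<close>, so it equals its
      own negative; this is where the symmetry assumption on \<open>\<phi>\<close> enters.\<close>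
    define Z where "Z = (\<Sum>i\<in>UNIV. \<Sum>j\<in>UNIV. pd j (pd i \<phi>) x * hom g \<sigma> i j x)"
    have "Z = (\<Sum>j\<in>UNIV. \<Sum>i\<in>UNIV. pd j (pd i \<phi>) x * hom g \<sigma> i j x)"
      unfolding Z_def by (rule sum.swap)
    also have "\<dots> = (\<Sum>j\<in>UNIV. \<Sum>i\<in>UNIV. - (pd i (pd j \<phi>) x * hom g \<sigma> j i x))"
      by (intro sum.cong refl) (simp add: sym hom_def algebra_simps)
    also have "\<dots> = - Z" by (simp add: Z_def sum_negf)
    finally have Z: "Z = 0" by simp
    have "(\<Sum>i\<in>UNIV. \<Sum>j\<in>UNIV. pd j (\<lambda>x. \<psi> x * b \<sigma> i j x) x) =
       (\<Sum>i\<in>UNIV. \<Sum>j\<in>UNIV. pd j \<psi> x * (pd i \<phi> x * hom g \<sigma> i j x)) + \<psi> x * Z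
       + \<psi> x * (\<Sum>i\<in>UNIV. pd i \<phi> x * (\<Sum>j\<in>UNIV. pd j (hom g \<sigma> i j) x))"
      unfolding e1 Z_def by (simp add: sum.distrib sum_distrib_left)
    then show ?thesis using Z div_hom[OF g div] by (simp add: K_def)
  qed
  have int0: "(LINT x|lborel. pd j (\<lambda>x. \<psi> x * b \<sigma> i j x) x) = 0" for \<sigma> i j
    using bump_smooth[OF sb[of \<sigma> i j]]
    by (intro integral_deriv_along_zero smooth_differentiable smooth_continuous smooth_deriv_along bump_integrable
        bump_deriv_along sb) auto
  have Kint: "(LINT x|lborel. K (\<sigma>, x)) = 0" for \<sigma>
    unfolding Kdiv using int0 by (simp add: bump_integrable bump_deriv_along sb)
  obtain r where r: "\<And>x. r < norm x \<Longrightarrow> \<psi> x = 0" using bump_support[OF \<psi>] by metis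
  have cont: "continuous_on UNIV K"
    unfolding K_def[abs_def] hom_def hom_div_def
    by (intro continuous_intros continuous_on_dilation smooth_deriv_along g bump_smooth \<psi> \<phi>)
  have "(LINT x|lborel. LINT \<sigma>|lborel. indicator {0..1} \<sigma> * K (\<sigma>, x)) = 0"
    using integral_swap_compact[OF cont, of r] r deriv_along_zero_outside[of r \<psi>] Kint by (simp add: K_def)
  moreover have "(LINT \<sigma>|lborel. indicator {0..1} \<sigma> * K (\<sigma>, x)) = (\<Sum>i\<in>UNIV. truncation \<psi> g i x * pd i \<phi> x)" for x
  proof -
    have i1: "integrable lborel (\<lambda>\<sigma>. indicator {0..1} \<sigma> * hom g \<sigma> i j x)" for i j
      unfolding hom_def by (intro integrable_Icc_continuous continuous_intros continuous_on_dilation g)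
    have i2: "integrable lborel (\<lambda>\<sigma>. indicator {0..1} \<sigma> * hom_div g \<sigma> i x)" for i
      unfolding hom_div_def by (intro integrable_Icc_continuous continuous_intros continuous_on_dilation g smooth_deriv_along)
    have "(LINT \<sigma>|lborel. indicator {0..1} \<sigma> * K (\<sigma>, x)) = (LINT \<sigma>|lborel. 
       (\<Sum>i\<in>UNIV. \<Sum>j\<in>UNIV. (pd j \<psi> x * pd i \<phi> x) * (indicator {0..1} \<sigma> * hom g \<sigma> i j x))
      + (\<Sum>i\<in>UNIV. (\<psi> x * pd i \<phi> x) * (indicator {0..1} \<sigma> * hom_div g \<sigma> i x)))"
      by (intro Bochner_Integration.integral_cong refl) (simp add: K_def sum_distrib_left algebra_simps)
    also have "\<dots> = (\<Sum>i\<in>UNIV. \<Sum>j\<in>UNIV. (pd j \<psi> x * pd i \<phi> x) * hom_matrix g i j x)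
      + (\<Sum>i\<in>UNIV. (\<psi> x * pd i \<phi> x) * g i x)"
      using i1 i2 by (simp add: hom_matrix_def integral_hom_div[OF g])
    also have "\<dots> = (\<Sum>i\<in>UNIV. truncation \<psi> g i x * pd i \<phi> x)"
      by (simp add: truncation_def algebra_simps sum.distrib sum_distrib_left)
    finally show ?thesis .
  qed
  ultimately show ?thesis by simp
qed

text \<open>The homotopy matrix is bounded by 2 |x| H(x) with H in L^2, the factor |x| being its
  linear growth. The gradient of the cutoff is at most L / (n + 1) and lives where |x| <= 2 (n + 1),
  so each correction term is below 4 L H, uniformly in n. Hence a single L^2 majorant serves the
  pointwise convergence to g.\<close>

lemma divergence_free_approximation:
  assumes g: "\<And>i. smooth (g i)" and gs: "\<And>i. sq (g i)" and div: "\<And>x. (\<Sum>i\<in>UNIV. pd i (g i) x) = 0"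
  obtains f :: "nat \<Rightarrow> 3 \<Rightarrow> real^3 \<Rightarrow> real" and w r
  where "sq w" "\<And>n i. sq (f n i)" "\<And>n i x. \<bar>f n i x\<bar> \<le> w x" "\<And>i x. (\<lambda>n. f n i x) \<longlonglongrightarrow> g i x"
    "\<And>n i x. r n < norm x \<Longrightarrow> f n i x = 0"
    "\<And>n \<phi>. bump \<phi> \<Longrightarrow> (\<And>i j. pd i (pd j \<phi>) = pd j (pd i \<phi>)) \<Longrightarrow> (LINT x|lborel. (\<Sum>i\<in>UNIV. f n i x * pd i \<phi> x)) = 0"
proof -
  obtain \<psi> :: "nat \<Rightarrow> real^3 \<Rightarrow> real" and L where L: "0 < L" and \<psi>: "\<And>n. bump (\<psi> n)"
    "\<And>n x. \<bar>\<psi> n x\<bar> \<le> 1" "\<And>n x. 2 * real (Suc n) \<le> norm x \<Longrightarrow> \<psi> n x = 0"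
    "\<And>n h x. \<bar>deriv_along h (\<psi> n) x\<bar> \<le> L / real (Suc n) * norm h"
    and \<psi>_lim: "\<And>x. (\<lambda>n. \<psi> n x) \<longlonglongrightarrow> 1" "\<And>h x. (\<lambda>n. deriv_along h (\<psi> n) x) \<longlonglongrightarrow> 0"
    by (rule cutoff_sequence) blast
  define \<gamma> where "\<gamma> x = (\<Sum>i\<in>UNIV. \<bar>g i x\<bar>)" for x
  have \<gamma>c: "continuous_on UNIV \<gamma>"
    unfolding \<gamma>_def[abs_def] by (intro continuous_intros smooth_continuous g)
  have \<gamma>s: "sq \<gamma>"
    unfolding \<gamma>_def[abs_def] by (intro sq_sum sq_abs gs)
  have g\<gamma>: "\<bar>g i x\<bar> \<le> \<gamma> x" for i x
    unfolding \<gamma>_def by (rule member_le_sum) auto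
  have \<gamma>0: "0 \<le> \<gamma> x" for x
    unfolding \<gamma>_def by (intro sum_nonneg) auto
  define H where "H = dilation_avg \<gamma>"
  have Hs: "sq H" unfolding H_def by (rule sq_dilation_avg[OF \<gamma>c \<gamma>s])
  have H0: "0 \<le> H x" for x
    unfolding H_def dilation_avg_def using \<gamma>0 by (intro Bochner_Integration.integral_nonneg) (auto simp: indicator_def)
  have M: "\<bar>hom_matrix g i j x\<bar> \<le> 2 * norm x * H x" for i j x
  proof -
    have c\<gamma>: "continuous_on UNIV (\<lambda>\<sigma>. \<gamma> (\<sigma>\<^sup>2 *\<^sub>R x))"
      by (intro continuous_on_compose2[OF \<gamma>c] continuous_intros) auto
    have i1: "integrable lborel (\<lambda>\<sigma>. indicator {0..1} \<sigma> * hom g \<sigma> i j x)"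
      unfolding hom_def by (intro integrable_Icc_continuous continuous_intros continuous_on_dilation g)
    have i2: "integrable lborel (\<lambda>\<sigma>. indicator {0..1} \<sigma> * (2 * \<sigma> ^ 3 * \<gamma> (\<sigma>\<^sup>2 *\<^sub>R x)))"
      by (intro integrable_Icc_continuous continuous_intros c\<gamma>)
    have "\<bar>hom_matrix g i j x\<bar> \<le> (LINT \<sigma>|lborel. \<bar>indicator {0..1} \<sigma> * hom g \<sigma> i j x\<bar>)"
      unfolding hom_matrix_def by (rule integral_abs_bound)
    also have "\<dots> \<le> (LINT \<sigma>|lborel. 2 * norm x * (indicator {0..1} \<sigma> * (2 * \<sigma> ^ 3 * \<gamma> (\<sigma>\<^sup>2 *\<^sub>R x))))"
    proof (rule integral_mono)
      fix \<sigma> :: real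
      have "\<bar>hom g \<sigma> i j x\<bar> \<le> 2 * norm x * (2 * \<sigma> ^ 3 * \<gamma> (\<sigma>\<^sup>2 *\<^sub>R x))" if "0 \<le> \<sigma>"
      proof -
        have "\<bar>g i (\<sigma>\<^sup>2 *\<^sub>R x) * x $ j - g j (\<sigma>\<^sup>2 *\<^sub>R x) * x $ i\<bar> \<le> \<bar>g i (\<sigma>\<^sup>2 *\<^sub>R x)\<bar> * \<bar>x $ j\<bar> + \<bar>g j (\<sigma>\<^sup>2 *\<^sub>R x)\<bar> * \<bar>x $ i\<bar>"
          by (metis abs_mult abs_triangle_ineq4)
        also have "\<dots> \<le> \<gamma> (\<sigma>\<^sup>2 *\<^sub>R x) * norm x + \<gamma> (\<sigma>\<^sup>2 *\<^sub>R x) * norm x"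
          using g\<gamma> \<gamma>0 by (intro add_mono mult_mono component_le_norm_cart) auto
        finally have "2 * \<sigma> ^ 3 * \<bar>g i (\<sigma>\<^sup>2 *\<^sub>R x) * x $ j - g j (\<sigma>\<^sup>2 *\<^sub>R x) * x $ i\<bar> \<le> 2 * \<sigma> ^ 3 * (\<gamma> (\<sigma>\<^sup>2 *\<^sub>R x) * norm x + \<gamma> (\<sigma>\<^sup>2 *\<^sub>R x) * norm x)"
          using that by (intro mult_left_mono) auto
        moreover have "\<bar>hom g \<sigma> i j x\<bar> = 2 * \<sigma> ^ 3 * \<bar>g i (\<sigma>\<^sup>2 *\<^sub>R x) * x $ j - g j (\<sigma>\<^sup>2 *\<^sub>R x) * x $ i\<bar>"
          unfolding hom_def abs_mult using that by simp
        ultimately show ?thesis by (simp add: algebra_simps)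
      qed
      then show "\<bar>indicator {0..1} \<sigma> * hom g \<sigma> i j x\<bar> \<le> 2 * norm x * (indicator {0..1} \<sigma> * (2 * \<sigma> ^ 3 * \<gamma> (\<sigma>\<^sup>2 *\<^sub>R x)))"
        by (auto simp: indicator_def)
    qed (intro integrable_abs integrable_mult_right i1 i2)+
    also have "\<dots> = 2 * norm x * H x"
      unfolding H_def dilation_avg_def by (rule integral_mult_right_zero)
    finally show ?thesis .
  qed
  \<comment> \<open>The constant 12 L is 4 L for each of the three summands of the
    correction.\<close>
  define w where "w x = \<gamma> x + 12 * L * H x" for x
  define f where "f n = truncation (\<psi> n) g" for n
  have dz: "pd j (\<psi> n) x = 0" if "2 * Suc n < norm x" for j n x
    using deriv_along_zero_outside[of "2 * real (Suc n)" "\<psi> n" x] \<psi>(3) that by (simp add: less_imp_le)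
  have summand: "\<bar>pd j (\<psi> n) x * hom_matrix g i j x\<bar> \<le> 4 * L * H x" for n i j x
  proof (cases "2 * Suc n < norm x")
    case True
    then show ?thesis using dz L H0 by simp
  next
    case False
    have "\<bar>pd j (\<psi> n) x\<bar> * \<bar>hom_matrix g i j x\<bar> \<le> (L / Suc n) * (2 * (2 * Suc n) * H x)"
    proof (rule mult_mono)
      show "\<bar>pd j (\<psi> n) x\<bar> \<le> L / Suc n"
        using \<psi>(4)[of "axis j 1" n x] by simp
      have "2 * norm x * H x \<le> 2 * (2 * Suc n) * H x"
        using False H0 by (intro mult_right_mono) auto
      then show "\<bar>hom_matrix g i j x\<bar> \<le> 2 * (2 * Suc n) * H x" using M[of i j x] by simp
    qed (use L in auto)
    also have "\<dots> = 4 * L * H x" by (simp add: field_simps)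
    finally show ?thesis by (simp add: abs_mult)
  qed
  have bound: "\<bar>f n i x\<bar> \<le> w x" for n i x
  proof -
    have "\<bar>f n i x\<bar> \<le> \<bar>\<psi> n x * g i x\<bar> + (\<Sum>j\<in>UNIV. \<bar>pd j (\<psi> n) x * hom_matrix g i j x\<bar>)"
      unfolding f_def truncation_def by (intro order_trans[OF abs_triangle_ineq] add_mono sum_abs order_refl)
    also have "\<dots> \<le> \<gamma> x + (\<Sum>j\<in>(UNIV::3 set). 4 * L * H x)"
    proof (intro add_mono sum_mono summand)
      have "\<bar>\<psi> n x\<bar> * \<bar>g i x\<bar> \<le> 1 * \<gamma> x"
        using \<psi>(2)[of n x] g\<gamma> by (intro mult_mono) auto
      then show "\<bar>\<psi> n x * g i x\<bar> \<le> \<gamma> x" by (simp add: abs_mult)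
    qed
    finally show ?thesis by (simp add: w_def)
  qed
  have ws: "sq w" unfolding w_def[abs_def] by (intro sq_add sq_cmult \<gamma>s Hs)
  have w0: "0 \<le> w x" for x using \<gamma>0 H0 L by (simp add: w_def)
  have Mm: "hom_matrix g i j \<in> borel_measurable borel" for i j
  proof -
    have "continuous_on UNIV (\<lambda>z. hom g (fst z) i j (snd z))"
      unfolding hom_def by (intro continuous_intros continuous_on_dilation g)
    from continuous_pair_measurable[OF this] show ?thesis
      by (simp add: hom_matrix_def[abs_def])
  qed
  have fm: "f n i \<in> borel_measurable borel" for n i
    unfolding f_def truncation_def[abs_def]
    by (intro borel_measurable_add borel_measurable_times borel_measurable_sum Mm sq_measurable[OF gs] bump_measurable bump_deriv_along \<psi>(1))
  show thesis
  proof (rule that[of w f "\<lambda>n. 2 * Suc n"])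
    show "sq w" by (rule ws)
    show "sq (f n i)" for n i
      using bound w0 by (intro sq_dominated[OF ws fm]) auto
    show "\<bar>f n i x\<bar> \<le> w x" for n i x by (rule bound)
    show "f n i x = 0" if "real (2 * Suc n) < norm x" for n i x
      using that dz[of n x] \<psi>(3)[of n x] by (simp add: f_def truncation_def)
    show "(LINT x|lborel. (\<Sum>i\<in>UNIV. f n i x * pd i \<phi> x)) = 0" if "bump \<phi>" "\<And>i j. pd i (pd j \<phi>) = pd j (pd i \<phi>)" for n \<phi>
      unfolding f_def by (rule truncation_divergence_free[OF g div \<psi>(1) that])
    show "(\<lambda>n. f n i x) \<longlonglongrightarrow> g i x" for i x
    proof -
      have "(\<lambda>n. f n i x) \<longlonglongrightarrow> 1 * g i x + (\<Sum>j\<in>UNIV. 0 * hom_matrix g i j x)"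
        unfolding f_def truncation_def by (intro tendsto_intros \<psi>_lim)
      then show ?thesis by simp
    qed
  qed
qed

section \<open>Curves in \<open>L\<^sup>2\<close>\<close>

definition l2cont :: "real set \<Rightarrow> (real \<Rightarrow> 'a::euclidean_space \<Rightarrow> real) \<Rightarrow> bool" where
  "l2cont I f \<longleftrightarrow> (\<forall>t\<in>I. sq (f t)) \<and>
     (\<forall>t\<in>I. ((\<lambda>s. nrm (\<lambda>x. f s x - f t x)) \<longlongrightarrow> 0) (at t within I))"

lemma l2contD: "l2cont I f \<Longrightarrow> t \<in> I \<Longrightarrow> sq (f t)"
  "l2cont I f \<Longrightarrow> t \<in> I \<Longrightarrow> ((\<lambda>s. nrm (\<lambda>x. f s x - f t x)) \<longlongrightarrow> 0) (at t within I)"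
  by (auto simp: l2cont_def)

lemma tendsto_zero_within_le:
  fixes g h :: "real \<Rightarrow> real"
  assumes h: "(h \<longlongrightarrow> z) (at t within I)" "z = 0"
    and "\<And>s. s \<in> I \<Longrightarrow> 0 \<le> g s" "\<And>s. s \<in> I \<Longrightarrow> g s \<le> h s"
  shows "(g \<longlongrightarrow> 0) (at t within I)"
proof (rule tendsto_sandwich[OF _ _ tendsto_const h(1)[unfolded h(2)]])
  show "\<forall>\<^sub>F s in at t within I. 0 \<le> g s" "\<forall>\<^sub>F s in at t within I. g s \<le> h s"
    using assms(3,4) by (auto simp: eventually_at_filter)
qed

lemma l2cont_const: "sq f \<Longrightarrow> l2cont I (\<lambda>t. f)"
  by (simp add: l2cont_def)

lemma l2cont_add:
  assumes f: "l2cont I f" and g: "l2cont I g"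
  shows "l2cont I (\<lambda>t x. f t x + g t x)"
  unfolding l2cont_def
proof (intro conjI ballI)
  fix t assume t: "t \<in> I"
  show "sq (\<lambda>x. f t x + g t x)" using f g t by (intro sq_add) (auto simp: l2cont_def)
  have "((\<lambda>s. nrm (\<lambda>x. f s x - f t x) + nrm (\<lambda>x. g s x - g t x)) \<longlongrightarrow> 0 + 0) (at t within I)"
    by (intro tendsto_add l2contD(2)[OF f t] l2contD(2)[OF g t])
  then show "((\<lambda>s. nrm (\<lambda>x. f s x + g s x - (f t x + g t x))) \<longlongrightarrow> 0) (at t within I)"
  proof (rule tendsto_zero_within_le)
    fix s assume "s \<in> I"
    then show "0 \<le> nrm (\<lambda>x. f s x + g s x - (f t x + g t x))" 
      "nrm (\<lambda>x. f s x + g s x - (f t x + g t x)) \<le> nrm (\<lambda>x. f s x - f t x) + nrm (\<lambda>x. g s x - g t x)"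
      using nrm_triangle[of "\<lambda>x. f s x - f t x" "\<lambda>x. g s x - g t x"] f g t
      by (simp_all add: sq_diff l2contD algebra_simps)
  qed auto
qed

lemma l2cont_cmult:
  assumes f: "l2cont I f"
  shows "l2cont I (\<lambda>t x. c * f t x)"
  unfolding l2cont_def
proof (intro conjI ballI)
  fix t assume t: "t \<in> I"
  show "sq (\<lambda>x. c * f t x)" by (intro sq_cmult l2contD[OF f t])
  have "((\<lambda>s. \<bar>c\<bar> * nrm (\<lambda>x. f s x - f t x)) \<longlongrightarrow> \<bar>c\<bar> * 0) (at t within I)"
    by (intro tendsto_mult tendsto_const l2contD(2)[OF f t])
  then show "((\<lambda>s. nrm (\<lambda>x. c * f s x - c * f t x)) \<longlongrightarrow> 0) (at t within I)"
    by (simp add: nrm_cmult[symmetric] right_diff_distrib)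
qed

lemma l2cont_diff: "l2cont I f \<Longrightarrow> l2cont I g \<Longrightarrow> l2cont I (\<lambda>t x. f t x - g t x)"
  using l2cont_add[OF _ l2cont_cmult[of I g "-1"]] by simp

lemma l2cont_sum: "(\<And>i. i \<in> A \<Longrightarrow> l2cont I (f i)) \<Longrightarrow> l2cont I (\<lambda>t x. \<Sum>i\<in>A. f i t x)"
  by (induction A rule: infinite_finite_induct) (auto intro: l2cont_add l2cont_const)

lemma l2cont_conv:
  assumes k: "bump k" and f: "l2cont I f"
  shows "l2cont I (\<lambda>t. conv k (f t))"
  unfolding l2cont_def
proof (intro conjI ballI)
  fix t assume t: "t \<in> I"
  show "sq (conv k (f t))" by (intro conv_sq k l2contD[OF f t])
  have "((\<lambda>s. l1 k * nrm (\<lambda>x. f s x - f t x)) \<longlongrightarrow> l1 k * 0) (at t within I)"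
    by (intro tendsto_mult tendsto_const l2contD(2)[OF f t])
  then show "((\<lambda>s. nrm (\<lambda>x. conv k (f s) x - conv k (f t) x)) \<longlongrightarrow> 0) (at t within I)"
  proof (rule tendsto_zero_within_le)
    fix s assume s: "s \<in> I"
    show "nrm (\<lambda>x. conv k (f s) x - conv k (f t) x) \<le> l1 k * nrm (\<lambda>x. f s x - f t x)"
      using nrm_conv_le[OF k sq_diff[OF l2contD(1)[OF f s] l2contD(1)[OF f t]]]
      by (simp add: conv_diff k l2contD(1)[OF f s] l2contD(1)[OF f t])
  qed auto
qed

lemma l2cont_ip:
  assumes f: "l2cont I f" and g: "l2cont I g"
  shows "continuous_on I (\<lambda>t. ip (f t) (g t))"
  unfolding continuous_on_def
proof
  fix t assume t: "t \<in> I"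
  have "((\<lambda>s. nrm (\<lambda>x. f s x - f t x) * (nrm (\<lambda>x. g s x - g t x) + nrm (g t)) + nrm (f t) * nrm (\<lambda>x. g s x - g t x)) \<longlongrightarrow> 0 * (0 + nrm (g t)) + nrm (f t) * 0) (at t within I)"
    by (intro tendsto_intros l2contD(2)[OF f t] l2contD(2)[OF g t])
  then have "((\<lambda>s. \<bar>ip (f s) (g s) - ip (f t) (g t)\<bar>) \<longlongrightarrow> 0) (at t within I)"
  proof (rule tendsto_zero_within_le)
    fix s assume s: "s \<in> I"
    note sqs = l2contD(1)[OF f s] l2contD(1)[OF f t] l2contD(1)[OF g s] l2contD(1)[OF g t]
    have eq: "ip (f s) (g s) - ip (f t) (g t) = ip (\<lambda>x. f s x - f t x) (g s) + ip (f t) (\<lambda>x. g s x - g t x)"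
      using sqs by (simp add: ip_diff_left ip_diff_right)
    have "\<bar>ip (\<lambda>x. f s x - f t x) (g s) + ip (f t) (\<lambda>x. g s x - g t x)\<bar> \<le> nrm (\<lambda>x. f s x - f t x) * nrm (g s) + nrm (f t) * nrm (\<lambda>x. g s x - g t x)"
      using sqs by (intro order_trans[OF abs_triangle_ineq] add_mono ip_Cauchy_Schwarz sq_diff)
    also have "\<dots> \<le> nrm (\<lambda>x. f s x - f t x) * (nrm (\<lambda>x. g s x - g t x) + nrm (g t)) + nrm (f t) * nrm (\<lambda>x. g s x - g t x)"
      using mult_left_mono[OF nrm_triangle[OF sq_diff[OF sqs(3,4)] sqs(4)], of "nrm (\<lambda>x. f s x - f t x)"] by simp
    finally show "\<bar>ip (f s) (g s) - ip (f t) (g t)\<bar> \<le> nrm (\<lambda>x. f s x - f t x) * (nrm (\<lambda>x. g s x - g t x) + nrm (g t)) + nrm (f t) * nrm (\<lambda>x. g s x - g t x)" unfolding eq .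
  qed auto
  then have "((\<lambda>s. ip (f s) (g s) - ip (f t) (g t)) \<longlongrightarrow> 0) (at t within I)"
    by (rule tendsto_rabs_zero_cancel)
  then show "((\<lambda>s. ip (f s) (g s)) \<longlongrightarrow> ip (f t) (g t)) (at t within I)"
    by (simp add: LIM_zero_iff)
qed

lemma l2cont_nrm: "l2cont I f \<Longrightarrow> continuous_on I (\<lambda>t. nrm (f t))"
  unfolding nrm_def by (intro continuous_on_real_sqrt l2cont_ip)

text \<open>Continuity in L^2 alone would not survive products; it does for curves with pointwise
  bounds. In f(s) g(s) - f(t) g(t) = g(s) (f(s) - f(t)) + f(t) (g(s) - g(t)) the first factor varies
  with s, and continuity of m' keeps its bound under control near t.\<close>

lemma l2cont_mult:
  assumes f: "l2cont I f" and g: "l2cont I g"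
    and m: "continuous_on I m" "\<And>t x. t \<in> I \<Longrightarrow> \<bar>f t x\<bar> \<le> m t" "\<And>t x. t \<in> I \<Longrightarrow> \<bar>g t x\<bar> \<le> m' t" "continuous_on I m'"
  shows "l2cont I (\<lambda>t x. f t x * g t x)"
  unfolding l2cont_def
proof (intro conjI ballI)
  fix t assume t: "t \<in> I"
  show "sq (\<lambda>x. f t x * g t x)"
    by (rule sq_bounded_mult[OF l2contD(1)[OF g t] sq_measurable[OF l2contD(1)[OF f t]] m(2)[OF t]])
  \<comment> \<open>Any point serves: a bound on an absolute value is nonnegative.\<close>
  have m0: "0 \<le> m s" "0 \<le> m' s" if "s \<in> I" for s
    using m(2,3)[OF that, of undefined] by linarith+
  have "((\<lambda>s. m' s * nrm (\<lambda>x. f s x - f t x) + m t * nrm (\<lambda>x. g s x - g t x)) \<longlongrightarrow> m' t * 0 + m t * 0) (at t within I)"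
    using m(4) t by (intro tendsto_intros l2contD(2)[OF f t] l2contD(2)[OF g t]) (auto simp: continuous_on_def)
  then show "((\<lambda>s. nrm (\<lambda>x. f s x * g s x - f t x * g t x)) \<longlongrightarrow> 0) (at t within I)"
  proof (rule tendsto_zero_within_le)
    fix s assume s: "s \<in> I"
    note sqs = l2contD(1)[OF f s] l2contD(1)[OF f t] l2contD(1)[OF g s] l2contD(1)[OF g t]
    note ms = sqs[THEN sq_measurable]
    note d = sq_diff[OF sqs(1,2)] sq_diff[OF sqs(3,4)]
    have "(\<lambda>x. f s x * g s x - f t x * g t x) = (\<lambda>x. g s x * (f s x - f t x) + f t x * (g s x - g t x))"
      by (simp add: algebra_simps)
    then have "nrm (\<lambda>x. f s x * g s x - f t x * g t x) \<le> nrm (\<lambda>x. g s x * (f s x - f t x)) + nrm (\<lambda>x. f t x * (g s x - g t x))"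
      using nrm_triangle[OF sq_bounded_mult[OF d(1) ms(3) m(3)[OF s]] sq_bounded_mult[OF d(2) ms(2) m(2)[OF t]]] by simp
    also have "\<dots> \<le> m' s * nrm (\<lambda>x. f s x - f t x) + m t * nrm (\<lambda>x. g s x - g t x)"
      using m0 s t by (intro add_mono nrm_bounded_mult d ms m) auto
    finally show "nrm (\<lambda>x. f s x * g s x - f t x * g t x) \<le> m' s * nrm (\<lambda>x. f s x - f t x) + m t * nrm (\<lambda>x. g s x - g t x)" .
  qed auto
qed

section \<open>Weak derivatives in time\<close>

text \<open>The function may be unbounded near 0 and T, so the antiderivative is taken on the open
  interval. Its derivatives are then two-sided, also at the end points of a compact
  subinterval.\<close>

lemma antiderivative_on_interval:
  fixes f :: "real \<Rightarrow> real"
  assumes f: "continuous_on {0<..<T} f" and "0 < T"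
  obtains P where "\<And>x. 0 < x \<Longrightarrow> x < T \<Longrightarrow> (P has_real_derivative f x) (at x)"
    "\<And>a b. 0 < a \<Longrightarrow> a \<le> b \<Longrightarrow> b < T \<Longrightarrow> integral {a..b} f = P b - P a"
proof -
  have "\<exists>P. \<forall>x. ereal 0 < ereal x \<longrightarrow> ereal x < ereal T \<longrightarrow> (P has_vector_derivative f x) (at x)"
    using assms by (intro einterval_antiderivative) (auto simp: continuous_on_eq_continuous_at)
  then obtain P where P: "\<And>x. 0 < x \<Longrightarrow> x < T \<Longrightarrow> (P has_vector_derivative f x) (at x)"
    by auto
  show thesis
  proof (rule that[of P])
    show "(P has_real_derivative f x) (at x)" if "0 < x" "x < T" for x
      using P[OF that] by (simp add: has_real_derivative_iff_has_vector_derivative)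
    show "integral {a..b} f = P b - P a" if "0 < a" "a \<le> b" "b < T" for a b
    proof (rule integral_unique, rule fundamental_theorem_of_calculus[OF that(2)])
      show "(P has_vector_derivative f x) (at x within {a..b})" if "x \<in> {a..b}" for x
        by (rule has_vector_derivative_at_within, rule P) (use that \<open>0 < a\<close> \<open>b < T\<close> in auto)
    qed
  qed
qed

text \<open>Subtracting an antiderivative P of B leaves c = A - P with weak derivative 0. It is
  tested with a plateau that rises just after t1 and falls just after t2; the derivative of the
  plateau approximates a unit mass at t1 minus one at t2, so c has the same value at both
  times.\<close>

lemma weak_derivative_integral:
  fixes A B :: "real \<Rightarrow> real"
  assumes A: "continuous_on {0<..<T} A" and B: "continuous_on {0<..<T} B"
    and weak: "\<And>\<phi> a b. smooth \<phi> \<Longrightarrow> 0 < a \<Longrightarrow> a < b \<Longrightarrow> b < T \<Longrightarrow> (\<And>t. t \<notin> {a..b} \<Longrightarrow> \<phi> t = 0) \<Longrightarrow>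
       integral {a..b} (\<lambda>t. deriv_along 1 \<phi> t * A t + \<phi> t * B t) = 0"
    and t: "0 < t1" "t1 < t2" "t2 < T"
  shows "A t2 - A t1 = integral {t1..t2} B"
proof -
  obtain P where P: "\<And>x. 0 < x \<Longrightarrow> x < T \<Longrightarrow> (P has_real_derivative B x) (at x)"
    and P_int: "\<And>a b. 0 < a \<Longrightarrow> a \<le> b \<Longrightarrow> b < T \<Longrightarrow> integral {a..b} B = P b - P a"
    using antiderivative_on_interval[OF B] t by auto
  have Pc: "continuous_on {0<..<T} P"
    using P DERIV_isCont by (intro continuous_at_imp_continuous_on ballI) auto
  define c where "c t = A t - P t" for t
  have cc: "continuous_on {0<..<T} c"
    unfolding c_def[abs_def] by (intro continuous_intros A Pc)
  obtain S :: "real \<Rightarrow> real" where S: "smooth S" "\<And>t. t \<le> 0 \<Longrightarrow> S t = 0" "\<And>t. 1 \<le> t \<Longrightarrow> S t = 1"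
    "\<And>t. 0 \<le> deriv_along 1 S t"
    using smooth_step_exists by metis
  have S': "deriv_along 1 S t = 0" if "t < 0 \<or> 1 < t" for t
  proof (cases "t < 0")
    case True
    then show ?thesis by (intro deriv_along_locally_constant[of "{..<0}"]) (use S in auto)
  next
    case False
    then show ?thesis using that by (intro deriv_along_locally_constant[of "{1<..}"]) (use S in auto)
  qed
  have "\<bar>c t1 - c t2\<bar> \<le> 2 * e" if e: "0 < e" for e
  proof -
    have lim: "\<exists>d>0. \<forall>x. \<bar>x - t\<bar> < d \<longrightarrow> \<bar>c x - c t\<bar> < e" if "0 < t" "t < T" for t
    proof -
      have "isCont c t" using cc that by (simp add: continuous_on_eq_continuous_at)
      then show ?thesis using e unfolding continuous_at_eps_delta dist_real_def by blast
    qed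
    obtain d1 where d1: "d1 > 0" "\<And>x. \<bar>x - t1\<bar> < d1 \<Longrightarrow> \<bar>c x - c t1\<bar> < e" using lim[of t1] t by auto
    obtain d2 where d2: "d2 > 0" "\<And>x. \<bar>x - t2\<bar> < d2 \<Longrightarrow> \<bar>c x - c t2\<bar> < e" using lim[of t2] t by auto
    \<comment> \<open>Short enough for c to vary by less than e on [t1, t1 + d] and on [t2, t2 + d],
      and for t2 + d to stay below T.\<close>
    define d where "d = min (min d1 d2) (T - t2) / 2"
    have d: "0 < d" "d < d1" "d < d2" "t2 + d < T"
      using d1 d2 t by (auto simp: d_def min_def field_simps)
    \<comment> \<open>\<open>Q a\<close> rises from 0 to 1 on [a, a + d]. Its derivative
      \<open>q a\<close> is a nonnegative weight of mass 1 on that interval.\<close>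
    define Q where "Q a t = S ((1/d) *\<^sub>R t + (- a / d))" for a t
    define q where "q a t = deriv_along 1 S ((t - a) / d) / d" for a t
    have Qs: "smooth (Q a)" for a
      unfolding Q_def[abs_def] by (rule smooth_affine[OF bounded_linear_scaleR_right S(1)])
    have Qe: "Q a t = S ((t - a) / d)" for a t by (simp add: Q_def diff_divide_distrib)
    have Qd: "(Q a has_real_derivative q a t) (at t)" for a t
    proof -
      have "((\<lambda>t. (t - a) / d) has_real_derivative 1 / d) (at t)"
        using d(1) by (auto intro!: derivative_eq_intros)
      moreover have "(S has_real_derivative deriv_along 1 S y) (at y)" for y
      proof -
        note dS = smooth_has_derivative[OF S(1), of y]
        have "deriv_along h S y = deriv_along 1 S y * h" for h
          using linear_scale[OF has_derivative_linear[OF dS], of h 1] by (simp add: mult.commute)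
        then have "(\<lambda>h. deriv_along h S y) = (*) (deriv_along 1 S y)" by blast
        then show ?thesis using dS by (simp add: has_field_derivative_def)
      qed
      ultimately have "((\<lambda>t. S ((t - a) / d)) has_real_derivative deriv_along 1 S ((t - a) / d) * (1 / d)) (at t)"
        by (rule DERIV_chain2[rotated])
      then show ?thesis by (simp add: Qe[abs_def] q_def)
    qed
    have q0: "0 \<le> q a t" for a t using S(4) d by (simp add: q_def)
    have qz: "q a t = 0" if "t < a \<or> a + d < t" for a t
      using that d by (auto simp: q_def field_simps intro!: S')
    have qc: "continuous_on X (q a)" for X a
      unfolding q_def[abs_def] using d
      by (intro continuous_intros continuous_on_compose2[OF smooth_continuous[OF smooth_deriv_along[OF S(1)], of UNIV]])
        (use d in auto)
    define a where "a = t1"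
    define b where "b = t2 + d"
    have ab: "0 < a" "a < b" "b < T" "{a..b} \<subseteq> {0<..<T}" using t d by (auto simp: a_def b_def)
    have q1: "(q t1 has_integral 1) {a..b}" "(q t2 has_integral 1) {a..b}"
    proof -
      have "(q s has_integral Q s b - Q s a) {a..b}" for s
        using ab Qd by (intro fundamental_theorem_of_calculus)
          (auto simp: has_real_derivative_iff_has_vector_derivative[symmetric] intro: DERIV_subset)
      moreover have "Q t1 b = 1" "Q t1 a = 0" "Q t2 b = 1" "Q t2 a = 0"
        using d t by (auto simp: Qe a_def b_def field_simps intro!: S(2,3))
      ultimately show "(q t1 has_integral 1) {a..b}" "(q t2 has_integral 1) {a..b}"
        by (metis diff_zero)+
    qed
    define \<phi> where "\<phi> t = Q t1 t - Q t2 t" for t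
    have \<phi>s: "smooth \<phi>" unfolding \<phi>_def[abs_def] by (intro smooth_diff Qs)
    have \<phi>d: "(\<phi> has_real_derivative q t1 t - q t2 t) (at t)" for t
      unfolding \<phi>_def[abs_def] by (intro DERIV_diff Qd)
    have \<phi>': "deriv_along 1 \<phi> t = q t1 t - q t2 t" for t
      using deriv_along_eq[OF \<phi>d[unfolded has_field_derivative_def]] by simp
    have \<phi>z: "\<phi> t = 0" if "t \<le> a \<or> b \<le> t" for t
    proof -
      have "t \<le> t1 \<or> t2 + d \<le> t" using that by (simp add: a_def b_def)
      then show ?thesis
      proof
        assume "t \<le> t1"
        then show ?thesis using t d by (simp add: \<phi>_def Qe S(2) divide_nonpos_pos)
      next
        assume "t2 + d \<le> t"
        then show ?thesis using t d by (simp add: \<phi>_def Qe S(3))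
      qed
    qed
    have cab: "continuous_on {a..b} A" "continuous_on {a..b} B" "continuous_on {a..b} P" "continuous_on {a..b} c"
      using A B Pc cc ab by (auto intro: continuous_on_subset)
    have \<phi>P: "((\<lambda>t. (q t1 t - q t2 t) * P t + \<phi> t * B t) has_integral \<phi> b * P b - \<phi> a * P a) {a..b}"
    proof (rule fundamental_theorem_of_calculus)
      fix x assume "x \<in> {a..b}"
      then have "(P has_real_derivative B x) (at x)" using P ab by auto
      then have "((\<lambda>t. \<phi> t * P t) has_real_derivative \<phi> x * B x + (q t1 x - q t2 x) * P x) (at x)"
        by (intro DERIV_mult' \<phi>d)
      then show "((\<lambda>t. \<phi> t * P t) has_vector_derivative (q t1 x - q t2 x) * P x + \<phi> x * B x) (at x within {a..b})"
        by (simp add: has_real_derivative_iff_has_vector_derivative add.commute has_vector_derivative_at_within)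
    qed (use ab in simp)
    have "(\<lambda>t. (q t1 t - q t2 t) * A t + \<phi> t * B t) integrable_on {a..b}"
      by (intro integrable_continuous_interval continuous_intros cab qc smooth_continuous \<phi>s)
    moreover have "integral {a..b} (\<lambda>t. (q t1 t - q t2 t) * A t + \<phi> t * B t) = 0"
    proof -
      have "\<phi> t = 0" if "t \<notin> {a..b}" for t using that by (intro \<phi>z) auto
      from weak[OF \<phi>s ab(1-3) this] show ?thesis by (simp add: \<phi>')
    qed
    ultimately have "((\<lambda>t. (q t1 t - q t2 t) * A t + \<phi> t * B t) has_integral 0) {a..b}"
      by (simp add: has_integral_integrable_integral)
    from has_integral_diff[OF this \<phi>P]
    have I1: "((\<lambda>t. (q t1 t - q t2 t) * c t) has_integral 0) {a..b}"
      using \<phi>z by (simp add: c_def algebra_simps)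
    have "((\<lambda>t. q t1 t * c t1 - q t2 t * c t2) has_integral 1 * c t1 - 1 * c t2) {a..b}"
      by (intro has_integral_diff has_integral_mult_left q1)
    from has_integral_diff[OF this I1]
    have I2: "((\<lambda>t. q t1 t * (c t1 - c t) - q t2 t * (c t2 - c t)) has_integral c t1 - c t2) {a..b}"
      by (simp add: algebra_simps)
    have I3: "((\<lambda>t. e * q t1 t + e * q t2 t) has_integral e * 1 + e * 1) {a..b}"
      by (intro has_integral_add has_integral_mult_right q1)
    \<comment> \<open>Each weight has mass 1 and is supported where c is within e of its value at t1
      or t2, so each of the two averages costs at most e.\<close>
    have "norm (integral {a..b} (\<lambda>t. q t1 t * (c t1 - c t) - q t2 t * (c t2 - c t))) \<le> integral {a..b} (\<lambda>t. e * q t1 t + e * q t2 t)"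
    proof (rule integral_norm_bound_integral)
      fix t
      have "\<bar>q t1 t * (c t1 - c t)\<bar> \<le> e * q t1 t"
      proof (cases "t < t1 \<or> t1 + d < t")
        case False
        then have "\<bar>c t - c t1\<bar> < e" using d by (intro d1(2)) auto
        then show ?thesis using q0[of t1 t] by (simp add: abs_mult mult.commute[of e] mult_left_mono abs_minus_commute)
      qed (use qz in auto)
      moreover have "\<bar>q t2 t * (c t2 - c t)\<bar> \<le> e * q t2 t"
      proof (cases "t < t2 \<or> t2 + d < t")
        case False
        then have "\<bar>c t - c t2\<bar> < e" using d by (intro d2(2)) auto
        then show ?thesis using q0[of t2 t] by (simp add: abs_mult mult.commute[of e] mult_left_mono abs_minus_commute)
      qed (use qz in auto)
      ultimately show "norm (q t1 t * (c t1 - c t) - q t2 t * (c t2 - c t)) \<le> e * q t1 t + e * q t2 t"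
        by simp
    qed (use I2 I3 in \<open>auto simp: integrable_on_def\<close>)
    then show ?thesis using I2 I3 by (simp add: integral_unique)
  qed
  then have "\<bar>c t1 - c t2\<bar> \<le> e" if "0 < e" for e
    using that by (metis half_gt_zero_iff mult.commute field_sum_of_halves mult_2)
  then have "\<bar>c t1 - c t2\<bar> \<le> 0"
    using field_le_epsilon[of "\<bar>c t1 - c t2\<bar>" 0] by simp
  then have "c t1 = c t2" by simp
  moreover have "integral {t1..t2} B = P t2 - P t1" using t by (intro P_int) auto
  ultimately show ?thesis by (simp add: c_def)
qed

section \<open>Borel representatives\<close>

text \<open>The bridge from the integrals of the definitions to \<open>lborel\<close>. Measurability
  of f comes from f' by completeness of Lebesgue measure, so the integrands of the weak equation
  need only be identified almost everywhere.\<close>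

lemma lebesgue_integral_eq_lborel:
  fixes f f' :: "real^3 \<Rightarrow> real"
  assumes f': "f' \<in> borel_measurable borel" and eq: "AE x in lborel. f x = f' x"
  shows "(LINT x|lebesgue. f x) = (LINT x|lborel. f' x)"
proof -
  have m: "f' \<in> borel_measurable lebesgue"
    using f' by (intro measurable_completion) simp
  have ae: "AE x in lebesgue. f' x = f x"
    unfolding AE_completion_iff using eq by eventually_elim simp
  have "f \<in> borel_measurable lebesgue"
    by (rule borel_measurable_AE[OF m ae])
  then have "(LINT x|lebesgue. f' x) = (LINT x|lebesgue. f x)"
    using m ae by (intro integral_cong_AE) auto
  then show ?thesis
    using integral_completion[of f' lborel] f' by simp
qed

lemma Linf_AE_le:
  assumes "f \<in> Linf"
  shows "AE x in lborel. norm (f x) \<le> Linf_norm f" "0 \<le> Linf_norm f"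
proof -
  define E where "E = esssup lebesgue (\<lambda>x. ereal (norm (f x)))"
  have "AE x in lebesgue. ereal (norm (f x)) \<le> E"
    unfolding E_def by (rule esssup_AE)
  then have ae: "AE x in lborel. ereal (norm (f x)) \<le> E"
    by (simp add: AE_completion_iff)
  have E1: "E < \<infinity>" using assms by (simp add: Linf_def E_def)
  \<comment> \<open>A negative essential supremum, including minus infinity, would put a nonnegative
    norm below it almost everywhere, which is impossible since the measure is not zero. Together
    with finiteness this makes \<open>real_of_ereal\<close> faithful.\<close>
  have E0: "0 \<le> E"
  proof (rule ccontr)
    assume "\<not> 0 \<le> E"
    then have "\<not> ereal (norm (f x)) \<le> E" for x
      by (meson ereal_less_eq(5) norm_ge_zero order_trans)
    then have "AE x in (lborel :: (real^3) measure). False"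
      using ae by simp
    then have "ae_filter (lborel :: (real^3) measure) = bot"
      by (simp add: trivial_limit_def)
    then show False by (simp add: ae_filter_eq_bot_iff)
  qed
  have E: "E = ereal (Linf_norm f)"
    using E0 E1 by (cases E) (auto simp: Linf_norm_def E_def)
  show "AE x in lborel. norm (f x) \<le> Linf_norm f" using ae by (simp add: E)
  show "0 \<le> Linf_norm f" using E0 by (simp add: E)
qed

lemma Linf_norm_le:
  assumes f: "f \<in> borel_measurable lebesgue" and c: "AE x in lborel. norm (f x) \<le> c"
  shows "f \<in> Linf" "Linf_norm f \<le> c"
proof -
  have "AE x in lebesgue. ereal (norm (f x)) \<le> ereal c"
    using c by (simp add: AE_completion_iff)
  then have le: "esssup lebesgue (\<lambda>x. ereal (norm (f x))) \<le> ereal c"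
    using f by (intro esssup_I) auto
  then show fL: "f \<in> Linf"
    using f by (auto simp: Linf_def intro: le_less_trans)
  show "Linf_norm f \<le> c"
  proof (cases "esssup lebesgue (\<lambda>x. ereal (norm (f x)))")
    case (real r)
    then show ?thesis using le by (simp add: Linf_norm_def)
  next
    \<comment> \<open>\<open>real_of_ereal\<close> would hide this value as 0; it is excluded
      because the measure is not zero.\<close>
    case MInf
    then have "AE x in (lborel :: (real^3) measure). False"
      using esssup_AE[of "\<lambda>x. ereal (norm (f x))" lebesgue] by (simp add: AE_completion_iff)
    then have "ae_filter (lborel :: (real^3) measure) = bot"
      by (simp add: trivial_limit_def)
    then show ?thesis by (simp add: ae_filter_eq_bot_iff)
  qed (use le in simp)
qed

lemma norm_power2_vec: "(norm (x :: real^3))\<^sup>2 = (\<Sum>i\<in>UNIV. (x $ i)\<^sup>2)"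
  unfolding power2_norm_eq_inner by (simp add: inner_vec_def power2_eq_square)

text \<open>The bound is put on the sum of squares rather than on each component: it is this joint
  bound that later gives the constant M^2 without a factor 3.\<close>

lemma borel_representative:
  assumes f2: "f \<in> L2" and fi: "f \<in> Linf"
  shows "\<exists>U :: 3 \<Rightarrow> real^3 \<Rightarrow> real. (\<forall>i. sq (U i)) \<and> (\<forall>x. (\<Sum>i\<in>UNIV. (U i x)\<^sup>2) \<le> (Linf_norm f)\<^sup>2) \<and>
    (AE x in lborel. \<forall>i. U i x = f x $ i)"
proof -
  have fm: "f \<in> borel_measurable lebesgue" using f2 by (simp add: L2_def)
  have "\<exists>g'\<in>borel_measurable lborel. AE x in lborel. f x $ i = g' x" for i
  proof (rule completion_ex_borel_measurable_real)
    have "(\<lambda>x. f x \<bullet> axis i 1) \<in> borel_measurable lebesgue" using fm by measurable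
    then show "(\<lambda>x. f x $ i) \<in> borel_measurable lebesgue" by (simp add: inner_axis)
  qed
  then have "\<forall>i. \<exists>g'. g' \<in> borel_measurable borel \<and> (AE x in lborel. f x $ i = g' x)"
    by (simp add: Bex_def)
  from choice[OF this] obtain V :: "3 \<Rightarrow> real^3 \<Rightarrow> real"
    where V: "\<And>i. V i \<in> borel_measurable borel" "\<And>i. AE x in lborel. f x $ i = V i x"
    by blast
  \<comment> \<open>All components are set to 0 together wherever the joint bound fails, which
    happens only on a null set.\<close>
  define U where "U i x = (if (\<Sum>k\<in>UNIV. (V k x)\<^sup>2) \<le> (Linf_norm f)\<^sup>2 then V i x else 0)" for i x
  have Um: "U i \<in> borel_measurable borel" for i
  proof -
    have "(\<lambda>x. \<Sum>k\<in>UNIV. (V k x)\<^sup>2) \<in> borel_measurable borel"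
      by (intro borel_measurable_sum borel_measurable_power V(1))
    then have "{x \<in> space borel. (\<Sum>k\<in>UNIV. (V k x)\<^sup>2) \<le> (Linf_norm f)\<^sup>2} \<in> sets borel"
      by (rule borel_measurable_le[OF _ borel_measurable_const])
    then show ?thesis
      unfolding U_def[abs_def] by (intro measurable_If V(1)) auto
  qed
  have "AE x in lborel. \<forall>i. f x $ i = V i x"
    by (rule AE_all_countable[THEN iffD2], rule allI, rule V(2))
  then have ae: "AE x in lborel. \<forall>i. U i x = f x $ i"
    using Linf_AE_le(1)[OF fi]
  proof eventually_elim
    case (elim x)
    have "(\<Sum>k\<in>UNIV. (V k x)\<^sup>2) = (norm (f x))\<^sup>2"
      unfolding norm_power2_vec using elim(1) by simp
    then have "(\<Sum>k\<in>UNIV. (V k x)\<^sup>2) \<le> (Linf_norm f)\<^sup>2"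
      using elim(2) by (simp add: power_mono)
    then show ?case using elim(1) by (simp add: U_def)
  qed
  have bound: "(\<Sum>i\<in>UNIV. (U i x)\<^sup>2) \<le> (Linf_norm f)\<^sup>2" for x
    by (cases "(\<Sum>k\<in>UNIV. (V k x)\<^sup>2) \<le> (Linf_norm f)\<^sup>2") (simp_all add: U_def)
  have "integrable lebesgue (\<lambda>x. (norm (f x))\<^sup>2)" using f2 by (simp add: L2_def)
  then have "integrable lebesgue (\<lambda>x. \<Sum>i\<in>UNIV. (U i x)\<^sup>2)"
  proof (rule integrable_cong_AE_imp)
    show "(\<lambda>x. \<Sum>i\<in>UNIV. (U i x)\<^sup>2) \<in> borel_measurable lebesgue"
      using Um by (intro measurable_completion) simp
    show "AE x in lebesgue. (norm (f x))\<^sup>2 = (\<Sum>i\<in>UNIV. (U i x)\<^sup>2)"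
      unfolding AE_completion_iff using ae by eventually_elim (simp add: norm_power2_vec)
  qed
  then have int: "integrable lborel (\<lambda>x. \<Sum>i\<in>UNIV. (U i x)\<^sup>2)"
    using Um by (subst (asm) integrable_completion) auto
  have "sq (U i)" for i
  proof -
    have "integrable lborel (\<lambda>x. (U i x)\<^sup>2)"
    proof (rule Bochner_Integration.integrable_bound[OF int])
      have "(U i x)\<^sup>2 \<le> (\<Sum>i\<in>UNIV. (U i x)\<^sup>2)" for x
        by (rule member_le_sum[of i UNIV "\<lambda>i. (U i x)\<^sup>2"]) auto
      then show "AE x in lborel. norm ((U i x)\<^sup>2) \<le> norm (\<Sum>i\<in>UNIV. (U i x)\<^sup>2)"
        by (intro AE_I2) (simp add: sum_nonneg)
    qed (use Um in simp)
    then show ?thesis using Um by (simp add: sq_def)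
  qed
  then show ?thesis using ae bound by blast
qed

lemma L2_norm_representative:
  assumes "\<And>i. sq (U i)" "AE x in lborel. \<forall>i. U i x = f x $ i"
  shows "(L2_norm f)\<^sup>2 = (\<Sum>i\<in>UNIV. ip (U i) (U i))"
proof -
  have "(LINT x|lebesgue. (norm (f x))\<^sup>2) = (LINT x|lborel. (\<Sum>i\<in>UNIV. (U i x)\<^sup>2))"
  proof (rule lebesgue_integral_eq_lborel)
    show "(\<lambda>x. \<Sum>i\<in>UNIV. (U i x)\<^sup>2) \<in> borel_measurable borel"
      using sq_measurable[OF assms(1)] by simp
    show "AE x in lborel. (norm (f x))\<^sup>2 = (\<Sum>i\<in>UNIV. (U i x)\<^sup>2)"
      using assms(2) by eventually_elim (simp add: norm_power2_vec)
  qed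
  also have "\<dots> = (\<Sum>i\<in>UNIV. ip (U i) (U i))"
    using sq_integrable[OF assms(1)] by (simp add: ip_self_eq)
  finally have "(LINT x|lebesgue. (norm (f x))\<^sup>2) = (\<Sum>i\<in>UNIV. ip (U i) (U i))" .
  then show ?thesis unfolding L2_norm_def by (simp add: sum_nonneg)
qed

section \<open>Test fields of product form\<close>

text \<open>With a test field of this form and a fixed F, the space-time equation becomes a
  statement about the weak time derivative of the scalar function t -> <u(t), F>.\<close>

definition tensor :: "(real \<Rightarrow> real) \<Rightarrow> (3 \<Rightarrow> real^3 \<Rightarrow> real) \<Rightarrow> (real^3) \<times> real \<Rightarrow> real^3" where
  "tensor \<phi> F z = \<phi> (snd z) *\<^sub>R (\<Sum>i\<in>UNIV. F i (fst z) *\<^sub>R axis i 1)"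

lemma tensor_nth: "tensor \<phi> F (x, t) $ i = \<phi> t * F i x"
  by (simp add: tensor_def axis_def if_distrib[of "\<lambda>c. _ * c"] cong: if_cong)

lemma smooth_tensor:
  assumes "smooth \<phi>" "\<And>i. smooth (F i)"
  shows "smooth (tensor \<phi> F)"
proof -
  have "smooth (\<lambda>z. \<phi> (snd z + 0))" "smooth (\<lambda>z. F i (fst z + 0))" for i
    by (rule smooth_affine[OF bounded_linear_snd assms(1)], rule smooth_affine[OF bounded_linear_fst assms(2)])
  then show ?thesis
    unfolding tensor_def[abs_def] by (intro smooth_scaleR smooth_sum smooth_const) simp_all
qed

lemma deriv_along_tensor:
  assumes "smooth \<phi>" "\<And>i. smooth (F i)"
  shows "deriv_along (h, k) (tensor \<phi> F) (x, t) =
    (k * deriv_along 1 \<phi> t) *\<^sub>R (\<Sum>i\<in>UNIV. F i x *\<^sub>R axis i 1) + \<phi> t *\<^sub>R (\<Sum>i\<in>UNIV. deriv_along h (F i) x *\<^sub>R axis i 1)"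
proof -
  have 1: "((\<lambda>z. \<phi> (snd z)) has_derivative (\<lambda>v. deriv_along (snd v) \<phi> (snd (x, t)))) (at (x, t))"
    by (rule has_derivative_compose[where f = snd, OF bounded_linear_imp_has_derivative[OF bounded_linear_snd] smooth_has_derivative[OF assms(1)]])
  have 2: "((\<lambda>z. F i (fst z)) has_derivative (\<lambda>v. deriv_along (fst v) (F i) (fst (x, t)))) (at (x, t))" for i
    by (rule has_derivative_compose[where f = fst, OF bounded_linear_imp_has_derivative[OF bounded_linear_fst] smooth_has_derivative[OF assms(2)]])
  have 3: "((\<lambda>z. \<Sum>i\<in>UNIV. F i (fst z) *\<^sub>R axis i 1) has_derivative (\<lambda>v. \<Sum>i\<in>UNIV. deriv_along (fst v) (F i) (fst (x, t)) *\<^sub>R axis i 1)) (at (x, t))"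
    by (intro has_derivative_sum has_derivative_scaleR_left 2)
  have "deriv_along k \<phi> t = k * deriv_along 1 \<phi> t"
    using linear_scale[OF has_derivative_linear[OF smooth_has_derivative[OF assms(1)]], of k 1] by simp
  then show ?thesis
    using deriv_along_eq[OF has_derivative_scaleR[OF 1 3], of "(h, k)"]
    by (simp add: tensor_def[abs_def] add.commute)
qed

lemma deriv_along_0 [simp]: "smooth f \<Longrightarrow> deriv_along 0 f x = 0"
  using linear_0[OF has_derivative_linear[OF smooth_has_derivative]] by blast

lemma time_deriv_tensor:
  assumes "smooth \<phi>" "\<And>i. smooth (F i)"
  shows "time_deriv (tensor \<phi> F) (x, t) = tensor (deriv_along 1 \<phi>) F (x, t)"
  using assms by (simp add: time_deriv_def deriv_along_tensor tensor_def)

lemma space_deriv_tensor: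
  assumes "smooth \<phi>" "\<And>i. smooth (F i)"
  shows "space_deriv j (tensor \<phi> F) = tensor \<phi> (\<lambda>i. pd j (F i))"
  using assms by (auto simp: space_deriv_def deriv_along_tensor tensor_def fun_eq_iff)

lemma tensor_test_function:
  assumes \<phi>: "smooth \<phi>" "\<And>t. t \<notin> {a..b} \<Longrightarrow> \<phi> t = 0" and F: "\<And>i. bump (F i)" and ab: "0 < a" "b < T"
  shows "tensor \<phi> F \<in> test_functions (UNIV \<times> {0<..<T})"
proof -
  have "\<exists>r. \<forall>x. r < norm x \<longrightarrow> F i x = 0" for i using F by (simp add: bump_def)
  then obtain r where r: "\<And>i x. r i < norm x \<Longrightarrow> F i x = 0" by metis
  define R where "R = Max (range r)"
  have R: "F i x = 0" if "R < norm x" for i x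
    using that r[of i x] Max_ge[of "range r" "r i"] by (simp add: R_def)
  define K where "K = cball (0 :: real^3) R \<times> {a..b}"
  have K: "compact K" unfolding K_def by (intro compact_Times) auto
  have "{z. tensor \<phi> F z \<noteq> 0} \<subseteq> K"
  proof
    fix z assume z: "z \<in> {z. tensor \<phi> F z \<noteq> 0}"
    obtain x t where xt: "z = (x, t)" by (cases z)
    have "t \<in> {a..b}" using z \<phi>(2)[of t] by (auto simp: xt tensor_def)
    moreover have "norm x \<le> R"
    proof (rule ccontr)
      assume "\<not> norm x \<le> R"
      then have "F i x = 0" for i by (intro R) simp
      then show False using z by (simp add: xt tensor_def)
    qed
    ultimately show "z \<in> K" by (simp add: xt K_def)
  qed
  then have "closure {z. tensor \<phi> F z \<noteq> 0} \<subseteq> K" "bounded {z. tensor \<phi> F z \<noteq> 0}"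
    using K by (auto simp: closure_minimal compact_imp_closed intro: bounded_subset compact_imp_bounded)
  moreover have "K \<subseteq> UNIV \<times> {0<..<T}" using ab by (auto simp: K_def)
  ultimately show ?thesis
    using smooth_tensor[of \<phi> F, OF \<phi>(1) bump_smooth[OF F]]
    by (auto simp: test_functions_def smooth_def)
qed

section \<open>Strong solutions in components\<close>

text \<open>\<open>U t i\<close> is a Borel representative of the \<open>i\<close>-th component of \<open>u t\<close> which is bounded everywhere,
  not only almost everywhere. The pressure is absent since the test fields \<open>F\<close> are divergence free.\<close>

definition component_solution :: "real \<Rightarrow> (real \<Rightarrow> real) \<Rightarrow> (real \<Rightarrow> 3 \<Rightarrow> real^3 \<Rightarrow> real) \<Rightarrow> bool" where
  "component_solution T m U \<longleftrightarrow>
     (\<forall>i. l2cont {0<..<T} (\<lambda>t. U t i)) \<and>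
     continuous_on {0<..<T} m \<and>
     (\<forall>t\<in>{0<..<T}. 0 \<le> m t) \<and>
     (\<forall>t\<in>{0<..<T}. \<forall>x. (\<Sum>i\<in>UNIV. (U t i x)\<^sup>2) \<le> (m t)\<^sup>2) \<and>
     (\<forall>t\<in>{0<..<T}. \<forall>g. bump g \<longrightarrow> (\<Sum>i\<in>UNIV. ip (U t i) (pd i g)) = 0) \<and>
     (\<forall>F t1 t2. (\<forall>i. bump (F i)) \<longrightarrow> (\<forall>x. (\<Sum>i\<in>UNIV. pd i (F i) x) = 0) \<longrightarrow> 0 < t1 \<longrightarrow> t1 < t2 \<longrightarrow> t2 < T \<longrightarrow>
        (\<Sum>i\<in>UNIV. ip (U t2 i) (F i)) - (\<Sum>i\<in>UNIV. ip (U t1 i) (F i)) =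
        integral {t1..t2} (\<lambda>t. (\<Sum>i\<in>UNIV. \<Sum>j\<in>UNIV. ip (U t i) (pd j (pd j (F i))))
          + (\<Sum>i\<in>UNIV. \<Sum>j\<in>UNIV. ip (\<lambda>x. U t i x * U t j x) (pd j (F i)))))"

lemma component_le:
  assumes "(\<Sum>i\<in>UNIV. (U i)\<^sup>2) \<le> m\<^sup>2" "0 \<le> m"
  shows "\<bar>U (i::3) :: real\<bar> \<le> m"
proof -
  have "(U i)\<^sup>2 \<le> (\<Sum>i\<in>UNIV. (U i)\<^sup>2)" by (rule member_le_sum[of i UNIV "\<lambda>i. (U i)\<^sup>2"]) auto
  then have "(U i)\<^sup>2 \<le> m\<^sup>2" using assms by simp
  then show ?thesis using assms(2) abs_le_square_iff[of "U i" m] by simp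
qed

lemma set_integral_eq_integral_Icc:
  fixes h :: "real \<Rightarrow> real"
  assumes c: "continuous_on {a..b} h" and z: "\<And>t. t \<notin> {a..b} \<Longrightarrow> h t = 0" and sub: "{a..b} \<subseteq> I"
  shows "(LINT t:I|lebesgue. h t) = integral {a..b} h"
proof -
  have "(LINT t:I|lebesgue. h t) = (LINT t:{a..b}|lebesgue. h t)"
    unfolding set_lebesgue_integral_def using z sub
    by (intro Bochner_Integration.integral_cong) (auto simp: indicator_def)
  also have "\<dots> = integral {a..b} h"
    by (rule set_lebesgue_integral_eq_integral(2)[OF absolutely_integrable_continuous_real[OF c]])
  finally show ?thesis .
qed

lemma bump_test_function:
  fixes g :: "real^3 \<Rightarrow> real"
  assumes "bump g"
  shows "g \<in> test_functions UNIV"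
proof -
  obtain r where "\<And>x. r < norm x \<Longrightarrow> g x = 0" using bump_support[OF assms] by metis
  then have "{x. g x \<noteq> 0} \<subseteq> cball 0 r" by (auto simp: not_less[symmetric])
  then have "bounded {x. g x \<noteq> 0}" by (rule bounded_subset[OF bounded_cball])
  then show ?thesis
    using bump_smooth[OF assms] by (auto simp: test_functions_def smooth_def)
qed

text \<open>For divergence free F, testing with \<open>tensor \<phi> F\<close> says that <u(t), F>
  has the continuous weak derivative \<open>Lp t + N t\<close>, and
  \<open>weak_derivative_integral\<close> turns this into an identity between any two times.
  Continuity of the nonlinear part \<open>N\<close> needs both curve conditions: L^2 for the
  differences, L^infinity for local bounds.\<close>

lemma strong_solution_components:
  assumes sol: "strong_solution T u"
  obtains U where "component_solution T (\<lambda>t. Linf_norm (u t)) U"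
    "\<And>t. t \<in> {0<..<T} \<Longrightarrow> AE x in lborel. \<forall>i. U t i x = u t x $ i"
proof -
  define I where "I = {0<..<T}"
  define m where "m t = Linf_norm (u t)" for t
  have c2: "\<And>t. t \<in> I \<Longrightarrow> u t \<in> L2" "\<And>t. t \<in> I \<Longrightarrow> ((\<lambda>s. L2_norm (\<lambda>x. u s x - u t x)) \<longlongrightarrow> 0) (at t within I)"
    and ci: "\<And>t. t \<in> I \<Longrightarrow> u t \<in> Linf" "\<And>t. t \<in> I \<Longrightarrow> ((\<lambda>s. Linf_norm (\<lambda>x. u s x - u t x)) \<longlongrightarrow> 0) (at t within I)"
    and dv: "\<And>t. t \<in> I \<Longrightarrow> weakly_divergence_free (u t)"
    using sol by (auto simp: strong_solution_def continuous_curve_def I_def)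
  obtain p where weq: "\<And>f. f \<in> test_functions (UNIV \<times> I) \<Longrightarrow>
           (LINT t:I|lebesgue. LINT x|lebesgue.
              u t x \<bullet> (time_deriv f (x, t) + laplacian f (x, t)) + p (x, t) * divergence f (x, t))
           = - (LINT t:I|lebesgue. LINT x|lebesgue. u t x \<bullet> advection (u t x) f (x, t))"
    using sol unfolding strong_solution_def I_def by blast
  have "\<forall>t\<in>I. \<exists>U :: 3 \<Rightarrow> real^3 \<Rightarrow> real. (\<forall>i. sq (U i)) \<and> (\<forall>x. (\<Sum>i\<in>UNIV. (U i x)\<^sup>2) \<le> (m t)\<^sup>2) \<and>
    (AE x in lborel. \<forall>i. U i x = u t x $ i)"
    unfolding m_def using borel_representative[OF c2(1) ci(1)] by blast
  from bchoice[OF this] obtain U :: "real \<Rightarrow> 3 \<Rightarrow> real^3 \<Rightarrow> real" where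
    Us: "\<And>t i. t \<in> I \<Longrightarrow> sq (U t i)" and Ub: "\<And>t x. t \<in> I \<Longrightarrow> (\<Sum>i\<in>UNIV. (U t i x)\<^sup>2) \<le> (m t)\<^sup>2"
    and Ua: "\<And>t. t \<in> I \<Longrightarrow> AE x in lborel. \<forall>i. U t i x = u t x $ i"
    by blast
  have m0: "0 \<le> m t" if "t \<in> I" for t
    unfolding m_def by (rule Linf_AE_le(2)[OF ci(1)[OF that]])
  have Um: "\<bar>U t i x\<bar> \<le> m t" if "t \<in> I" for t i x
    by (rule component_le[OF Ub[OF that] m0[OF that]])
  have L: "l2cont I (\<lambda>t. U t i)" for i
    unfolding l2cont_def
  proof (intro conjI ballI)
    fix t assume t: "t \<in> I"
    show "sq (U t i)" by (rule Us[OF t])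
    show "((\<lambda>s. nrm (\<lambda>x. U s i x - U t i x)) \<longlongrightarrow> 0) (at t within I)"
    proof (rule tendsto_zero_within_le[OF c2(2)[OF t] refl])
      fix s assume s: "s \<in> I"
      have sqd: "sq (\<lambda>x. U s k x - U t k x)" for k by (intro sq_diff Us s t)
      have ae: "AE x in lborel. \<forall>k. U s k x - U t k x = (u s x - u t x) $ k"
        using Ua[OF s] Ua[OF t] by eventually_elim simp
      have "(nrm (\<lambda>x. U s i x - U t i x))\<^sup>2 \<le> (\<Sum>k\<in>UNIV. ip (\<lambda>x. U s k x - U t k x) (\<lambda>x. U s k x - U t k x))"
        unfolding nrm_power2 by (rule member_le_sum[of i UNIV "\<lambda>k. ip (\<lambda>x. U s k x - U t k x) (\<lambda>x. U s k x - U t k x)"]) auto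
      also have "\<dots> = (L2_norm (\<lambda>x. u s x - u t x))\<^sup>2"
        using L2_norm_representative[of "\<lambda>k x. U s k x - U t k x" "\<lambda>x. u s x - u t x"] sqd ae by simp
      finally show "nrm (\<lambda>x. U s i x - U t i x) \<le> L2_norm (\<lambda>x. u s x - u t x)"
        by (rule power2_le_imp_le) (simp add: L2_norm_def)
    qed simp
  qed
  have mc: "continuous_on I m"
    unfolding continuous_on_def
  proof
    fix t assume t: "t \<in> I"
    have "((\<lambda>s. \<bar>m s - m t\<bar>) \<longlongrightarrow> 0) (at t within I)"
    proof (rule tendsto_zero_within_le[OF ci(2)[OF t] refl])
      fix s assume s: "s \<in> I"
      have bs: "AE x in lborel. norm (u s x) \<le> m s" and bt: "AE x in lborel. norm (u t x) \<le> m t"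
        unfolding m_def by (intro Linf_AE_le(1) ci s t)+
      have meas: "u s \<in> borel_measurable lebesgue" "u t \<in> borel_measurable lebesgue"
        using c2(1)[OF s] c2(1)[OF t] by (auto simp: L2_def)
      then have md: "(\<lambda>x. u s x - u t x) \<in> borel_measurable lebesgue" by simp
      \<comment> \<open>The number \<open>Linf_norm\<close> of the difference bounds it only once
        the difference is known to lie in \<open>Linf\<close>, so a crude bound comes first. The
        reverse triangle inequality follows.\<close>
      have "AE x in lborel. norm (u s x - u t x) \<le> m s + m t"
        using bs bt by eventually_elim (rule order_trans[OF norm_triangle_ineq4 add_mono])
      from Linf_norm_le(1)[OF md this] have "(\<lambda>x. u s x - u t x) \<in> Linf" .
      from Linf_AE_le(1)[OF this]
      have bd: "AE x in lborel. norm (u s x - u t x) \<le> Linf_norm (\<lambda>x. u s x - u t x)" .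
      have "m s \<le> m t + Linf_norm (\<lambda>x. u s x - u t x)"
        unfolding m_def[of s]
      proof (rule Linf_norm_le(2)[OF meas(1)])
        show "AE x in lborel. norm (u s x) \<le> m t + Linf_norm (\<lambda>x. u s x - u t x)"
          using bt bd
        proof eventually_elim
          case (elim x)
          then show ?case using norm_triangle_ineq2[of "u s x" "u t x"] by linarith
        qed
      qed
      moreover have "m t \<le> m s + Linf_norm (\<lambda>x. u s x - u t x)"
        unfolding m_def[of t]
      proof (rule Linf_norm_le(2)[OF meas(2)])
        show "AE x in lborel. norm (u t x) \<le> m s + Linf_norm (\<lambda>x. u s x - u t x)"
          using bs bd
        proof eventually_elim
          case (elim x)
          then show ?case using norm_triangle_ineq3[of "u s x" "u t x"] by linarith
        qed
      qed
      ultimately show "\<bar>m s - m t\<bar> \<le> Linf_norm (\<lambda>x. u s x - u t x)" by linarith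
    qed simp
    then have "((\<lambda>s. m s - m t) \<longlongrightarrow> 0) (at t within I)" by (rule tendsto_rabs_zero_cancel)
    then show "(m \<longlongrightarrow> m t) (at t within I)" by (simp add: LIM_zero_iff)
  qed
  have bmeas: "U t i \<in> borel_measurable borel" if "t \<in> I" for t i
    by (rule sq_measurable[OF Us[OF that]])
  have div: "(\<Sum>i\<in>UNIV. ip (U t i) (pd i g)) = 0" if t: "t \<in> I" and g: "bump g" for t g
  proof -
    have bp: "bump (pd i g)" for i by (rule bump_deriv_along[OF g])
    have "(LINT x|lebesgue. u t x \<bullet> gradient g x) = (LINT x|lborel. (\<Sum>i\<in>UNIV. U t i x * pd i g x))"
    proof (rule lebesgue_integral_eq_lborel)
      show "(\<lambda>x. \<Sum>i\<in>UNIV. U t i x * pd i g x) \<in> borel_measurable borel"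
        by (intro borel_measurable_sum borel_measurable_times bmeas t bump_measurable bp)
      show "AE x in lborel. u t x \<bullet> gradient g x = (\<Sum>i\<in>UNIV. U t i x * pd i g x)"
        using Ua[OF t] by eventually_elim (simp add: inner_vec_def gradient_def)
    qed
    then have "(LINT x|lborel. (\<Sum>i\<in>UNIV. U t i x * pd i g x)) = 0"
      using dv[OF t] bump_test_function[OF g] by (simp add: weakly_divergence_free_def)
    then show ?thesis
      using sq_mult_integrable[OF Us[OF t] bump_sq[OF bp]] by (simp add: ip_def)
  qed
  have UU: "l2cont I (\<lambda>t x. U t i x * U t j x)" for i j
    by (rule l2cont_mult[OF L L mc Um Um mc])
  have weak: "(\<Sum>i\<in>UNIV. ip (U t2 i) (F i)) - (\<Sum>i\<in>UNIV. ip (U t1 i) (F i)) =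
        integral {t1..t2} (\<lambda>t. (\<Sum>i\<in>UNIV. \<Sum>j\<in>UNIV. ip (U t i) (pd j (pd j (F i))))
          + (\<Sum>i\<in>UNIV. \<Sum>j\<in>UNIV. ip (\<lambda>x. U t i x * U t j x) (pd j (F i))))"
    if F: "\<And>i. bump (F i)" and dF: "\<And>x. (\<Sum>i\<in>UNIV. pd i (F i) x) = 0" and t12: "0 < t1" "t1 < t2" "t2 < T" for F t1 t2
  proof -
    have F1: "bump (pd j (F i))" and F2: "bump (pd j (pd j (F i)))" for i j by (intro bump_deriv_along F)+
    note Fs = bump_smooth[OF F] bump_smooth[OF F1] bump_smooth[OF F2]
    define A where "A t = (\<Sum>i\<in>UNIV. ip (U t i) (F i))" for t
    define Lp where "Lp t = (\<Sum>i\<in>UNIV. \<Sum>j\<in>UNIV. ip (U t i) (pd j (pd j (F i))))" for t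
    define N where "N t = (\<Sum>i\<in>UNIV. \<Sum>j\<in>UNIV. ip (\<lambda>x. U t i x * U t j x) (pd j (F i)))" for t
    have Ac: "continuous_on I A"
      unfolding A_def[abs_def] by (intro continuous_on_sum l2cont_ip L l2cont_const bump_sq F)
    have Lc: "continuous_on I Lp"
      unfolding Lp_def[abs_def] by (intro continuous_on_sum l2cont_ip L l2cont_const bump_sq F2)
    have Nc: "continuous_on I N"
      unfolding N_def[abs_def] by (intro continuous_on_sum l2cont_ip UU l2cont_const bump_sq F1)
    have "A t2 - A t1 = integral {t1..t2} (\<lambda>t. Lp t + N t)"
    proof (rule weak_derivative_integral[OF _ _ _ t12])
      show "continuous_on {0<..<T} A" using Ac by (simp add: I_def)
      show "continuous_on {0<..<T} (\<lambda>t. Lp t + N t)"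
        using continuous_on_add[OF Lc Nc] by (simp add: I_def)
      fix \<phi> :: "real \<Rightarrow> real" and a b :: real
      assume \<phi>: "smooth \<phi>" and ab: "0 < a" "a < b" "b < T" and z: "\<And>t::real. t \<notin> {a..b} \<Longrightarrow> \<phi> t = 0"
      define f where "f = tensor \<phi> F"
      have f: "f \<in> test_functions (UNIV \<times> I)"
        unfolding f_def I_def by (rule tensor_test_function[OF \<phi> z F ab(1,3)])
      have sub: "{a..b} \<subseteq> I" using ab by (auto simp: I_def)
      have z': "deriv_along 1 \<phi> t = 0" if "t \<notin> {a..b}" for t
        by (rule deriv_along_locally_constant[of "- {a..b}"]) (use that z in auto)
      have lap: "laplacian f (x, t) = (\<Sum>j\<in>UNIV. tensor \<phi> (\<lambda>i. pd j (pd j (F i))) (x, t))" for x t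
        unfolding laplacian_def f_def by (simp add: space_deriv_tensor \<phi> Fs)
      \<comment> \<open>Here the pressure leaves the equation: it is multiplied by 0 at every point,
        before any question about its slices arises.\<close>
      have dvf: "divergence f (x, t) = 0" for x t
        unfolding divergence_def f_def
        using dF[of x] by (simp add: space_deriv_tensor \<phi> Fs tensor_nth sum_distrib_left[symmetric])
      have td: "time_deriv f (x, t) = tensor (deriv_along 1 \<phi>) F (x, t)" for x t
        unfolding f_def by (rule time_deriv_tensor[OF \<phi> Fs(1)])
      have adv: "advection v f (x, t) = (\<Sum>j\<in>UNIV. v $ j *\<^sub>R tensor \<phi> (\<lambda>i. pd j (F i)) (x, t))" for v x t
        unfolding advection_def f_def by (simp add: space_deriv_tensor \<phi> Fs)
      have left: "(LINT x|lebesgue. u t x \<bullet> (time_deriv f (x, t) + laplacian f (x, t)) + p (x, t) * divergence f (x, t))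
          = deriv_along 1 \<phi> t * A t + \<phi> t * Lp t" if t: "t \<in> I" for t
      proof -
        have "(LINT x|lebesgue. u t x \<bullet> (time_deriv f (x, t) + laplacian f (x, t)) + p (x, t) * divergence f (x, t))
          = (LINT x|lborel. deriv_along 1 \<phi> t * (\<Sum>i\<in>UNIV. U t i x * F i x)
             + \<phi> t * (\<Sum>i\<in>UNIV. \<Sum>j\<in>UNIV. U t i x * pd j (pd j (F i)) x))"
        proof (rule lebesgue_integral_eq_lborel)
          show "(\<lambda>x. deriv_along 1 \<phi> t * (\<Sum>i\<in>UNIV. U t i x * F i x)
             + \<phi> t * (\<Sum>i\<in>UNIV. \<Sum>j\<in>UNIV. U t i x * pd j (pd j (F i)) x)) \<in> borel_measurable borel"
            by (intro borel_measurable_add borel_measurable_sum borel_measurable_times borel_measurable_const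
                bmeas t bump_measurable F F2)
          show "AE x in lborel. u t x \<bullet> (time_deriv f (x, t) + laplacian f (x, t)) + p (x, t) * divergence f (x, t) =
             deriv_along 1 \<phi> t * (\<Sum>i\<in>UNIV. U t i x * F i x) + \<phi> t * (\<Sum>i\<in>UNIV. \<Sum>j\<in>UNIV. U t i x * pd j (pd j (F i)) x)"
            using Ua[OF t]
          proof eventually_elim
            case (elim x)
            have "u t x \<bullet> (time_deriv f (x, t) + laplacian f (x, t)) =
              (\<Sum>i\<in>UNIV. U t i x * (deriv_along 1 \<phi> t * F i x + (\<Sum>j\<in>UNIV. \<phi> t * pd j (pd j (F i)) x)))"
              using elim by (simp add: inner_vec_def td lap tensor_nth)
            also have "\<dots> = deriv_along 1 \<phi> t * (\<Sum>i\<in>UNIV. U t i x * F i x) + \<phi> t * (\<Sum>i\<in>UNIV. \<Sum>j\<in>UNIV. U t i x * pd j (pd j (F i)) x)"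
              by (simp add: distrib_left sum.distrib sum_distrib_left mult_ac)
            finally show ?case by (simp add: dvf)
          qed
        qed
        also have "\<dots> = deriv_along 1 \<phi> t * A t + \<phi> t * Lp t"
          using sq_mult_integrable[OF Us[OF t] bump_sq[OF F]] sq_mult_integrable[OF Us[OF t] bump_sq[OF F2]]
          by (simp add: A_def Lp_def ip_def)
        finally show ?thesis .
      qed
      have right: "(LINT x|lebesgue. u t x \<bullet> advection (u t x) f (x, t)) = \<phi> t * N t" if t: "t \<in> I" for t
      proof -
        have "(LINT x|lebesgue. u t x \<bullet> advection (u t x) f (x, t))
          = (LINT x|lborel. \<phi> t * (\<Sum>i\<in>UNIV. \<Sum>j\<in>UNIV. (U t i x * U t j x) * pd j (F i) x))"
        proof (rule lebesgue_integral_eq_lborel)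
          show "(\<lambda>x. \<phi> t * (\<Sum>i\<in>UNIV. \<Sum>j\<in>UNIV. (U t i x * U t j x) * pd j (F i) x)) \<in> borel_measurable borel"
            by (intro borel_measurable_sum borel_measurable_times borel_measurable_const bmeas t bump_measurable F1)
          show "AE x in lborel. u t x \<bullet> advection (u t x) f (x, t) = \<phi> t * (\<Sum>i\<in>UNIV. \<Sum>j\<in>UNIV. (U t i x * U t j x) * pd j (F i) x)"
            using Ua[OF t]
          proof eventually_elim
            case (elim x)
            have "u t x \<bullet> advection (u t x) f (x, t) = (\<Sum>i\<in>UNIV. U t i x * (\<Sum>j\<in>UNIV. U t j x * (\<phi> t * pd j (F i) x)))"
              using elim by (simp add: inner_vec_def adv tensor_nth)
            then show ?case by (simp add: sum_distrib_left mult_ac)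
          qed
        qed
        also have "\<dots> = \<phi> t * N t"
          using sq_mult_integrable[OF l2contD(1)[OF UU t] bump_sq[OF F1]] by (simp add: N_def ip_def)
        finally show ?thesis .
      qed
      have c\<phi>: "continuous_on X \<phi>" "continuous_on X (deriv_along 1 \<phi>)" for X
        by (intro smooth_continuous smooth_deriv_along \<phi>)+
      have cont: "continuous_on {a..b} (\<lambda>t. deriv_along 1 \<phi> t * A t + \<phi> t * Lp t)" "continuous_on {a..b} (\<lambda>t. \<phi> t * N t)"
        using Ac Lc Nc sub by (auto intro!: continuous_intros c\<phi> intro: continuous_on_subset)
      have "(LINT t:I|lebesgue. deriv_along 1 \<phi> t * A t + \<phi> t * Lp t) = (LINT t:I|lebesgue. LINT x|lebesgue.
              u t x \<bullet> (time_deriv f (x, t) + laplacian f (x, t)) + p (x, t) * divergence f (x, t))"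
        unfolding set_lebesgue_integral_def using left
        by (intro Bochner_Integration.integral_cong refl) (auto simp: indicator_def)
      also have "\<dots> = - (LINT t:I|lebesgue. LINT x|lebesgue. u t x \<bullet> advection (u t x) f (x, t))"
        by (rule weq[OF f])
      also have "(LINT t:I|lebesgue. LINT x|lebesgue. u t x \<bullet> advection (u t x) f (x, t)) = (LINT t:I|lebesgue. \<phi> t * N t)"
        unfolding set_lebesgue_integral_def using right
        by (intro Bochner_Integration.integral_cong refl) (auto simp: indicator_def)
      finally have "integral {a..b} (\<lambda>t. deriv_along 1 \<phi> t * A t + \<phi> t * Lp t) = - integral {a..b} (\<lambda>t. \<phi> t * N t)"
        using set_integral_eq_integral_Icc[OF cont(1) _ sub] set_integral_eq_integral_Icc[OF cont(2) _ sub] z z' by simp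
      moreover have "integral {a..b} (\<lambda>t. deriv_along 1 \<phi> t * A t + \<phi> t * (Lp t + N t)) =
         integral {a..b} (\<lambda>t. deriv_along 1 \<phi> t * A t + \<phi> t * Lp t) + integral {a..b} (\<lambda>t. \<phi> t * N t)"
        using integral_add[OF integrable_continuous_interval[OF cont(1)] integrable_continuous_interval[OF cont(2)]]
        by (simp add: algebra_simps)
      ultimately show "integral {a..b} (\<lambda>t. deriv_along 1 \<phi> t * A t + \<phi> t * (Lp t + N t)) = 0" by simp
    qed
    then show ?thesis by (simp add: A_def Lp_def N_def)
  qed
  show thesis
  proof (rule that[of U])
    show "component_solution T (\<lambda>t. Linf_norm (u t)) U"
      using L mc m0 Ub div weak unfolding component_solution_def I_def m_def by simp
    show "AE x in lborel. \<forall>i. U t i x = u t x $ i" if "t \<in> {0<..<T}" for t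
      using Ua[of t] that by (simp add: I_def)
  qed
qed

section \<open>Parity of mollifiers and its consequences for convolutions\<close>

lemma deriv_along_reflect:
  fixes k :: "'a::real_normed_vector \<Rightarrow> real"
  assumes "smooth k"
  shows "deriv_along h (\<lambda>y. k (x - y)) = (\<lambda>y. - deriv_along h k (x - y))"
proof
  fix y
  note d = smooth_has_derivative[OF assms, of "x - y"]
  have "((\<lambda>y. x - y) has_derivative (\<lambda>h. - h)) (at y)"
    by (auto intro!: derivative_eq_intros)
  from has_derivative_compose[OF this d]
  have "deriv_along h (\<lambda>y. k (x - y)) y = deriv_along (- h) k (x - y)"
    by (rule deriv_along_eq)
  then show "deriv_along h (\<lambda>y. k (x - y)) y = - deriv_along h k (x - y)"
    using linear_neg[OF has_derivative_linear[OF d]] by simp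
qed

lemma mollifier_even:
  assumes \<eta>: "mollifier \<delta> \<eta>"
  shows "\<eta> (- x) = \<eta> x" "deriv_along h \<eta> (- x) = - deriv_along h \<eta> x"
    "deriv_along k (deriv_along h \<eta>) (- x) = deriv_along k (deriv_along h \<eta>) x"
proof -
  have s: "smooth \<eta>" by (rule bump_smooth[OF mollifier_bump[OF \<eta>]])
  show e: "\<eta> (- x) = \<eta> x" for x using \<eta> by (simp add: mollifier_def)
  have odd: "deriv_along h \<eta> (- x) = - deriv_along h \<eta> x" for h x
  proof -
    have "(\<lambda>y. \<eta> (0 - y)) = \<eta>" by (simp add: e)
    then have "deriv_along h \<eta> x = - deriv_along h \<eta> (0 - x)"
      using fun_cong[OF deriv_along_reflect[OF s, of h 0], of x] by metis
    then show ?thesis by simp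
  qed
  show "deriv_along h \<eta> (- x) = - deriv_along h \<eta> x" by (rule odd)
  have "(\<lambda>y. deriv_along h \<eta> (0 - y)) = (\<lambda>y. - 1 * deriv_along h \<eta> y)"
    using odd by (simp add: fun_eq_iff)
  then have "deriv_along k (\<lambda>y. deriv_along h \<eta> (0 - y)) = (\<lambda>y. - 1 * deriv_along k (deriv_along h \<eta>) y)"
    unfolding deriv_along_cmult[OF smooth_deriv_along[OF s, of h], symmetric] by (rule arg_cong)
  then have "- deriv_along k (deriv_along h \<eta>) (0 - x) = - 1 * deriv_along k (deriv_along h \<eta>) x"
    unfolding deriv_along_reflect[OF smooth_deriv_along[OF s, of h]] by (rule fun_cong)
  then show "deriv_along k (deriv_along h \<eta>) (- x) = deriv_along k (deriv_along h \<eta>) x"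
    by simp
qed

text \<open>Each derivative flips the parity of the even kernel, so the adjoint carries a minus sign
  exactly at odd order.\<close>

lemma mollifier_conv_adjoint:
  assumes \<eta>: "mollifier \<delta> \<eta>" and f: "sq f" and g: "sq g"
  shows "ip f (conv \<eta> g) = ip (conv \<eta> f) g"
    "ip f (conv (deriv_along h \<eta>) g) = - ip (conv (deriv_along h \<eta>) f) g"
    "ip f (conv (deriv_along k (deriv_along h \<eta>)) g) = ip (conv (deriv_along k (deriv_along h \<eta>)) f) g"
proof -
  note b = mollifier_bump[OF \<eta>]
  note b1 = bump_deriv_along[OF b] and b2 = bump_deriv_along[OF bump_deriv_along[OF b]]
  show "ip f (conv \<eta> g) = ip (conv \<eta> f) g"
    "ip f (conv (deriv_along k (deriv_along h \<eta>)) g) = ip (conv (deriv_along k (deriv_along h \<eta>)) f) g"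
    using conv_adjoint[OF b f g] conv_adjoint[OF b2 f g, of k h] by (simp_all add: mollifier_even[OF \<eta>])
  show "ip f (conv (deriv_along h \<eta>) g) = - ip (conv (deriv_along h \<eta>) f) g"
    using conv_adjoint[OF b1 f g, of h]
    by (simp add: mollifier_even[OF \<eta>] conv_minus_kernel ip_minus_left ip_commute[of f])
qed

text \<open>The divergence of the convolution at x is minus the pairing of h with the gradient of y
  -> \<open>\<eta>\<close>(x - y). This test function inherits symmetric second derivatives from the
  mollifier, so weak divergence freeness is demanded only against such functions, exactly as the
  truncated fields provide it.\<close>

lemma conv_divergence_free:
  assumes \<eta>: "mollifier \<delta> \<eta>" and h: "\<And>i. sq (h i)"
    and weak: "\<And>\<phi>. bump \<phi> \<Longrightarrow> (\<And>i j. pd i (pd j \<phi>) = pd j (pd i \<phi>)) \<Longrightarrow> (\<Sum>i\<in>UNIV. ip (h i) (pd i \<phi>)) = 0"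
  shows "(\<Sum>i\<in>UNIV. pd i (conv \<eta> (h i)) x) = 0"
proof -
  note b = mollifier_bump[OF \<eta>]
  define \<phi> where "\<phi> y = \<eta> (x - y)" for y
  have s: "smooth \<eta>" by (rule bump_smooth[OF b])
  have p1: "pd i \<phi> = (\<lambda>y. - 1 * pd i \<eta> (x - y))" for i
    unfolding \<phi>_def[abs_def] using deriv_along_reflect[OF s] by simp
  have sm: "smooth (\<lambda>y. pd i \<eta> (x - y))" for i
    by (intro bump_smooth bump_reflect bump_deriv_along b)
  have "pd i (pd j \<phi>) = (\<lambda>y. pd i (pd j \<eta>) (x - y))" for i j
    unfolding p1 deriv_along_cmult[OF sm] deriv_along_reflect[OF smooth_deriv_along[OF s]] by simp
  then have "(\<Sum>i\<in>UNIV. ip (h i) (pd i \<phi>)) = 0"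
    using \<eta> b unfolding mollifier_def by (intro weak) (simp_all add: \<phi>_def[abs_def] bump_reflect)
  moreover have "pd i (conv \<eta> (h i)) x = - ip (h i) (pd i \<phi>)" for i
    by (simp add: deriv_along_conv[OF b h] conv_def ip_def p1 mult.commute)
  ultimately show ?thesis by (simp add: sum_negf)
qed

section \<open>The mollified equation\<close>

text \<open>\<open>\<Delta>u - div (u \<otimes> u)\<close> convolved with \<open>\<eta>\<close>, with all derivatives on the kernel.\<close>

definition ns_rhs :: "(real^3 \<Rightarrow> real) \<Rightarrow> (3 \<Rightarrow> real^3 \<Rightarrow> real) \<Rightarrow> 3 \<Rightarrow> real^3 \<Rightarrow> real" where
  "ns_rhs \<eta> u i x = (\<Sum>j\<in>UNIV. conv (pd j (pd j \<eta>)) (u i) x) - (\<Sum>j\<in>UNIV. conv (pd j \<eta>) (\<lambda>y. u i y * u j y) x)"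

lemma component_solutionD:
  assumes "component_solution T m U"
  shows "l2cont {0<..<T} (\<lambda>t. U t i)" "continuous_on {0<..<T} m"
    "t \<in> {0<..<T} \<Longrightarrow> 0 \<le> m t"
    "t \<in> {0<..<T} \<Longrightarrow> (\<Sum>i\<in>UNIV. (U t i x)\<^sup>2) \<le> (m t)\<^sup>2"
    "t \<in> {0<..<T} \<Longrightarrow> \<bar>U t i x\<bar> \<le> m t"
    "t \<in> {0<..<T} \<Longrightarrow> bump g \<Longrightarrow> (\<Sum>i\<in>UNIV. ip (U t i) (pd i g)) = 0"
    "t \<in> {0<..<T} \<Longrightarrow> sq (U t i)"
    "l2cont {0<..<T} (\<lambda>t x. U t i x * U t j x)"
proof -
  show *: "l2cont {0<..<T} (\<lambda>t. U t i)" "continuous_on {0<..<T} m" "t \<in> {0<..<T} \<Longrightarrow> 0 \<le> m t"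
    "t \<in> {0<..<T} \<Longrightarrow> (\<Sum>i\<in>UNIV. (U t i x)\<^sup>2) \<le> (m t)\<^sup>2"
    "t \<in> {0<..<T} \<Longrightarrow> bump g \<Longrightarrow> (\<Sum>i\<in>UNIV. ip (U t i) (pd i g)) = 0" for i t x
    using assms unfolding component_solution_def by blast+
  show b: "t \<in> {0<..<T} \<Longrightarrow> \<bar>U t i x\<bar> \<le> m t" for i t x
    by (rule component_le[of "\<lambda>i. U t i x"]) (use * in blast)+
  show "t \<in> {0<..<T} \<Longrightarrow> sq (U t i)" by (rule l2contD(1)[OF *(1)])
  show "l2cont {0<..<T} (\<lambda>t x. U t i x * U t j x)"
    by (rule l2cont_mult[OF *(1,1,2) b b *(2)])
qed

lemma l2cont_ns_rhs:
  assumes U: "component_solution T m U" and \<eta>: "mollifier \<delta> \<eta>"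
  shows "l2cont {0<..<T} (\<lambda>t. ns_rhs \<eta> (U t) i)"
  unfolding ns_rhs_def[abs_def]
  by (intro l2cont_diff l2cont_sum l2cont_conv bump_deriv_along mollifier_bump[OF \<eta>] component_solutionD[OF U])

text \<open>The desired test field \<open>\<eta>\<close> * \<open>\<eta>\<close> * h lacks compact
  support. Truncating g = \<open>\<eta>\<close> * h to f_n and testing with \<open>\<eta>\<close> *
  f_n is legitimate; the outer convolution and all derivatives then move to U. What is left pairs
  fixed L^2 functions with f_n, so the common majorant w allows n to tend to infinity, also under
  the time integral.\<close>

lemma mollified_evolution:
  assumes U: "component_solution T m U" and \<eta>: "mollifier \<delta> \<eta>" and h: "\<And>i. sq (h i)"
    and hdiv: "\<And>\<phi>. bump \<phi> \<Longrightarrow> (\<Sum>i\<in>UNIV. ip (h i) (pd i \<phi>)) = 0"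
    and t: "0 < t1" "t1 < t2" "t2 < T"
  shows "(\<Sum>i\<in>UNIV. ip (conv \<eta> (U t2 i)) (conv \<eta> (h i))) - (\<Sum>i\<in>UNIV. ip (conv \<eta> (U t1 i)) (conv \<eta> (h i))) =
    integral {t1..t2} (\<lambda>t. \<Sum>i\<in>UNIV. ip (ns_rhs \<eta> (U t) i) (conv \<eta> (h i)))"
proof -
  note b = mollifier_bump[OF \<eta>]
  define g where "g i = conv \<eta> (h i)" for i
  have gs: "smooth (g i)" "sq (g i)" for i
    unfolding g_def by (intro smooth_conv conv_sq b h)+
  have gdiv: "(\<Sum>i\<in>UNIV. pd i (g i) x) = 0" for x
    unfolding g_def by (rule conv_divergence_free[OF \<eta> h hdiv])
  obtain f :: "nat \<Rightarrow> 3 \<Rightarrow> real^3 \<Rightarrow> real" and w r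
    where w: "sq w" and fs: "\<And>n i. sq (f n i)" and fw: "\<And>n i x. \<bar>f n i x\<bar> \<le> w x"
    and lim: "\<And>i x. (\<lambda>n. f n i x) \<longlonglongrightarrow> g i x" and fr: "\<And>n i x. r n < norm x \<Longrightarrow> f n i x = 0"
    and fdiv: "\<And>n \<phi>. bump \<phi> \<Longrightarrow> (\<And>i j. pd i (pd j \<phi>) = pd j (pd i \<phi>)) \<Longrightarrow> (LINT x|lborel. (\<Sum>i\<in>UNIV. f n i x * pd i \<phi> x)) = 0"
  proof (rule divergence_free_approximation[OF gs gdiv])
    fix f w r
    assume "sq w" "\<And>n i. sq (f n i)" "\<And>n i x. \<bar>f n i x\<bar> \<le> w x" "\<And>i x. (\<lambda>n. f n i x) \<longlonglongrightarrow> g i x"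
      "\<And>n i x. r n < norm x \<Longrightarrow> f n i x = 0"
      "\<And>n \<phi>. bump \<phi> \<Longrightarrow> (\<And>i j. pd i (pd j \<phi>) = pd j (pd i \<phi>)) \<Longrightarrow> (LINT x|lborel. (\<Sum>i\<in>UNIV. f n i x * pd i \<phi> x)) = 0"
    then show thesis by (rule that[of w f r])
  qed
  define F where "F n i = conv \<eta> (f n i)" for n i
  have Fb: "bump (F n i)" for n i
    unfolding F_def by (rule bump_conv[OF b fs fr])
  have Fdiv: "(\<Sum>i\<in>UNIV. pd i (F n i) x) = 0" for n x
    unfolding F_def
  proof (rule conv_divergence_free[OF \<eta> fs])
    fix \<phi> :: "real^3 \<Rightarrow> real" assume \<phi>: "bump \<phi>" "\<And>i j. pd i (pd j \<phi>) = pd j (pd i \<phi>)"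
    show "(\<Sum>i\<in>UNIV. ip (f n i) (pd i \<phi>)) = 0"
      using fdiv[OF \<phi>, of n] sq_mult_integrable[OF fs bump_sq[OF bump_deriv_along[OF \<phi>(1)]]] by (simp add: ip_def)
  qed
  define q where "q n t = (\<Sum>i\<in>UNIV. ip (ns_rhs \<eta> (U t) i) (f n i))" for n t
  define Q where "Q t = (\<Sum>i\<in>UNIV. ip (ns_rhs \<eta> (U t) i) (g i))" for t
  have sub: "{t1..t2} \<subseteq> {0<..<T}" using t by auto
  have Us: "sq (U t i)" "sq (\<lambda>x. U t i x * U t j x)" if "t \<in> {0<..<T}" for t i j
    by (rule component_solutionD(7)[OF U that], rule l2contD(1)[OF component_solutionD(8)[OF U] that])
  have eq: "(\<Sum>i\<in>UNIV. ip (conv \<eta> (U t2 i)) (f n i)) - (\<Sum>i\<in>UNIV. ip (conv \<eta> (U t1 i)) (f n i)) = integral {t1..t2} (q n)" for n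
  proof -
    have "(\<Sum>i\<in>UNIV. ip (U t2 i) (F n i)) - (\<Sum>i\<in>UNIV. ip (U t1 i) (F n i)) =
        integral {t1..t2} (\<lambda>t. (\<Sum>i\<in>UNIV. \<Sum>j\<in>UNIV. ip (U t i) (pd j (pd j (F n i))))
          + (\<Sum>i\<in>UNIV. \<Sum>j\<in>UNIV. ip (\<lambda>x. U t i x * U t j x) (pd j (F n i))))"
      using U Fb Fdiv t unfolding component_solution_def by blast
    also have "\<dots> = integral {t1..t2} (q n)"
    proof (rule Henstock_Kurzweil_Integration.integral_cong)
      fix t assume "t \<in> {t1..t2}"
      then have t: "t \<in> {0<..<T}" using sub by blast
      have "ip (U t i) (pd j (pd j (F n i))) = ip (conv (pd j (pd j \<eta>)) (U t i)) (f n i)" for i j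
        unfolding F_def deriv_along_conv[OF b fs] deriv_along_conv[OF bump_deriv_along[OF b] fs]
        by (rule mollifier_conv_adjoint(3)[OF \<eta> Us(1)[OF t] fs])
      moreover have "ip (\<lambda>x. U t i x * U t j x) (pd j (F n i)) = - ip (conv (pd j \<eta>) (\<lambda>x. U t i x * U t j x)) (f n i)" for i j
        unfolding F_def deriv_along_conv[OF b fs]
        by (rule mollifier_conv_adjoint(2)[OF \<eta> Us(2)[OF t] fs])
      moreover have "ip (ns_rhs \<eta> (U t) i) (f n i) =
         (\<Sum>j\<in>UNIV. ip (conv (pd j (pd j \<eta>)) (U t i)) (f n i)) - (\<Sum>j\<in>UNIV. ip (conv (pd j \<eta>) (\<lambda>x. U t i x * U t j x)) (f n i))" for i
        unfolding ns_rhs_def[abs_def] using Us[OF t] fs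
        by (simp add: ip_diff_left ip_sum_left sq_sum conv_sq bump_deriv_along b)
      ultimately show "(\<Sum>i\<in>UNIV. \<Sum>j\<in>UNIV. ip (U t i) (pd j (pd j (F n i))))
          + (\<Sum>i\<in>UNIV. \<Sum>j\<in>UNIV. ip (\<lambda>x. U t i x * U t j x) (pd j (F n i))) = q n t"
        by (simp add: q_def sum_subtractf sum_negf)
    qed
    also have "(\<Sum>i\<in>UNIV. ip (U s i) (F n i)) = (\<Sum>i\<in>UNIV. ip (conv \<eta> (U s i)) (f n i))" if "s \<in> {0<..<T}" for s
      unfolding F_def using mollifier_conv_adjoint(1)[OF \<eta> Us(1)[OF that] fs] by simp
    ultimately show ?thesis using t by simp
  qed
  have ip_lim: "(\<lambda>n. ip a (f n i)) \<longlonglongrightarrow> ip a (g i)" if a: "sq a" for a i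
    unfolding ip_def
  proof (rule integral_dominated_convergence[where w = "\<lambda>x. \<bar>a x\<bar> * w x"])
    show "integrable lborel (\<lambda>x. \<bar>a x\<bar> * w x)" by (intro sq_mult_integrable sq_abs a w)
    show "AE x in lborel. (\<lambda>n. a x * f n i x) \<longlonglongrightarrow> a x * g i x"
      by (intro AE_I2 tendsto_mult tendsto_const lim)
    show "AE x in lborel. norm (a x * f n i x) \<le> \<bar>a x\<bar> * w x" for n
      using fw by (intro AE_I2) (simp add: abs_mult mult_left_mono)
    show "(\<lambda>x. a x * g i x) \<in> borel_measurable lborel" "(\<lambda>x. a x * f n i x) \<in> borel_measurable lborel" for n
      using sq_measurable[OF a] sq_measurable[OF gs(2)] sq_measurable[OF fs] by simp_all
  qed
  have Rs: "sq (ns_rhs \<eta> (U t) i)" if "t \<in> {0<..<T}" for t i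
    by (rule l2contD(1)[OF l2cont_ns_rhs[OF U \<eta>] that])
  have "(\<lambda>n. integral {t1..t2} (q n)) \<longlonglongrightarrow> integral {t1..t2} Q"
  proof (rule dominated_convergence(2)[where h = "\<lambda>t. \<Sum>i\<in>UNIV. nrm (ns_rhs \<eta> (U t) i) * nrm w"])
    show "q n integrable_on {t1..t2}" for n
      unfolding q_def[abs_def]
      by (intro integrable_continuous_interval continuous_on_subset[OF _ sub] continuous_on_sum l2cont_ip
          l2cont_ns_rhs[OF U \<eta>] l2cont_const fs)
    show "(\<lambda>t. \<Sum>i\<in>UNIV. nrm (ns_rhs \<eta> (U t) i) * nrm w) integrable_on {t1..t2}"
      by (intro integrable_continuous_interval continuous_on_subset[OF _ sub] continuous_on_sum continuous_on_mult
          continuous_on_const l2cont_nrm l2cont_ns_rhs[OF U \<eta>])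
    show "norm (q n t) \<le> (\<Sum>i\<in>UNIV. nrm (ns_rhs \<eta> (U t) i) * nrm w)" if "t \<in> {t1..t2}" for n t
      unfolding q_def real_norm_def
    proof (intro order_trans[OF sum_abs] sum_mono)
      fix i :: 3
      have t: "t \<in> {0<..<T}" using sub that by blast
      have "\<bar>ip (ns_rhs \<eta> (U t) i) (f n i)\<bar> \<le> nrm (ns_rhs \<eta> (U t) i) * nrm (f n i)"
        by (rule ip_Cauchy_Schwarz[OF Rs[OF t] fs])
      also have "\<dots> \<le> nrm (ns_rhs \<eta> (U t) i) * nrm w"
        using fw by (intro mult_left_mono nrm_mono[OF w sq_measurable[OF fs]]) (auto intro: order_trans[OF _ abs_ge_self])
      finally show "\<bar>ip (ns_rhs \<eta> (U t) i) (f n i)\<bar> \<le> nrm (ns_rhs \<eta> (U t) i) * nrm w" .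
    qed
    show "(\<lambda>n. q n t) \<longlonglongrightarrow> Q t" if "t \<in> {t1..t2}" for t
      unfolding q_def Q_def using sub that by (intro tendsto_sum ip_lim Rs) auto
  qed
  moreover have "(\<lambda>n. integral {t1..t2} (q n)) \<longlonglongrightarrow> (\<Sum>i\<in>UNIV. ip (conv \<eta> (U t2 i)) (g i)) - (\<Sum>i\<in>UNIV. ip (conv \<eta> (U t1 i)) (g i))"
    unfolding eq[symmetric] using t by (intro tendsto_diff tendsto_sum ip_lim conv_sq b Us(1)) auto
  ultimately show ?thesis
    unfolding g_def Q_def[abs_def] using LIMSEQ_unique by blast
qed

section \<open>Differentiating the mollified energy\<close>

text \<open>A fundamental theorem in which the integrand depends on the end points as well, as it
  must when the test field is built from both end times. It suffices that the integrand tends to l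
  when a, b and t approach x together.\<close>

lemma has_derivative_from_integrals:
  fixes E r :: "real \<Rightarrow> real" and R :: "real \<Rightarrow> real \<Rightarrow> real \<Rightarrow> real"
  assumes I: "open I" "is_interval I" "x \<in> I"
    and E: "\<And>a b. a \<in> I \<Longrightarrow> b \<in> I \<Longrightarrow> a < b \<Longrightarrow> E b - E a = integral {a..b} (R a b)"
    and c: "\<And>a b. a \<in> I \<Longrightarrow> b \<in> I \<Longrightarrow> continuous_on I (R a b)"
    and near: "\<And>e. 0 < e \<Longrightarrow> \<exists>d>0. \<forall>a b t. a \<in> I \<longrightarrow> b \<in> I \<longrightarrow> t \<in> {a..b} \<longrightarrow> \<bar>a - x\<bar> < d \<longrightarrow> \<bar>b - x\<bar> < d \<longrightarrow> \<bar>R a b t - l\<bar> \<le> e"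
  shows "(E has_real_derivative l) (at x)"
proof -
  have "\<exists>d>0. \<forall>h. h \<noteq> 0 \<and> \<bar>h\<bar> < d \<longrightarrow> \<bar>(E (x + h) - E x) / h - l\<bar> \<le> e" if e: "0 < e" for e
  proof -
    obtain d1 where d1: "d1 > 0" "\<And>a b t. a \<in> I \<Longrightarrow> b \<in> I \<Longrightarrow> t \<in> {a..b} \<Longrightarrow> \<bar>a - x\<bar> < d1 \<Longrightarrow> \<bar>b - x\<bar> < d1 \<Longrightarrow> \<bar>R a b t - l\<bar> \<le> e"
      using near[OF e] by blast
    obtain d2 where d2: "d2 > 0" "ball x d2 \<subseteq> I"
      by (rule openE[OF I(1,3)])
    have main: "\<bar>E b - E a - l * (b - a)\<bar> \<le> e * (b - a)" if ab: "a \<in> I" "b \<in> I" "a < b" "\<bar>a - x\<bar> < d1" "\<bar>b - x\<bar> < d1" for a b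
    proof -
      have sub: "{a..b} \<subseteq> I"
        using mem_is_interval_1_I[OF I(2) ab(1,2)] by auto
      have i: "(R a b has_integral (E b - E a)) {a..b}"
        using integrable_integral[OF integrable_continuous_interval[OF continuous_on_subset[OF c[OF ab(1,2)] sub]]] E[OF ab(1-3)] by simp
      have "((\<lambda>t. R a b t - l) has_integral (E b - E a) - l * (b - a)) {a..b}"
        using has_integral_diff[OF i has_integral_const_real[of l a b]] ab by (simp add: mult.commute)
      from has_integral_bound_real[of e, OF _ finite.emptyI this] show ?thesis
        using d1(2)[OF ab(1,2) _ ab(4,5)] e ab by simp
    qed
    have "\<bar>(E (x + h) - E x) / h - l\<bar> \<le> e" if h: "h \<noteq> 0" "\<bar>h\<bar> < min d1 d2" for h
    proof -
      have xh: "x + h \<in> I" using d2 h by (auto simp: dist_real_def)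
      have "\<bar>E (x + h) - E x - l * h\<bar> \<le> e * \<bar>h\<bar>"
      proof (cases "0 < h")
        case True
        then show ?thesis using main[OF I(3) xh] h d1 by simp
      next
        case False
        then have "\<bar>E x - E (x + h) - l * (- h)\<bar> \<le> e * (- h)" using main[OF xh I(3)] h d1 by simp
        then show ?thesis using False by (simp add: abs_minus_commute algebra_simps abs_if split: if_splits)
      qed
      moreover have "(E (x + h) - E x) / h - l = (E (x + h) - E x - l * h) / h"
        using h by (simp add: field_simps)
      ultimately show ?thesis using h by (simp add: abs_divide field_simps)
    qed
    then show ?thesis using d1(1) d2(1) by (intro exI[of _ "min d1 d2"]) auto
  qed note key = this
  have "(\<lambda>h. (E (x + h) - E x) / h) \<midarrow>0\<rightarrow> l"
    unfolding LIM_eq real_norm_def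
  proof (intro allI impI)
    fix e :: real assume "0 < e"
    then obtain d where "d > 0" "\<forall>h. h \<noteq> 0 \<and> \<bar>h\<bar> < d \<longrightarrow> \<bar>(E (x + h) - E x) / h - l\<bar> \<le> e / 2"
      using key[of "e / 2"] by auto
    then show "\<exists>s>0. \<forall>h. h \<noteq> 0 \<and> \<bar>h - 0\<bar> < s \<longrightarrow> \<bar>(E (x + h) - E x) / h - l\<bar> < e"
      using \<open>0 < e\<close> by (intro exI[of _ d]) force
  qed
  then show ?thesis by (simp add: DERIV_def)
qed

text \<open>Only a field frozen in time can be tested, so W(a) + W(c) is used for the increment of
  the energy from a to c. As a and c tend to x this field tends to 2 W(x), which is the origin of
  the factor 2.\<close>

lemma mollified_energy_derivative:
  assumes U: "component_solution T m U" and V: "component_solution T m' V" and \<eta>: "mollifier \<delta> \<eta>"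
    and x: "x \<in> {0<..<T}"
  defines "W \<equiv> \<lambda>t i. conv \<eta> (\<lambda>x. U t i x - V t i x)"
    and "\<Psi> \<equiv> \<lambda>t i x. ns_rhs \<eta> (U t) i x - ns_rhs \<eta> (V t) i x"
  shows "((\<lambda>t. \<Sum>i\<in>UNIV. ip (W t i) (W t i)) has_real_derivative 2 * (\<Sum>i\<in>UNIV. ip (\<Psi> x i) (W x i))) (at x)"
proof -
  define I where "I = {0<..<T}"
  note b = mollifier_bump[OF \<eta>]
  note LU = component_solutionD(1)[OF U, folded I_def] and LV = component_solutionD(1)[OF V, folded I_def]
  note Us = component_solutionD(7)[OF U, folded I_def] and Vs = component_solutionD(7)[OF V, folded I_def]
  have LW: "l2cont I (\<lambda>t. W t i)" for i
    unfolding W_def by (intro l2cont_conv b l2cont_diff LU LV)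
  have L\<Psi>: "l2cont I (\<lambda>t. \<Psi> t i)" for i
    unfolding \<Psi>_def using l2cont_ns_rhs[OF U \<eta>] l2cont_ns_rhs[OF V \<eta>] by (intro l2cont_diff) (auto simp: I_def)
  note Ws = l2contD(1)[OF LW] and \<Psi>s = l2contD(1)[OF L\<Psi>]
  have Weq: "W t i = (\<lambda>x. conv \<eta> (U t i) x - conv \<eta> (V t i) x)" if "t \<in> I" for t i
    unfolding W_def by (rule conv_diff[OF b Us[OF that] Vs[OF that]])
  define E where "E t = (\<Sum>i\<in>UNIV. ip (W t i) (W t i))" for t
  define R where "R a c t = (\<Sum>i\<in>UNIV. ip (\<Psi> t i) (\<lambda>y. W a i y + W c i y))" for a c t
  have "(E has_real_derivative 2 * (\<Sum>i\<in>UNIV. ip (\<Psi> x i) (W x i))) (at x)"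
  proof (rule has_derivative_from_integrals[where I = I and R = R])
    show "open I" "is_interval I" "x \<in> I" using x by (auto simp: I_def is_interval_1)
    show "continuous_on I (R a c)" if "a \<in> I" "c \<in> I" for a c
      unfolding R_def[abs_def] by (intro continuous_on_sum l2cont_ip L\<Psi> l2cont_const sq_add Ws that)
    show "E c - E a = integral {a..c} (R a c)" if a: "a \<in> I" and c: "c \<in> I" and ac: "a < c" for a c
    proof -
      define h where "h i y = (U a i y - V a i y) + (U c i y - V c i y)" for i y
      have d: "sq (\<lambda>y. U a i y - V a i y)" "sq (\<lambda>y. U c i y - V c i y)" for i
        by (intro sq_diff Us Vs a c)+
      have hs: "sq (h i)" for i
        unfolding h_def[abs_def] by (intro sq_add d)
      have hW: "conv \<eta> (h i) = (\<lambda>y. W a i y + W c i y)" for i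
        unfolding h_def[abs_def] W_def by (rule conv_add[OF b d])
      have hdiv: "(\<Sum>i\<in>UNIV. ip (h i) (pd i \<phi>)) = 0" if \<phi>: "bump \<phi>" for \<phi>
      proof -
        have "ip (h i) (pd i \<phi>) = (ip (U a i) (pd i \<phi>) - ip (V a i) (pd i \<phi>)) + (ip (U c i) (pd i \<phi>) - ip (V c i) (pd i \<phi>))" for i
          unfolding h_def[abs_def] using Us Vs a c d bump_sq[OF bump_deriv_along[OF \<phi>]] by (simp add: ip_add_left ip_diff_left)
        then show ?thesis
          using component_solutionD(6)[OF U _ \<phi>] component_solutionD(6)[OF V _ \<phi>] a c
          by (simp add: sum.distrib sum_subtractf I_def)
      qed
      have ac': "0 < a" "a < c" "c < T" using a c ac by (auto simp: I_def)
      have ev: "(\<Sum>i\<in>UNIV. ip (conv \<eta> (X c i)) (conv \<eta> (h i))) - (\<Sum>i\<in>UNIV. ip (conv \<eta> (X a i)) (conv \<eta> (h i))) =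
        integral {a..c} (\<lambda>t. \<Sum>i\<in>UNIV. ip (ns_rhs \<eta> (X t) i) (conv \<eta> (h i)))"
        if "component_solution T k X" for k X
        by (rule mollified_evolution[OF that \<eta> hs _ ac']) (rule hdiv)
      have sub: "{a..c} \<subseteq> {0<..<T}" using ac' by auto
      have hc: "sq (conv \<eta> (h i))" for i by (rule conv_sq[OF b hs])
      have int: "(\<lambda>t. \<Sum>i\<in>UNIV. ip (ns_rhs \<eta> (U t) i) (conv \<eta> (h i))) integrable_on {a..c}"
        "(\<lambda>t. \<Sum>i\<in>UNIV. ip (ns_rhs \<eta> (V t) i) (conv \<eta> (h i))) integrable_on {a..c}"
        by (intro integrable_continuous_interval continuous_on_subset[OF _ sub] continuous_on_sum l2cont_ip
            l2cont_ns_rhs[OF U \<eta>] l2cont_ns_rhs[OF V \<eta>] l2cont_const hc)+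
      have "E c - E a = (\<Sum>i\<in>UNIV. ip (W c i) (\<lambda>y. W a i y + W c i y)) - (\<Sum>i\<in>UNIV. ip (W a i) (\<lambda>y. W a i y + W c i y))"
        unfolding E_def using Ws[OF a] Ws[OF c]
        by (simp add: ip_add_right sum.distrib ip_commute[of "W c _" "W a _"])
      also have "\<dots> = ((\<Sum>i\<in>UNIV. ip (conv \<eta> (U c i)) (conv \<eta> (h i))) - (\<Sum>i\<in>UNIV. ip (conv \<eta> (U a i)) (conv \<eta> (h i))))
         - ((\<Sum>i\<in>UNIV. ip (conv \<eta> (V c i)) (conv \<eta> (h i))) - (\<Sum>i\<in>UNIV. ip (conv \<eta> (V a i)) (conv \<eta> (h i))))"
      proof -
        have "ip (W s i) (conv \<eta> (h i)) = ip (conv \<eta> (U s i)) (conv \<eta> (h i)) - ip (conv \<eta> (V s i)) (conv \<eta> (h i))"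
          if "s \<in> I" for s i
          unfolding Weq[OF that] by (rule ip_diff_left[OF conv_sq[OF b Us[OF that]] conv_sq[OF b Vs[OF that]] hc])
        then show ?thesis
          unfolding hW[symmetric] using a c by (simp add: sum_subtractf)
      qed
      also have "\<dots> = integral {a..c} (\<lambda>t. (\<Sum>i\<in>UNIV. ip (ns_rhs \<eta> (U t) i) (conv \<eta> (h i))) - (\<Sum>i\<in>UNIV. ip (ns_rhs \<eta> (V t) i) (conv \<eta> (h i))))"
        unfolding ev[OF U] ev[OF V] by (rule Henstock_Kurzweil_Integration.integral_diff[OF int, symmetric])
      also have "\<dots> = integral {a..c} (R a c)"
      proof (rule Henstock_Kurzweil_Integration.integral_cong)
        fix t assume "t \<in> {a..c}"
        then have t: "t \<in> {0<..<T}" using sub by blast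
        show "(\<Sum>i\<in>UNIV. ip (ns_rhs \<eta> (U t) i) (conv \<eta> (h i))) - (\<Sum>i\<in>UNIV. ip (ns_rhs \<eta> (V t) i) (conv \<eta> (h i))) = R a c t"
          unfolding R_def hW[symmetric] \<Psi>_def
          using l2contD(1)[OF l2cont_ns_rhs[OF U \<eta>] t] l2contD(1)[OF l2cont_ns_rhs[OF V \<eta>] t] hc
          by (simp add: ip_diff_left sum_subtractf)
      qed
      finally show ?thesis .
    qed
    fix e :: real assume e: "0 < e"
    have xI: "x \<in> I" using x by (simp add: I_def)
    \<comment> \<open>Each summand is the coefficient of \<open>e1\<close> in the error for one
      component. Its term 2 comes from \<open>e1\<close> <= 1, by which the norm of W near x exceeds
      its value at x by at most 1.\<close>
    define C where "C = (\<Sum>i\<in>UNIV. 2 * nrm (W x i) + 2 + 2 * nrm (\<Psi> x i))"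
    have C0: "0 < C" unfolding C_def
    proof (intro sum_pos)
      fix i
      show "0 < 2 * nrm (W x i) + 2 + 2 * nrm (\<Psi> x i)"
        using nrm_nonneg[of "W x i"] nrm_nonneg[of "\<Psi> x i"] by linarith
    qed auto
    define e1 where "e1 = min 1 (e / C)"
    have e1: "0 < e1" "e1 \<le> 1" "e1 * C \<le> e" using e C0 by (auto simp: e1_def min_def field_simps)
    have "\<forall>\<^sub>F s in at x within I. \<forall>i\<in>UNIV. nrm (\<lambda>y. W s i y - W x i y) < e1 \<and> nrm (\<lambda>y. \<Psi> s i y - \<Psi> x i y) < e1"
      by (rule eventually_ball_finite_distrib[OF finite, THEN iffD2], rule ballI,
          rule eventually_conj[OF order_tendstoD(2)[OF l2contD(2)[OF LW xI] e1(1)] order_tendstoD(2)[OF l2contD(2)[OF L\<Psi> xI] e1(1)]])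
    then obtain d where d: "d > 0" "\<And>s i. s \<in> I \<Longrightarrow> s \<noteq> x \<Longrightarrow> \<bar>s - x\<bar> < d \<Longrightarrow> nrm (\<lambda>y. W s i y - W x i y) < e1 \<and> nrm (\<lambda>y. \<Psi> s i y - \<Psi> x i y) < e1"
      unfolding eventually_at dist_real_def by blast
    have d': "nrm (\<lambda>y. W s i y - W x i y) \<le> e1" "nrm (\<lambda>y. \<Psi> s i y - \<Psi> x i y) \<le> e1" if "s \<in> I" "\<bar>s - x\<bar> < d" for s i
      using d(2)[of s i] that e1(1) by (cases "s = x"; force)+
    have "\<bar>R a c t - 2 * (\<Sum>i\<in>UNIV. ip (\<Psi> x i) (W x i))\<bar> \<le> e"
      if a: "a \<in> I" "\<bar>a - x\<bar> < d" and c: "c \<in> I" "\<bar>c - x\<bar> < d" and t: "t \<in> {a..c}" for a c t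
    proof -
      have tI: "t \<in> I" "\<bar>t - x\<bar> < d" using a c t by (auto simp: I_def)
      have "\<bar>ip (\<Psi> t i) (\<lambda>y. W a i y + W c i y) - 2 * ip (\<Psi> x i) (W x i)\<bar> \<le> e1 * (2 * nrm (W x i) + 2 + 2 * nrm (\<Psi> x i))" for i
      proof -
        note s = Ws[OF a(1), of i] Ws[OF c(1), of i] Ws[OF xI, of i] \<Psi>s[OF tI(1), of i] \<Psi>s[OF xI, of i]
        have s': "sq (\<lambda>y. W a i y + W c i y)" "sq (\<lambda>y. W a i y - W x i y)" "sq (\<lambda>y. W c i y - W x i y)" "sq (\<lambda>y. \<Psi> t i y - \<Psi> x i y)"
          by (intro sq_add sq_diff s)+
        have eq: "ip (\<Psi> t i) (\<lambda>y. W a i y + W c i y) - 2 * ip (\<Psi> x i) (W x i) =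
          ip (\<lambda>y. \<Psi> t i y - \<Psi> x i y) (\<lambda>y. W a i y + W c i y) + ip (\<Psi> x i) (\<lambda>y. W a i y - W x i y) + ip (\<Psi> x i) (\<lambda>y. W c i y - W x i y)"
          using s s' by (simp add: ip_add_right ip_diff_right ip_diff_left)
        have "\<bar>ip (\<lambda>y. \<Psi> t i y - \<Psi> x i y) (\<lambda>y. W a i y + W c i y) + ip (\<Psi> x i) (\<lambda>y. W a i y - W x i y) + ip (\<Psi> x i) (\<lambda>y. W c i y - W x i y)\<bar>
           \<le> nrm (\<lambda>y. \<Psi> t i y - \<Psi> x i y) * nrm (\<lambda>y. W a i y + W c i y)
            + nrm (\<Psi> x i) * nrm (\<lambda>y. W a i y - W x i y) + nrm (\<Psi> x i) * nrm (\<lambda>y. W c i y - W x i y)"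
          by (intro order_trans[OF abs_triangle_ineq] add_mono ip_Cauchy_Schwarz s s')
        also have "\<dots> \<le> e1 * (2 * nrm (W x i) + 2) + nrm (\<Psi> x i) * e1 + nrm (\<Psi> x i) * e1"
        proof -
          have "nrm (\<lambda>y. W s i y) \<le> nrm (W x i) + 1" if "s \<in> I" "\<bar>s - x\<bar> < d" for s
            using nrm_triangle[OF sq_diff[OF Ws[OF that(1), of i] s(3)] s(3)] d'(1)[OF that, of i] e1(2) by simp
          from this[OF a] this[OF c] have "nrm (\<lambda>y. W a i y + W c i y) \<le> 2 * nrm (W x i) + 2"
            using nrm_triangle[OF s(1,2)] by simp
          then have "nrm (\<lambda>y. \<Psi> t i y - \<Psi> x i y) * nrm (\<lambda>y. W a i y + W c i y) \<le> e1 * (2 * nrm (W x i) + 2)"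
            using d'(2)[OF tI, of i] e1(1) by (intro mult_mono) auto
          then show ?thesis
            using mult_left_mono[OF d'(1)[OF a, of i] nrm_nonneg[of "\<Psi> x i"]]
              mult_left_mono[OF d'(1)[OF c, of i] nrm_nonneg[of "\<Psi> x i"]] by linarith
        qed
        also have "\<dots> = e1 * (2 * nrm (W x i) + 2 + 2 * nrm (\<Psi> x i))" by (simp add: algebra_simps)
        finally show ?thesis unfolding eq .
      qed
      then have "(\<Sum>i\<in>UNIV. \<bar>ip (\<Psi> t i) (\<lambda>y. W a i y + W c i y) - 2 * ip (\<Psi> x i) (W x i)\<bar>) \<le> e1 * C"
        unfolding C_def sum_distrib_left by (intro sum_mono) auto
      moreover have "R a c t - 2 * (\<Sum>i\<in>UNIV. ip (\<Psi> x i) (W x i)) = (\<Sum>i\<in>UNIV. ip (\<Psi> t i) (\<lambda>y. W a i y + W c i y) - 2 * ip (\<Psi> x i) (W x i))"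
        by (simp add: R_def sum_subtractf sum_distrib_left)
      ultimately show ?thesis using e1(3) sum_abs[of "\<lambda>i. ip (\<Psi> t i) (\<lambda>y. W a i y + W c i y) - 2 * ip (\<Psi> x i) (W x i)" UNIV] by linarith
    qed
    then show "\<exists>d>0. \<forall>a c t. a \<in> I \<longrightarrow> c \<in> I \<longrightarrow> t \<in> {a..c} \<longrightarrow> \<bar>a - x\<bar> < d \<longrightarrow> \<bar>c - x\<bar> < d \<longrightarrow>
        \<bar>R a c t - 2 * (\<Sum>i\<in>UNIV. ip (\<Psi> x i) (W x i))\<bar> \<le> e"
      using d(1) by blast
  qed
  then show ?thesis by (simp add: E_def[abs_def])
qed

section \<open>The energy estimate\<close>

text \<open>Twice the sum is the pairing of v with the gradient of q = |W|^2. As q is not compactly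
  supported, divergence freeness is applied to \<open>\<psi>\<close>_n q. The term with the gradient
  of the cutoff disappears by dominated convergence, since v is bounded and v q therefore
  integrable.\<close>

lemma transport_energy_zero:
  fixes v W :: "3 \<Rightarrow> real^3 \<Rightarrow> real"
  assumes v: "\<And>i. sq (v i)" "\<And>i x. \<bar>v i x\<bar> \<le> M"
    and div: "\<And>g. bump g \<Longrightarrow> (\<Sum>i\<in>UNIV. ip (v i) (pd i g)) = 0"
    and W: "\<And>i. smooth (W i)" "\<And>i. sq (W i)" "\<And>i j. sq (pd j (W i))"
  shows "(\<Sum>i\<in>UNIV. \<Sum>j\<in>UNIV. ip (\<lambda>x. v j x * W i x) (pd j (W i))) = 0"
proof -
  obtain \<psi> :: "nat \<Rightarrow> real^3 \<Rightarrow> real" and L where L: "0 < L" and \<psi>: "\<And>n. bump (\<psi> n)" "\<And>n x. \<bar>\<psi> n x\<bar> \<le> 1"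
    and \<psi>d: "\<And>n h x. \<bar>deriv_along h (\<psi> n) x\<bar> \<le> L / real (Suc n) * norm h"
    and \<psi>_lim: "\<And>x. (\<lambda>n. \<psi> n x) \<longlonglongrightarrow> 1" "\<And>h x. (\<lambda>n. deriv_along h (\<psi> n) x) \<longlonglongrightarrow> 0"
    by (rule cutoff_sequence) blast
  have \<psi>': "\<bar>pd j (\<psi> n) x\<bar> \<le> L" for n j x
  proof -
    have "L / real (Suc n) \<le> L / 1" using L by (intro divide_left_mono) auto
    then show ?thesis using \<psi>d[where h = "axis j 1", of n x] by simp
  qed
  define q where "q x = (\<Sum>i\<in>UNIV. W i x * W i x)" for x
  define q' where "q' j x = (\<Sum>i\<in>UNIV. 2 * (W i x * pd j (W i) x))" for j x
  have qs: "smooth q" unfolding q_def[abs_def] by (intro smooth_sum smooth_mult W)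
  have qd: "pd j q = q' j" for j
  proof
    fix x
    have "((\<lambda>x. \<Sum>i\<in>UNIV. W i x * W i x) has_derivative (\<lambda>h. \<Sum>i\<in>UNIV. W i x * deriv_along h (W i) x + deriv_along h (W i) x * W i x)) (at x)"
      by (intro has_derivative_sum has_derivative_mult smooth_has_derivative W)
    from deriv_along_eq[OF this] show "pd j q x = q' j x"
      by (simp add: q_def[abs_def] q'_def mult.commute)
  qed
  note vm = sq_measurable[OF v(1)]
  have vW: "sq (\<lambda>x. v j x * W i x)" for i j
    by (rule sq_bounded_mult[OF W(2) vm v(2)])
  have i1: "integrable lborel (\<lambda>x. (v j x * W i x) * pd j (W i) x)" for i j
    by (rule sq_mult_integrable[OF vW W(3)])
  have vq': "v j x * q' j x = (\<Sum>i\<in>UNIV. 2 * ((v j x * W i x) * pd j (W i) x))" for j x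
    by (simp add: q'_def sum_distrib_left mult_ac)
  have i2: "integrable lborel (\<lambda>x. v j x * q' j x)" for j
    unfolding vq' by (intro Bochner_Integration.integrable_sum integrable_mult_right i1)
  have vq: "v j x * q x = (\<Sum>i\<in>UNIV. (v j x * W i x) * W i x)" for j x
    by (simp add: q_def sum_distrib_left mult_ac)
  have i3: "integrable lborel (\<lambda>x. v j x * q x)" for j
    unfolding vq by (intro Bochner_Integration.integrable_sum sq_mult_integrable vW W)
  have qm: "q \<in> borel_measurable borel" "q' j \<in> borel_measurable borel" for j
    unfolding qd[symmetric] by (intro borel_measurable_continuous_onI smooth_continuous qs smooth_deriv_along)+
  have \<psi>m: "\<psi> n \<in> borel_measurable borel" "pd j (\<psi> n) \<in> borel_measurable borel" for n j
    by (intro bump_measurable bump_deriv_along \<psi>(1))+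
  have lim: "(\<lambda>n. LINT x|lborel. v j x * (\<psi> n x * q' j x + pd j (\<psi> n) x * q x)) \<longlonglongrightarrow> (LINT x|lborel. v j x * (1 * q' j x + 0 * q x))" for j
  proof (rule integral_dominated_convergence[where w = "\<lambda>x. \<bar>v j x * q' j x\<bar> + L * \<bar>v j x * q x\<bar>"])
    show "integrable lborel (\<lambda>x. \<bar>v j x * q' j x\<bar> + L * \<bar>v j x * q x\<bar>)"
      by (intro Bochner_Integration.integrable_add integrable_abs integrable_mult_right i2 i3)
    show "AE x in lborel. (\<lambda>n. v j x * (\<psi> n x * q' j x + pd j (\<psi> n) x * q x)) \<longlonglongrightarrow> v j x * (1 * q' j x + 0 * q x)"
      by (intro AE_I2 tendsto_intros \<psi>_lim)
    show "AE x in lborel. norm (v j x * (\<psi> n x * q' j x + pd j (\<psi> n) x * q x)) \<le> \<bar>v j x * q' j x\<bar> + L * \<bar>v j x * q x\<bar>" for n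
    proof (rule AE_I2)
      fix x
      have "v j x * (\<psi> n x * q' j x + pd j (\<psi> n) x * q x) = \<psi> n x * (v j x * q' j x) + pd j (\<psi> n) x * (v j x * q x)"
        by (simp add: algebra_simps)
      then have "norm (v j x * (\<psi> n x * q' j x + pd j (\<psi> n) x * q x)) \<le> \<bar>\<psi> n x\<bar> * \<bar>v j x * q' j x\<bar> + \<bar>pd j (\<psi> n) x\<bar> * \<bar>v j x * q x\<bar>"
        using abs_triangle_ineq[of "\<psi> n x * (v j x * q' j x)" "pd j (\<psi> n) x * (v j x * q x)"] by (simp add: abs_mult)
      also have "\<dots> \<le> 1 * \<bar>v j x * q' j x\<bar> + L * \<bar>v j x * q x\<bar>"
        by (rule add_mono[OF mult_right_mono[OF \<psi>(2)] mult_right_mono[OF \<psi>']]) auto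
      finally show "norm (v j x * (\<psi> n x * q' j x + pd j (\<psi> n) x * q x)) \<le> \<bar>v j x * q' j x\<bar> + L * \<bar>v j x * q x\<bar>" by simp
    qed
  qed (use vm qm \<psi>m in simp_all)
  have zero: "(\<Sum>j\<in>UNIV. LINT x|lborel. v j x * (\<psi> n x * q' j x + pd j (\<psi> n) x * q x)) = 0" for n
  proof -
    have "bump (\<lambda>x. \<psi> n x * q x)" by (rule bump_mult_smooth[OF \<psi>(1) qs])
    from div[OF this] show ?thesis
      by (simp add: ip_def smooth_deriv_along_mult[OF bump_smooth[OF \<psi>(1)] qs] qd)
  qed
  have "(\<lambda>n. \<Sum>j\<in>UNIV. LINT x|lborel. v j x * (\<psi> n x * q' j x + pd j (\<psi> n) x * q x)) \<longlonglongrightarrow> (\<Sum>j\<in>UNIV. LINT x|lborel. v j x * (1 * q' j x + 0 * q x))"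
    by (intro tendsto_sum lim)
  then have "(\<Sum>j\<in>UNIV. LINT x|lborel. v j x * q' j x) = 0"
    unfolding zero by (simp add: LIMSEQ_const_iff)
  also have "(\<Sum>j\<in>UNIV. LINT x|lborel. v j x * q' j x) = 2 * (\<Sum>j\<in>UNIV. \<Sum>i\<in>UNIV. ip (\<lambda>x. v j x * W i x) (pd j (W i)))"
    unfolding vq' ip_def using i1 by (simp add: sum_distrib_left)
  finally show ?thesis by (subst sum.swap) simp
qed

text \<open>Expand the square of d - c/2. The coefficient 1/4 is half of the constant in the
  theorem; the factor 2 of the energy derivative supplies the rest.\<close>

lemma ip_completed_square:
  assumes d: "sq d" and c: "sq c"
  shows "- ip d d + ip c d \<le> 1/4 * ip c c"
proof -
  define h where "h x = 1/2 * c x" for x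
  have h: "sq h" unfolding h_def[abs_def] by (rule sq_cmult[OF c])
  have hi: "ip h f = 1/2 * ip c f" for f
    unfolding h_def[abs_def] by (rule ip_cmult_left)
  have "0 \<le> ip (\<lambda>x. d x - h x) (\<lambda>x. d x - h x)" by simp
  also have "\<dots> = ip d d - 2 * ip h d + ip h h"
    using d h sq_diff[OF d h] by (simp add: ip_diff_left ip_diff_right ip_commute[of d h])
  also have "ip h h = 1/4 * ip c c"
    using hi[of h] hi[of c] by (simp add: ip_commute[of c h])
  finally show ?thesis using hi[of d] by simp
qed

text \<open>The mollification of \<open>u\<^sub>i u\<^sub>j - v\<^sub>i v\<^sub>j = u\<^sub>i w\<^sub>j + w\<^sub>i v\<^sub>j\<close>, where \<open>w = u - v\<close>, without the part
  \<open>v\<^sub>j (\<eta> * w\<^sub>i)\<close> that does not contribute to the energy. It tends to \<open>u\<^sub>i w\<^sub>j\<close> in \<open>L\<^sup>2\<close>.\<close>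

definition flux :: "(real^3 \<Rightarrow> real) \<Rightarrow> (3 \<Rightarrow> real^3 \<Rightarrow> real) \<Rightarrow> (3 \<Rightarrow> real^3 \<Rightarrow> real) \<Rightarrow> 3 \<Rightarrow> 3 \<Rightarrow> real^3 \<Rightarrow> real" where
  "flux \<eta> u v i j x = conv \<eta> (\<lambda>y. u i y * (u j y - v j y)) x +
     (conv \<eta> (\<lambda>y. (u i y - v i y) * v j y) x - v j x * conv \<eta> (\<lambda>y. u i y - v i y) x)"

text \<open>Integration by parts moves one derivative from the kernel to the mollified difference:
  viscosity yields minus the squared norm of D, convection the pairing of \<open>\<eta>\<close> * a
  with D. The transport part vanishes and the flux is absorbed entry by entry. The bound contains no
  derivative of the kernel, hence survives as the radius tends to 0.\<close>

lemma energy_estimate: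
  fixes u v :: "3 \<Rightarrow> real^3 \<Rightarrow> real"
  assumes \<eta>: "mollifier \<delta> \<eta>"
    and u: "\<And>i. sq (u i)" "\<And>i x. \<bar>u i x\<bar> \<le> M" and v: "\<And>i. sq (v i)" "\<And>i x. \<bar>v i x\<bar> \<le> M'"
    and div: "\<And>g. bump g \<Longrightarrow> (\<Sum>i\<in>UNIV. ip (v i) (pd i g)) = 0"
  shows "(\<Sum>i\<in>UNIV. ip (\<lambda>x. ns_rhs \<eta> u i x - ns_rhs \<eta> v i x) (conv \<eta> (\<lambda>x. u i x - v i x)))
    \<le> 1/4 * (\<Sum>i\<in>UNIV. \<Sum>j\<in>UNIV. ip (flux \<eta> u v i j) (flux \<eta> u v i j))"
proof -
  note b = mollifier_bump[OF \<eta>]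
  note b1 = bump_deriv_along[OF b]
  note b2 = bump_deriv_along[OF b1]
  define w where "w i x = u i x - v i x" for i x
  define W where "W i = conv \<eta> (w i)" for i
  define D where "D i j = conv (pd j \<eta>) (w i)" for i j
  define a where "a i j x = u i x * u j x - v i x * v j x" for i j x
  define c where "c = flux \<eta> u v"
  have ws: "sq (w i)" for i unfolding w_def[abs_def] by (intro sq_diff u v)
  note um = sq_measurable[OF u(1)] and vm = sq_measurable[OF v(1)]
  have p: "sq (\<lambda>x. u i x * u j x)" "sq (\<lambda>x. v i x * v j x)" "sq (\<lambda>x. u i x * w j x)" "sq (\<lambda>x. v j x * w i x)" "sq (\<lambda>x. w i x * v j x)" for i j
    using sq_bounded_mult[OF u(1) um u(2)] sq_bounded_mult[OF v(1) vm v(2)] sq_bounded_mult[OF ws um u(2)] sq_bounded_mult[OF ws vm v(2)]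
    by (simp_all add: mult.commute)
  have as: "sq (a i j)" for i j unfolding a_def[abs_def] by (intro sq_diff p)
  have Ws: "sq (W i)" "smooth (W i)" and Ds: "sq (D i j)" and dW: "pd j (W i) = D i j" for i j
    unfolding W_def D_def by (intro conv_sq smooth_conv b b1 ws deriv_along_conv)+
  have vW: "sq (\<lambda>x. v j x * W i x)" for i j by (rule sq_bounded_mult[OF Ws(1) vm v(2)])
  have c_eq: "c i j x = conv \<eta> (\<lambda>y. u i y * w j y) x + (conv \<eta> (\<lambda>y. w i y * v j y) x - v j x * W i x)" for i j x
    by (simp add: c_def flux_def w_def[abs_def] W_def)
  have cs: "sq (c i j)" for i j
    unfolding c_eq[abs_def] by (intro sq_add sq_diff conv_sq b p vW)
  have diff: "ns_rhs \<eta> u i x - ns_rhs \<eta> v i x = (\<Sum>j\<in>UNIV. conv (pd j (pd j \<eta>)) (w i) x) - (\<Sum>j\<in>UNIV. conv (pd j \<eta>) (a i j) x)" for i x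
    unfolding ns_rhs_def w_def[abs_def] a_def[abs_def]
    by (simp add: conv_diff b1 b2 u v p sum_subtractf)
  have visc: "ip (conv (pd j (pd j \<eta>)) (w i)) (W i) = - ip (D i j) (D i j)" for i j
  proof -
    have "conv (pd j (pd j \<eta>)) (w i) = pd j (D i j)"
      unfolding D_def by (rule deriv_along_conv[OF b1 ws, symmetric])
    moreover have "sq (pd j (D i j))" "smooth (D i j)"
      unfolding D_def deriv_along_conv[OF b1 ws] by (intro conv_sq smooth_conv b1 b2 ws)+
    ultimately show ?thesis
      using ip_by_parts[of "D i j" "W i" "axis j 1"] Ws Ds by (simp add: dW)
  qed
  have conv_term: "ip (conv (pd j \<eta>) (a i j)) (W i) = - ip (conv \<eta> (a i j)) (D i j)" for i j
  proof -
    have "conv (pd j \<eta>) (a i j) = pd j (conv \<eta> (a i j))" by (rule deriv_along_conv[OF b as, symmetric])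
    moreover have "sq (pd j (conv \<eta> (a i j)))" unfolding deriv_along_conv[OF b as] by (intro conv_sq b1 as)
    ultimately show ?thesis
      using ip_by_parts[of "conv \<eta> (a i j)" "W i" "axis j 1"] Ws Ds smooth_conv[OF b as] conv_sq[OF b as] by (simp add: dW)
  qed
  have conv_a: "conv \<eta> (a i j) = (\<lambda>x. c i j x + v j x * W i x)" for i j
  proof -
    have "a i j = (\<lambda>x. u i x * w j x + w i x * v j x)" by (simp add: a_def w_def fun_eq_iff algebra_simps)
    then show ?thesis unfolding c_eq by (simp add: conv_add b p)
  qed
  have "(\<Sum>i\<in>UNIV. ip (\<lambda>x. ns_rhs \<eta> u i x - ns_rhs \<eta> v i x) (W i)) =
     (\<Sum>i\<in>UNIV. \<Sum>j\<in>UNIV. - ip (D i j) (D i j) + ip (c i j) (D i j)) + (\<Sum>i\<in>UNIV. \<Sum>j\<in>UNIV. ip (\<lambda>x. v j x * W i x) (D i j))"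
    unfolding diff
    using conv_sq[OF b2 ws] conv_sq[OF b1 as] Ws Ds cs vW
    by (simp add: ip_diff_left ip_sum_left sq_sum visc conv_term conv_a ip_add_left sum_negf sum.distrib sum_subtractf)
  also have "(\<Sum>i\<in>UNIV. \<Sum>j\<in>UNIV. ip (\<lambda>x. v j x * W i x) (D i j)) = 0"
    using transport_energy_zero[of v M' W] v div Ws Ds by (simp add: dW)
  also have "(\<Sum>i\<in>UNIV. \<Sum>j\<in>UNIV. - ip (D i j) (D i j) + ip (c i j) (D i j)) + 0 \<le> (\<Sum>i\<in>UNIV. \<Sum>j\<in>UNIV. 1/4 * ip (c i j) (c i j))"
    unfolding add_0_right
  proof (intro sum_mono)
    fix i j :: 3
    show "- ip (D i j) (D i j) + ip (c i j) (D i j) \<le> 1/4 * ip (c i j) (c i j)"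
      by (rule ip_completed_square[OF Ds cs])
  qed
  finally show ?thesis by (simp add: W_def w_def[abs_def] c_def sum_distrib_left)
qed

text \<open>Together these feed dominated convergence in time: a bound uniform in the kernel, and
  the limit at each fixed time. In the commutator both halves tend to w_i v_j in L^2, the second one
  because multiplication by the bounded v_j is continuous on L^2.\<close>

lemma
  fixes u v :: "3 \<Rightarrow> real^3 \<Rightarrow> real"
  assumes u: "\<And>i. sq (u i)" "\<And>i x. \<bar>u i x\<bar> \<le> M" and v: "\<And>i. sq (v i)" "\<And>i x. \<bar>v i x\<bar> \<le> M'"
    and M: "0 \<le> M" "0 \<le> M'"
  shows nrm_flux_le: "mollifier \<delta> \<eta> \<Longrightarrow>
      nrm (flux \<eta> u v i j) \<le> M * nrm (\<lambda>x. u j x - v j x) + 2 * M' * nrm (\<lambda>x. u i x - v i x)"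
    and nrm_flux_tendsto: "(\<And>n. mollifier (1 / real (Suc n)) (\<eta>s n)) \<Longrightarrow>
      (\<lambda>n. nrm (flux (\<eta>s n) u v i j)) \<longlonglongrightarrow> nrm (\<lambda>x. u i x * (u j x - v j x))"
proof -
  define w where "w i x = u i x - v i x" for i x
  have ws: "sq (w i)" for i unfolding w_def[abs_def] by (intro sq_diff u v)
  note um = sq_measurable[OF u(1)] and vm = sq_measurable[OF v(1)]
  have p1: "sq (\<lambda>x. u i x * w j x)" and p2: "sq (\<lambda>x. w i x * v j x)" for i j
    using sq_bounded_mult[OF ws um u(2)] sq_bounded_mult[OF ws vm v(2)] by (simp_all add: mult.commute)
  have p3: "sq (\<lambda>x. v j x * conv \<eta> (w i) x)" if "mollifier \<delta> \<eta>" for \<eta> \<delta> i j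
    by (rule sq_bounded_mult[OF conv_sq[OF mollifier_bump[OF that] ws] vm v(2)])
  have f: "flux \<eta> u v i j = (\<lambda>x. conv \<eta> (\<lambda>y. u i y * w j y) x + (conv \<eta> (\<lambda>y. w i y * v j y) x - v j x * conv \<eta> (w i) x))" for \<eta>
    by (simp add: flux_def[abs_def] w_def[abs_def])
  have fs: "sq (flux \<eta> u v i j)" if "mollifier \<delta> \<eta>" for \<eta> \<delta>
    unfolding f by (intro sq_add sq_diff conv_sq mollifier_bump[OF that] p1 p2 p3[OF that])
  have n1: "nrm (\<lambda>x. u i x * w j x) \<le> M * nrm (w j)" "nrm (\<lambda>x. v j x * w i x) \<le> M' * nrm (w i)"
    by (intro nrm_bounded_mult ws um vm u v M)+
  {
    assume \<eta>: "mollifier \<delta> \<eta>"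
    note b = mollifier_bump[OF \<eta>]
    have "nrm (flux \<eta> u v i j) \<le> nrm (conv \<eta> (\<lambda>y. u i y * w j y)) + nrm (\<lambda>x. conv \<eta> (\<lambda>y. w i y * v j y) x - v j x * conv \<eta> (w i) x)"
      unfolding f by (intro nrm_triangle sq_diff conv_sq b p1 p2 p3[OF \<eta>])
    moreover have "nrm (\<lambda>x. conv \<eta> (\<lambda>y. w i y * v j y) x - v j x * conv \<eta> (w i) x) \<le> nrm (conv \<eta> (\<lambda>y. w i y * v j y)) + nrm (\<lambda>x. v j x * conv \<eta> (w i) x)"
      by (intro nrm_triangle_diff conv_sq b p2 p3[OF \<eta>])
    moreover have "nrm (conv \<eta> (\<lambda>y. u i y * w j y)) \<le> nrm (\<lambda>y. u i y * w j y)" by (rule nrm_mollify_le[OF \<eta> p1])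
    moreover have "nrm (conv \<eta> (\<lambda>y. w i y * v j y)) \<le> nrm (\<lambda>y. v j y * w i y)"
      using nrm_mollify_le[OF \<eta> p2, of i j] by (simp add: mult.commute)
    moreover have "nrm (\<lambda>x. v j x * conv \<eta> (w i) x) \<le> M' * nrm (conv \<eta> (w i))"
      by (intro nrm_bounded_mult conv_sq b ws vm v M)
    moreover have "M' * nrm (conv \<eta> (w i)) \<le> M' * nrm (w i)"
      by (rule mult_left_mono[OF nrm_mollify_le[OF \<eta> ws] M(2)])
    ultimately have "nrm (flux \<eta> u v i j) \<le> M * nrm (w j) + 2 * M' * nrm (w i)"
      using n1 by linarith
    then show "nrm (flux \<eta> u v i j) \<le> M * nrm (\<lambda>x. u j x - v j x) + 2 * M' * nrm (\<lambda>x. u i x - v i x)"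
      by (simp add: w_def[abs_def])
  }
  assume \<eta>: "\<And>n. mollifier (1 / real (Suc n)) (\<eta>s n)"
  note b = mollifier_bump[OF \<eta>]
  have up: "\<bar>nrm (flux (\<eta>s n) u v i j) - nrm (\<lambda>x. u i x * w j x)\<bar> \<le>
     nrm (\<lambda>x. conv (\<eta>s n) (\<lambda>y. u i y * w j y) x - u i x * w j x) + nrm (\<lambda>x. conv (\<eta>s n) (\<lambda>y. w i y * v j y) x - w i x * v j x)
      + M' * nrm (\<lambda>x. conv (\<eta>s n) (w i) x - w i x)" for n
  proof -
    have s: "sq (\<lambda>x. conv (\<eta>s n) (\<lambda>y. u i y * w j y) x - u i x * w j x)" "sq (\<lambda>x. conv (\<eta>s n) (\<lambda>y. w i y * v j y) x - w i x * v j x)"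
      "sq (\<lambda>x. conv (\<eta>s n) (w i) x - w i x)"
      by (intro sq_diff conv_sq b p1 p2 ws)+
    have s3: "sq (\<lambda>x. v j x * (conv (\<eta>s n) (w i) x - w i x))" by (rule sq_bounded_mult[OF s(3) vm v(2)])
    have eq: "(\<lambda>x. flux (\<eta>s n) u v i j x - u i x * w j x) = (\<lambda>x. (conv (\<eta>s n) (\<lambda>y. u i y * w j y) x - u i x * w j x) +
      ((conv (\<eta>s n) (\<lambda>y. w i y * v j y) x - w i x * v j x) - v j x * (conv (\<eta>s n) (w i) x - w i x)))"
      unfolding f by (simp add: fun_eq_iff algebra_simps)
    have "\<bar>nrm (flux (\<eta>s n) u v i j) - nrm (\<lambda>x. u i x * w j x)\<bar> \<le> nrm (\<lambda>x. flux (\<eta>s n) u v i j x - u i x * w j x)"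
      by (rule nrm_reverse_triangle[OF fs[OF \<eta>] p1])
    also have "\<dots> \<le> nrm (\<lambda>x. conv (\<eta>s n) (\<lambda>y. u i y * w j y) x - u i x * w j x) +
       (nrm (\<lambda>x. conv (\<eta>s n) (\<lambda>y. w i y * v j y) x - w i x * v j x) + nrm (\<lambda>x. v j x * (conv (\<eta>s n) (w i) x - w i x)))"
      unfolding eq
      by (rule order_trans[OF nrm_triangle[OF s(1) sq_diff[OF s(2) s3]] add_left_mono[OF nrm_triangle_diff[OF s(2) s3]]])
    also have "nrm (\<lambda>x. v j x * (conv (\<eta>s n) (w i) x - w i x)) \<le> M' * nrm (\<lambda>x. conv (\<eta>s n) (w i) x - w i x)"
      by (intro nrm_bounded_mult s vm v M)
    finally show ?thesis by simp
  qed
  have "(\<lambda>n. nrm (\<lambda>x. conv (\<eta>s n) (\<lambda>y. u i y * w j y) x - u i x * w j x) + nrm (\<lambda>x. conv (\<eta>s n) (\<lambda>y. w i y * v j y) x - w i x * v j x)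
      + M' * nrm (\<lambda>x. conv (\<eta>s n) (w i) x - w i x)) \<longlonglongrightarrow> 0 + 0 + M' * 0"
    by (intro tendsto_add tendsto_mult tendsto_const mollify_tendsto[OF _ \<eta>] p1 p2 ws)
  then have lim0: "(\<lambda>n. nrm (\<lambda>x. conv (\<eta>s n) (\<lambda>y. u i y * w j y) x - u i x * w j x) + nrm (\<lambda>x. conv (\<eta>s n) (\<lambda>y. w i y * v j y) x - w i x * v j x)
      + M' * nrm (\<lambda>x. conv (\<eta>s n) (w i) x - w i x)) \<longlonglongrightarrow> 0"
    by simp
  have "(\<lambda>n. nrm (flux (\<eta>s n) u v i j) - nrm (\<lambda>x. u i x * w j x)) \<longlonglongrightarrow> 0"
    by (rule Lim_null_comparison[OF always_eventually lim0]) (use up in auto)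
  then show "(\<lambda>n. nrm (flux (\<eta>s n) u v i j)) \<longlonglongrightarrow> nrm (\<lambda>x. u i x * (u j x - v j x))"
    by (simp add: LIM_zero_iff w_def[abs_def])
qed

section \<open>Removing the mollification\<close>

text \<open>The sum over i is taken under the integral, where the joint bound on the squares of u
  applies; componentwise bounds would lose a factor 3.\<close>

lemma sum_ip_product_le:
  fixes u :: "3 \<Rightarrow> real^3 \<Rightarrow> real"
  assumes u: "\<And>i. u i \<in> borel_measurable borel" "\<And>x. (\<Sum>i\<in>UNIV. (u i x)\<^sup>2) \<le> M\<^sup>2" "0 \<le> M" and w: "sq w"
  shows "(\<Sum>i\<in>UNIV. ip (\<lambda>x. u i x * w x) (\<lambda>x. u i x * w x)) \<le> M\<^sup>2 * ip w w"
proof -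
  have uw: "sq (\<lambda>x. u i x * w x)" for i
    by (rule sq_bounded_mult[OF w u(1) component_le[OF u(2,3)]])
  have "(\<Sum>i\<in>UNIV. ip (\<lambda>x. u i x * w x) (\<lambda>x. u i x * w x)) = (LINT x|lborel. (\<Sum>i\<in>UNIV. (u i x * w x)\<^sup>2))"
    using sq_integrable[OF uw] by (simp add: ip_self_eq)
  also have "\<dots> \<le> (LINT x|lborel. M\<^sup>2 * (w x)\<^sup>2)"
  proof (rule integral_mono)
    show "(\<Sum>i\<in>UNIV. (u i x * w x)\<^sup>2) \<le> M\<^sup>2 * (w x)\<^sup>2" for x
      using mult_right_mono[OF u(2), of "(w x)\<^sup>2" x] by (simp add: power_mult_distrib sum_distrib_right)
  qed (intro Bochner_Integration.integrable_sum integrable_mult_right sq_integrable uw w)+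
  finally show ?thesis by (simp add: ip_self_eq)
qed

text \<open>The mollified energies satisfy the identity with rate G n, and at each time G n <= q n,
  where the limit of q n is at most k. The kernels are removed in the integrated form, so nothing is
  claimed about a derivative of y.\<close>

lemma energy_inequality:
  assumes U: "component_solution T m U" and V: "component_solution T m' V" and ab: "0 < a" "a < b" "b < T"
  defines "y \<equiv> \<lambda>t. \<Sum>i\<in>UNIV. ip (\<lambda>x. U t i x - V t i x) (\<lambda>x. U t i x - V t i x)"
  shows "y b - y a \<le> integral {a..b} (\<lambda>t. 1/2 * (m t)\<^sup>2 * y t)"
proof -
  define I where "I = {0<..<T}"
  have sub: "{a..b} \<subseteq> I" using ab by (auto simp: I_def)
  define w where "w t i x = U t i x - V t i x" for t i x
  note LU = component_solutionD(1)[OF U, folded I_def] and LV = component_solutionD(1)[OF V, folded I_def]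
  note mc = component_solutionD(2)[OF U, folded I_def] component_solutionD(2)[OF V, folded I_def]
  note m0 = component_solutionD(3)[OF U, folded I_def] component_solutionD(3)[OF V, folded I_def]
  note Um = component_solutionD(5)[OF U, folded I_def] and Vm = component_solutionD(5)[OF V, folded I_def]
  note Us = component_solutionD(7)[OF U, folded I_def] and Vs = component_solutionD(7)[OF V, folded I_def]
  have Lw: "l2cont I (\<lambda>t. w t i)" for i
    unfolding w_def[abs_def] by (rule l2cont_diff[OF LU LV])
  note ws = l2contD(1)[OF Lw]
  have y_eq: "y t = (\<Sum>i\<in>UNIV. ip (w t i) (w t i))" for t
    by (simp add: y_def w_def[abs_def])
  have yc: "continuous_on I y"
    unfolding y_eq[abs_def] by (intro continuous_on_sum l2cont_ip Lw)
  have y0: "0 \<le> y t" for t unfolding y_eq by (intro sum_nonneg) simp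
  define k where "k t = 1/2 * (m t)\<^sup>2 * y t" for t
  have kc: "continuous_on I k" unfolding k_def[abs_def] by (intro continuous_intros mc yc)
  have k0: "0 \<le> k t" for t unfolding k_def using y0[of t] by simp
  have "\<forall>n. \<exists>\<eta>. mollifier (1 / real (Suc n)) \<eta>"
    using mollifier_exists by simp
  from choice[OF this] obtain \<eta> where \<eta>: "\<And>n. mollifier (1 / real (Suc n)) (\<eta> n)" by blast
  define E where "E n t = (\<Sum>i\<in>UNIV. ip (conv (\<eta> n) (w t i)) (conv (\<eta> n) (w t i)))" for n t
  define G where "G n t = 2 * (\<Sum>i\<in>UNIV. ip (\<lambda>x. ns_rhs (\<eta> n) (U t) i x - ns_rhs (\<eta> n) (V t) i x) (conv (\<eta> n) (w t i)))" for n t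
  define q where "q n t = 1/2 * (\<Sum>i\<in>UNIV. \<Sum>j\<in>UNIV. (nrm (flux (\<eta> n) (U t) (V t) i j))\<^sup>2)" for n t
  \<comment> \<open>G n has no lower bound uniform in n, as it contains minus the squared norm of D,
    and q n is not shown to be integrable in time. The maximum with k is continuous, dominates G n,
    and is squeezed between k and max(q n, k), which tends to k.\<close>
  define h where "h n t = max (G n t) (k t)" for n t
  \<comment> \<open>A continuous majorant of q n + k independent of n: \<open>nrm_flux_le\<close> is
    inserted for the flux.\<close>
  define C where "C t = 1/2 * (\<Sum>i\<in>UNIV. \<Sum>j\<in>UNIV. (m t * nrm (w t j) + 2 * m' t * nrm (w t i))\<^sup>2) + k t" for t
  have Gc: "continuous_on I (G n)" for n
    unfolding G_def[abs_def]
    by (intro continuous_on_mult continuous_on_const continuous_on_sum l2cont_ip l2cont_diff l2cont_conv Lw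
        l2cont_ns_rhs[OF U \<eta>, folded I_def] l2cont_ns_rhs[OF V \<eta>, folded I_def] mollifier_bump[OF \<eta>])
  have hc: "continuous_on I (h n)" for n unfolding h_def[abs_def] by (intro continuous_on_max Gc kc)
  have Cc: "continuous_on I C"
    unfolding C_def[abs_def] by (intro continuous_intros kc mc l2cont_nrm Lw)
  have Gq: "G n t \<le> q n t" if t: "t \<in> I" for n t
  proof -
    have "(\<Sum>i\<in>UNIV. ip (\<lambda>x. ns_rhs (\<eta> n) (U t) i x - ns_rhs (\<eta> n) (V t) i x) (conv (\<eta> n) (\<lambda>x. U t i x - V t i x)))
      \<le> 1/4 * (\<Sum>i\<in>UNIV. \<Sum>j\<in>UNIV. ip (flux (\<eta> n) (U t) (V t) i j) (flux (\<eta> n) (U t) (V t) i j))"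
      by (rule energy_estimate[OF \<eta>, where M = "m t" and M' = "m' t"])
        (intro Us Um Vs Vm component_solutionD(6)[OF V, folded I_def] t; assumption)+
    then show ?thesis unfolding G_def q_def nrm_power2 w_def[abs_def] by simp
  qed
  have qC: "q n t + k t \<le> C t" if t: "t \<in> I" for n t
  proof -
    have "(nrm (flux (\<eta> n) (U t) (V t) i j))\<^sup>2 \<le> (m t * nrm (w t j) + 2 * m' t * nrm (w t i))\<^sup>2" for i j
      unfolding w_def[abs_def]
      by (intro power_mono nrm_nonneg nrm_flux_le[where M = "m t" and M' = "m' t", OF _ _ _ _ _ _ \<eta>] Us Um Vs Vm m0 t)
    then show ?thesis unfolding q_def C_def by (simp add: sum_mono)
  qed
  have q_lim: "(\<lambda>n. q n t) \<longlonglongrightarrow> 1/2 * (\<Sum>i\<in>UNIV. \<Sum>j\<in>UNIV. (nrm (\<lambda>x. U t i x * w t j x))\<^sup>2)" if t: "t \<in> I" for t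
    unfolding q_def w_def
    by (intro tendsto_mult tendsto_const tendsto_sum tendsto_power
        nrm_flux_tendsto[where M = "m t" and M' = "m' t"] Us Um Vs Vm m0 \<eta> t)
  have q_lim_le: "1/2 * (\<Sum>i\<in>UNIV. \<Sum>j\<in>UNIV. (nrm (\<lambda>x. U t i x * w t j x))\<^sup>2) \<le> k t" if t: "t \<in> I" for t
  proof -
    have "(\<Sum>j\<in>UNIV. \<Sum>i\<in>UNIV. ip (\<lambda>x. U t i x * w t j x) (\<lambda>x. U t i x * w t j x)) \<le> (\<Sum>j\<in>UNIV. (m t)\<^sup>2 * ip (w t j) (w t j))"
      using component_solutionD(4)[OF U, folded I_def, OF t]
      by (intro sum_mono sum_ip_product_le sq_measurable[OF Us[OF t]] m0(1)[OF t] ws[OF t])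
    then have "(\<Sum>i\<in>UNIV. \<Sum>j\<in>UNIV. (nrm (\<lambda>x. U t i x * w t j x))\<^sup>2) \<le> (m t)\<^sup>2 * y t"
      unfolding nrm_power2 y_eq sum_distrib_left by (subst sum.swap)
    then show ?thesis by (simp add: k_def)
  qed
  have E_int: "E n b - E n a = integral {a..b} (G n)" for n
  proof -
    have "(G n has_integral E n b - E n a) {a..b}"
    proof (rule fundamental_theorem_of_calculus)
      fix t assume "t \<in> {a..b}"
      then have "t \<in> {0<..<T}" using sub by (auto simp: I_def)
      from mollified_energy_derivative[OF U V \<eta> this, of n]
      have "(E n has_real_derivative G n t) (at t)"
        by (simp add: E_def[abs_def] G_def w_def[abs_def])
      then show "(E n has_vector_derivative G n t) (at t within {a..b})"
        by (simp add: has_real_derivative_iff_has_vector_derivative has_vector_derivative_at_within)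
    qed (use ab in simp)
    then show ?thesis by (simp add: integral_unique)
  qed
  have int: "f integrable_on {a..b}" if "continuous_on I f" for f :: "real \<Rightarrow> real"
    by (intro integrable_continuous_interval continuous_on_subset[OF that sub])
  have le: "E n b - E n a \<le> integral {a..b} (h n)" for n
    unfolding E_int by (intro integral_le int Gc hc) (simp add: h_def)
  have "(\<lambda>n. integral {a..b} (h n)) \<longlonglongrightarrow> integral {a..b} k"
  proof (rule dominated_convergence(2)[where h = C])
    show "h n integrable_on {a..b}" "C integrable_on {a..b}" for n by (intro int hc Cc)+
    fix t assume "t \<in> {a..b}"
    then have t: "t \<in> I" using sub by blast
    have q0: "0 \<le> q n t" for n unfolding q_def by (intro mult_nonneg_nonneg sum_nonneg) auto
    have hq: "h n t \<le> max (q n t) (k t)" "k t \<le> h n t" for n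
      using Gq[OF t, of n] by (auto simp: h_def)
    show "norm (h n t) \<le> C t" for n
      using hq[of n] qC[OF t, of n] k0[of t] q0[of n] by simp
    show "(\<lambda>n. h n t) \<longlonglongrightarrow> k t"
    proof (rule tendsto_sandwich[OF always_eventually always_eventually tendsto_const])
      have "(\<lambda>n. max (q n t) (k t)) \<longlonglongrightarrow> max (1/2 * (\<Sum>i\<in>UNIV. \<Sum>j\<in>UNIV. (nrm (\<lambda>x. U t i x * w t j x))\<^sup>2)) (k t)"
        by (intro tendsto_max q_lim[OF t] tendsto_const)
      then show "(\<lambda>n. max (q n t) (k t)) \<longlonglongrightarrow> k t" using q_lim_le[OF t] by (simp add: max_absorb2)
    qed (use hq in auto)
  qed
  moreover have E_lim: "(\<lambda>n. E n t) \<longlonglongrightarrow> y t" if t: "t \<in> I" for t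
  proof -
    have "(\<lambda>n. nrm (conv (\<eta> n) (w t i))) \<longlonglongrightarrow> nrm (w t i)" for i
    proof -
      have "(\<lambda>n. nrm (conv (\<eta> n) (w t i)) - nrm (w t i)) \<longlonglongrightarrow> 0"
        by (rule Lim_null_comparison[OF always_eventually mollify_tendsto[OF ws[OF t] \<eta>]])
          (use nrm_reverse_triangle[OF conv_sq[OF mollifier_bump[OF \<eta>] ws[OF t]] ws[OF t]] in auto)
      then show ?thesis by (simp add: LIM_zero_iff)
    qed
    then show ?thesis unfolding E_def y_eq nrm_power2[symmetric] by (intro tendsto_sum tendsto_power)
  qed
  have "(\<lambda>n. E n b - E n a) \<longlonglongrightarrow> y b - y a"
    using ab by (intro tendsto_diff E_lim) (auto simp: I_def)
  ultimately have "y b - y a \<le> integral {a..b} k"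
    using le by (intro LIMSEQ_le[of "\<lambda>n. E n b - E n a" _ "\<lambda>n. integral {a..b} (h n)"]) auto
  then show ?thesis by (simp add: k_def[abs_def])
qed

text \<open>The right side of the integral inequality, Z(t) = y(a) plus the integral of k y, is
  differentiable while y is merely continuous. Since y <= Z and k >= 0, Z' = k y <= k Z, so Z times
  exp of minus the antiderivative of k is nonincreasing.\<close>

lemma gronwall_integral:
  fixes y k :: "real \<Rightarrow> real"
  assumes y: "continuous_on {0<..<T} y" and k: "continuous_on {0<..<T} k" "\<And>t. 0 \<le> k t"
    and ab: "0 < a" "a < b" "b < T"
    and le: "\<And>t. a < t \<Longrightarrow> t \<le> b \<Longrightarrow> y t - y a \<le> integral {a..t} (\<lambda>s. k s * y s)"
  shows "y b \<le> y a * exp (integral {a..b} k)"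
proof -
  have T: "0 < T" using ab by simp
  obtain P where P: "\<And>x. 0 < x \<Longrightarrow> x < T \<Longrightarrow> (P has_real_derivative k x) (at x)"
    and P_int: "\<And>a b. 0 < a \<Longrightarrow> a \<le> b \<Longrightarrow> b < T \<Longrightarrow> integral {a..b} k = P b - P a"
    using antiderivative_on_interval[OF k(1) T] by blast
  obtain Q where Q: "\<And>x. 0 < x \<Longrightarrow> x < T \<Longrightarrow> (Q has_real_derivative k x * y x) (at x)"
    and Q_int: "\<And>a b. 0 < a \<Longrightarrow> a \<le> b \<Longrightarrow> b < T \<Longrightarrow> integral {a..b} (\<lambda>x. k x * y x) = Q b - Q a"
    using antiderivative_on_interval[OF continuous_on_mult[OF k(1) y] T] by blast
  define Z where "Z t = y a + (Q t - Q a)" for t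
  have yZ: "y t \<le> Z t" if "a \<le> t" "t \<le> b" for t
  proof (cases "t = a")
    case False
    then show ?thesis using le[of t] Q_int[of a t] ab that by (simp add: Z_def)
  qed (simp add: Z_def)
  define g where "g t = Z t * exp (- P t)" for t
  have "g b \<le> g a"
  proof (rule DERIV_nonpos_imp_nonincreasing[of a b g])
    fix t assume t: "a \<le> t" "t \<le> b"
    then have t': "0 < t" "t < T" using ab by auto
    have "(g has_real_derivative Z t * (exp (- P t) * (- k t)) + k t * y t * exp (- P t)) (at t)"
      unfolding g_def[abs_def] Z_def[abs_def]
      by (intro DERIV_mult') (auto intro!: derivative_eq_intros P[OF t'] Q[OF t'])
    moreover have "Z t * (exp (- P t) * (- k t)) + k t * y t * exp (- P t) \<le> 0"
    proof -
      have "k t * (y t - Z t) \<le> 0" using yZ[OF t] k(2)[of t] by (simp add: mult_nonneg_nonpos)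
      then have "k t * (y t - Z t) * exp (- P t) \<le> 0" by (simp add: mult_nonpos_nonneg)
      then show ?thesis by (simp add: algebra_simps)
    qed
    ultimately show "\<exists>z. (g has_real_derivative z) (at t) \<and> z \<le> 0" by blast
  qed (use ab in simp)
  then have "Z b * exp (- P b) \<le> y a * exp (- P a)" by (simp add: g_def Z_def)
  then have "Z b * exp (- P b) * exp (P b) \<le> y a * exp (- P a) * exp (P b)"
    by (rule mult_right_mono) simp
  then have "Z b \<le> y a * exp (P b - P a)"
    by (simp add: mult.assoc exp_add[symmetric])
  then show ?thesis using yZ[of b] P_int[of a b] ab by simp
qed

theorem lemma3p5:
  fixes T t1 t2 :: real
    and u v w :: "real \<Rightarrow> vfield"
  assumes "T > 0"
    and "strong_solution T u"
    and "strong_solution T v"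
    and "w = (\<lambda>t x. u t x - v t x)"
    and "t1 \<in> {0<..<T}" and "t2 \<in> {0<..<T}" and "t1 < t2"
  shows "(L2_norm (w t2))\<^sup>2 \<le>
    (L2_norm (w t1))\<^sup>2 * exp (1/2 * (LINT s:{t1..t2}|lebesgue. (Linf_norm (u s))\<^sup>2))"
proof -
  define m where "m t = Linf_norm (u t)" for t
  obtain U where "component_solution T (\<lambda>t. Linf_norm (u t)) U"
    and Ua: "\<And>t. t \<in> {0<..<T} \<Longrightarrow> AE x in lborel. \<forall>i. U t i x = u t x $ i"
    using strong_solution_components[OF assms(2)] by blast
  then have U: "component_solution T m U" by (simp add: m_def[abs_def])
  obtain V where V: "component_solution T (\<lambda>t. Linf_norm (v t)) V"
    and Va: "\<And>t. t \<in> {0<..<T} \<Longrightarrow> AE x in lborel. \<forall>i. V t i x = v t x $ i"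
    using strong_solution_components[OF assms(3)] by blast
  define y where "y t = (\<Sum>i\<in>UNIV. ip (\<lambda>x. U t i x - V t i x) (\<lambda>x. U t i x - V t i x))" for t
  have wy: "(L2_norm (w t))\<^sup>2 = y t" if t: "t \<in> {0<..<T}" for t
    unfolding y_def
  proof (rule L2_norm_representative)
    show "sq (\<lambda>x. U t i x - V t i x)" for i
      by (intro sq_diff component_solutionD(7)[OF U t] component_solutionD(7)[OF V t])
    show "AE x in lborel. \<forall>i. U t i x - V t i x = w t x $ i"
      using Ua[OF t] Va[OF t] by eventually_elim (simp add: assms(4))
  qed
  have yc: "continuous_on {0<..<T} y"
    unfolding y_def[abs_def]
    by (intro continuous_on_sum l2cont_ip l2cont_diff component_solutionD(1)[OF U] component_solutionD(1)[OF V])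
  have mc: "continuous_on {0<..<T} (\<lambda>t. 1/2 * (m t)\<^sup>2)"
    by (intro continuous_intros component_solutionD(2)[OF U])
  have t: "0 < t1" "t1 < t2" "t2 < T" using assms by auto
  have "y t2 \<le> y t1 * exp (integral {t1..t2} (\<lambda>t. 1/2 * (m t)\<^sup>2))"
  proof (rule gronwall_integral[OF yc mc _ t])
    fix s assume "t1 < s" "s \<le> t2"
    then show "y s - y t1 \<le> integral {t1..s} (\<lambda>t. 1/2 * (m t)\<^sup>2 * y t)"
      using energy_inequality[OF U V, of t1 s] t by (simp add: y_def)
  qed simp
  moreover have "integral {t1..t2} (\<lambda>t. 1/2 * (m t)\<^sup>2) = 1/2 * (LINT s:{t1..t2}|lebesgue. (Linf_norm (u s))\<^sup>2)"
  proof -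
    have "continuous_on {t1..t2} (\<lambda>t. (m t)\<^sup>2)"
      using t by (intro continuous_intros continuous_on_subset[OF component_solutionD(2)[OF U]]) auto
    from set_lebesgue_integral_eq_integral(2)[OF absolutely_integrable_continuous_real[OF this]]
    show ?thesis by (simp add: m_def)
  qed
  ultimately show ?thesis using wy assms(5,6) by simp
qed

end
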